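(* Let $n\geq 2$, and fix $a_1,\ldots,a_n\in L^1_{\mathrm{loc}}(\mathbb{R})$ (complex valued). Let $\varphi_1,\ldots,\varphi_n$ be the auxiliary functions associated with $a_1,\ldots,a_n$, which are defined in a neighbourhood of $x=0$. For each $1\leq k\leq n$, denote by $\psi_{n,k}$ the unique solution to $$y^{(n)}=a_1y^{(n-1)}+a_2y^{(n-2)}+\cdots+a_{n-1}y^\prime+a_ny$$ such that $y=\psi_{n,k}$ satisfies the initial conditions $$y^{(j-1)}(0)=\delta_{j,k}\qquad(1\leq j\leq n).$$ Then for each $1\leq k\leq n$, there is an open neighbourhood of $x=0$ in which $\psi_{n,k}(x)$ is given in terms of the auxiliary functions by the formula $$\psi_{n,k}=T_{\varphi_{\eta(1)},\ldots,\varphi_{\eta(n)};\,\eta^{-1}(n)}\quad\text{ where }\quad\eta=\pi_n^{k-1}.$$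
   Context: Conventions. $L^1_{\mathrm{loc}}(\mathbb{R})$ denotes the complex valued locally integrable functions on $\mathbb{R}$, and $AC_{\mathrm{loc}}(\mathbb{R})$ the locally absolutely continuous ones. A solution $y$ of an order-$n$ linear equation with locally integrable coefficients is a function with $y^{(n-1)}$ locally absolutely continuous, the equation holding almost everywhere. $\delta_{j,k}$ is the Kronecker delta. Shift permutation. $\pi_n$ is the permutation of $\{1,\ldots,n\}$ for which $\pi_n(j)$ is the unique element of $\{1,\ldots,n\}$ congruent to $j-1$ modulo $n$; $\pi_n^k$ is its $k$-fold composition, with $\pi_n^0$ the identity. Trig operators. Let $\nu:\mathbb{Z}_{\geq 0}\rightarrow\{1,\ldots,n\}$ map each $j\geq 0$ to the unique element of $\{1,\ldots,n\}$ congruent to $j$ modulo $n$ (so $\nu(0)=n$). For locally integrable $f_1,\ldots,f_n$ and $j\geq 1$ set $$\mathcal{S}^j_{f_1,\ldots,f_n}(x)=\int_{0<s_1<\cdots<s_j<x}f_{\nu(1)}(s_1)f_{\nu(2)}(s_2)\cdots f_{\nu(j)}(s_j)\,ds_1\cdots ds_j\quad\text{if }x\geq 0,$$ $$\mathcal{S}^j_{f_1,\ldots,f_n}(x)=(-1)^j\int_{x<s_j<\cdots<s_1<0}f_{\nu(1)}(s_1)f_{\nu(2)}(s_2)\cdots f_{\nu(j)}(s_j)\,ds_1\cdots ds_j\quad\text{if }x\leq 0,$$ and $\mathcal{S}^0_{f_1,\ldots,f_n}(x)=1$. For $1\leq j\leq n$ define $$T_{f_1,\ldots,f_n;j}=\sum_{k\geq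 0,\ \nu(k)=j}\mathcal{S}^k_{f_1,\ldots,f_n}$$ (the series converges absolutely, uniformly on compact sets). If the $f_i$ are defined and integrable only on an open interval containing $0$, the same formulas define $T_{f_1,\ldots,f_n;j}(x)$ for $x$ in that interval, since only values of the $f_i$ between $0$ and $x$ are used. Auxiliary functions. Set $a=(-1,a_1,\ldots,a_n)^t$ and $D=\frac{d}{dx}$. Let $\mathscr{D}$ be the $(n+1)\times(n+1)$ upper triangular Toeplitz matrix of differential operators with first row $(0,1,D,D^2,\ldots,D^{n-1})$; that is, its $(i,j)$ entry is $D^{j-i-1}$ if $j>i$ (with $D^0=1$) and $0$ if $j\leq i$. It acts on vector functions by $(\mathscr{D}w)_i=\sum_{j>i}D^{j-i-1}w_j$. Vectors $\alpha^k=(\alpha^k_1,\ldots,\alpha^k_{n+1})^t$ and scalar functions $\varphi_k$ are defined by downward iteration. Set $\alpha^n=(0,\ldots,0,1)^t\in\mathbb{C}^{n+1}$. For each $k=n,n-1,\ldots,2$, given $\alpha^k$, let $\varphi_k$ be the unique local solution (in a neighbourhood of $x=0$) to the equation in the unknown scalar function $u$ $$a^t\mathscr{D}\bigl(u\alpha^k\bigr)=0$$ such that $u=\varphi_k$ satisfies the initial conditions $u^{(j-1)}(0)=\delta_{j,1}$ for $1\leq j\leq k-1$; then set $\alpha^{k-1}=\mathscr{D}\bigl(\varphi_k\alpha^k\bigr)$. (For each $k$ this is a linear equation in $u$ of order at most $k-1$, and $\alpha^k_j=0$ for $k+1\leq j\leq n+1$ when $k<n$.) Lastly, $\varphi_1$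 is defined near $x=0$ by $\varphi_1\varphi_2\cdots\varphi_n=a_n$. *)

theory Defs
  imports "HOL-Analysis.Analysis" "HOL-Combinatorics.Permutations" "HOL-Number_Theory.Cong"
begin

definition locally_integrable :: "(real \<Rightarrow> complex) \<Rightarrow> bool" where
  "locally_integrable f \<longleftrightarrow> (\<forall>c d. f absolutely_integrable_on {c..d})"

definition AC_on_interval :: "real \<Rightarrow> real \<Rightarrow> (real \<Rightarrow> complex) \<Rightarrow> bool" where
  "AC_on_interval c d f \<longleftrightarrow>
     (\<forall>\<epsilon>>0. \<exists>\<delta>>0. \<forall>(m::nat) u v.
        (\<forall>i<m. c \<le> u i \<and> u i \<le> v i \<and> v i \<le> d) \<longrightarrow>
        disjoint_family_on (\<lambda>i. {u i<..<v i}) {..<m} \<longrightarrow>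
        (\<Sum>i<m. v i - u i) < \<delta> \<longrightarrow>
        (\<Sum>i<m. norm (f (v i) - f (u i))) < \<epsilon>)"

definition locally_AC_on :: "real set \<Rightarrow> (real \<Rightarrow> complex) \<Rightarrow> bool" where
  "locally_AC_on I f \<longleftrightarrow> (\<forall>c d. {c..d} \<subseteq> I \<longrightarrow> AC_on_interval c d f)"

text \<open>The classical pointwise derivative. Its value is unspecified at points where the derivative
  does not exist; below, it is only used where the derivative exists everywhere or almost everywhere.\<close>

definition nderiv :: "nat \<Rightarrow> (real \<Rightarrow> complex) \<Rightarrow> real \<Rightarrow> complex" where
  "nderiv m = (\<lambda>f x. vector_derivative f (at x)) ^^ m"

text \<open>\<open>f\<close> is \<open>m\<close> times differentiable on \<open>I\<close> and its \<open>m\<close>-th derivative is locally absolutely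
  continuous there. This is the regularity required of solutions of an equation of order \<open>m + 1\<close>.\<close>

definition AC_nderiv_on :: "real set \<Rightarrow> nat \<Rightarrow> (real \<Rightarrow> complex) \<Rightarrow> bool" where
  "AC_nderiv_on I m f \<longleftrightarrow>
     (\<forall>i<m. \<forall>x\<in>I. nderiv i f differentiable (at x)) \<and> locally_AC_on I (nderiv m f)"

definition fundamental_solution ::
    "nat \<Rightarrow> (nat \<Rightarrow> real \<Rightarrow> complex) \<Rightarrow> nat \<Rightarrow> (real \<Rightarrow> complex) \<Rightarrow> bool" where
  "fundamental_solution n a k y \<longleftrightarrow>
     AC_nderiv_on UNIV (n - 1) y \<and>
     (AE x in lebesgue. nderiv n y x = (\<Sum>j=1..n. a j x * nderiv (n - j) y x)) \<and>
     (\<forall>j\<in>{1..n}. nderiv (j - 1) y 0 = (if j = k then 1 else 0))"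

definition shift_perm :: "nat \<Rightarrow> nat \<Rightarrow> nat" where
  "shift_perm n j = (if j = 1 then n else if 1 < j \<and> j \<le> n then j - 1 else j)"

lemma shift_perm_cong:
  assumes "j \<in> {1..n}"
  shows "shift_perm n j \<in> {1..n}" "[int (shift_perm n j) = int j - 1] (mod int n)"
  using assms by (auto simp: shift_perm_def cong_def of_nat_diff)

lemma shift_perm_permutes:
  assumes "n \<ge> 1"
  shows "shift_perm n permutes {1..n}"
proof (rule bij_imp_permutes)
  have "inj_on (shift_perm n) {1..n}"
    by (auto simp: inj_on_def shift_perm_def split: if_splits)
  moreover have "shift_perm n ` {1..n} \<subseteq> {1..n}"
    using shift_perm_cong(1) by blast
  ultimately show "bij_betw (shift_perm n) {1..n} {1..n}"
    by (simp add: bij_betw_def endo_inj_surj)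
qed (use assms in \<open>auto simp: shift_perm_def\<close>)

definition residue_index :: "nat \<Rightarrow> nat \<Rightarrow> nat" where
  "residue_index n k = (if k mod n = 0 then n else k mod n)"

lemma residue_index_cong:
  assumes "n \<ge> 1"
  shows "residue_index n k \<in> {1..n}" "[residue_index n k = k] (mod n)"
  using assms by (auto simp: residue_index_def cong_def intro: order_less_imp_le)

definition trig_S :: "nat \<Rightarrow> (nat \<Rightarrow> real \<Rightarrow> complex) \<Rightarrow> nat \<Rightarrow> real \<Rightarrow> complex" where
  "trig_S n f j x =
     (let M = Pi\<^sub>M {1..j} (\<lambda>_. lebesgue :: real measure);
          F = (\<lambda>s. \<Prod>i=1..j. f (residue_index n i) (s i))
      in if j = 0 then 1
         else if x \<ge> 0 then
           set_lebesgue_integral M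
             {s \<in> space M. 0 < s 1 \<and> (\<forall>i\<in>{1..<j}. s i < s (i + 1)) \<and> s j < x} F
         else
           (-1) ^ j * set_lebesgue_integral M
             {s \<in> space M. x < s j \<and> (\<forall>i\<in>{1..<j}. s (i + 1) < s i) \<and> s 1 < 0} F)"

definition trig_T :: "nat \<Rightarrow> (nat \<Rightarrow> real \<Rightarrow> complex) \<Rightarrow> nat \<Rightarrow> real \<Rightarrow> complex" where
  "trig_T n f j x = (\<Sum>\<^sub>\<infinity>k\<in>{k. residue_index n k = j}. trig_S n f k x)"

text \<open>Vectors of length \<open>n + 1\<close> of functions are indexed by \<open>{1..n + 1}\<close>.\<close>

definition coeff_vec :: "(nat \<Rightarrow> real \<Rightarrow> complex) \<Rightarrow> nat \<Rightarrow> real \<Rightarrow> complex" where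
  "coeff_vec a i x = (if i = 1 then -1 else a (i - 1) x)"

definition toeplitz_D :: "nat \<Rightarrow> (nat \<Rightarrow> real \<Rightarrow> complex) \<Rightarrow> nat \<Rightarrow> real \<Rightarrow> complex" where
  "toeplitz_D n w i x = (\<Sum>j=i+1..n+1. nderiv (j - i - 1) (w j) x)"

text \<open>\<open>alpha_down n \<phi> m\<close> is the vector \<open>\<alpha>\<^sup>n\<^sup>-\<^sup>m\<close>, obtained from \<open>\<alpha>\<^sup>n\<close> by \<open>m\<close> downward steps.\<close>

primrec alpha_down ::
    "nat \<Rightarrow> (nat \<Rightarrow> real \<Rightarrow> complex) \<Rightarrow> nat \<Rightarrow> nat \<Rightarrow> real \<Rightarrow> complex" where
  "alpha_down n \<phi> 0 = (\<lambda>j x. if j = n + 1 then 1 else 0)"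
| "alpha_down n \<phi> (Suc m) = toeplitz_D n (\<lambda>j x. \<phi> (n - m) x * alpha_down n \<phi> m j x)"

definition alpha :: "nat \<Rightarrow> (nat \<Rightarrow> real \<Rightarrow> complex) \<Rightarrow> nat \<Rightarrow> nat \<Rightarrow> real \<Rightarrow> complex" where
  "alpha n \<phi> k = alpha_down n \<phi> (n - k)"

lemma alpha_top: "alpha n \<phi> n = (\<lambda>j x. if j = n + 1 then 1 else 0)"
  by (simp add: alpha_def)

lemma alpha_step:
  assumes "k \<in> {2..n}"
  shows "alpha n \<phi> (k - 1) = toeplitz_D n (\<lambda>j x. \<phi> k x * alpha n \<phi> k j x)"
proof -
  have "n - (k - 1) = Suc (n - k)" "n - (n - k) = k"
    using assms by auto
  then show ?thesis
    by (simp add: alpha_def)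
qed

text \<open>\<open>\<phi>\<^sub>1, \<dots>, \<phi>\<^sub>n\<close> are auxiliary functions on the neighbourhood \<open>I\<close> of \<open>0\<close>. For \<open>2 \<le> k \<le> n\<close> the
  equation for \<open>\<phi>\<^sub>k\<close> has order \<open>k - 1\<close> near \<open>0\<close>, so a solution has a locally absolutely continuous
  derivative of order \<open>k - 2\<close>. As \<open>a\<^sub>n\<close> is an element of \<open>L\<^sup>1\<^sub>l\<^sub>o\<^sub>c\<close>, the relation defining \<open>\<phi>\<^sub>1\<close>
  is an identity almost everywhere.\<close>

definition auxiliary_functions_on ::
    "real set \<Rightarrow> nat \<Rightarrow> (nat \<Rightarrow> real \<Rightarrow> complex) \<Rightarrow> (nat \<Rightarrow> real \<Rightarrow> complex) \<Rightarrow> bool" where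
  "auxiliary_functions_on I n a \<phi> \<longleftrightarrow>
     (\<forall>k\<in>{2..n}.
        AC_nderiv_on I (k - 2) (\<phi> k) \<and>
        (AE x in lebesgue. x \<in> I \<longrightarrow>
           (\<Sum>i=1..n+1. coeff_vec a i x * toeplitz_D n (\<lambda>j x. \<phi> k x * alpha n \<phi> k j x) i x) = 0) \<and>
        (\<forall>j\<in>{1..k-1}. nderiv (j - 1) (\<phi> k) 0 = (if j = 1 then 1 else 0))) \<and>
     (AE x in lebesgue. x \<in> I \<longrightarrow> (\<Prod>k=1..n. \<phi> k x) = a n x)"

end

theory Submission
  imports Defs
begin

text \<open>The functions \<open>T j = trig_T n f j\<close> solve a cyclic first-order system: the simplex that defines
\<open>trig_S n f (k + 1)\<close> fibres over its last variable, so that \<open>trig_S n f (k + 1)\<close> is the indefinite integral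
of \<open>f i * trig_S n f k\<close>, with \<open>i\<close> congruent to \<open>k + 1\<close> modulo \<open>n\<close>. Summation gives
\<open>(T j)' = f j * T (j - 1)\<close>, with indices modulo \<open>n\<close>, and \<open>T j 0\<close> is \<open>1\<close> if \<open>j = n\<close> and \<open>0\<close> otherwise
(\<open>trig_T_cyclic_system\<close>). The shift commutes with the permutation \<open>\<eta>\<close>, so relabelling the indices by \<open>\<eta>\<close>
yields functions \<open>z m\<close> with \<open>(z m)' = \<phi> m * z (m - 1)\<close> for \<open>m \<ge> 2\<close> and \<open>(z 1)' = \<phi> 1 * z n\<close> almost
everywhere; the only one that does not vanish at \<open>0\<close> is \<open>z (n - k + 1)\<close>, with the value \<open>1\<close>. The claim is
that \<open>z n\<close> is the fundamental solution \<open>\<psi> k\<close> near \<open>0\<close>.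

Why \<open>z n\<close> solves the equation of order \<open>n\<close>: write \<open>\<D>\<close> for the operator \<open>toeplitz_D n\<close>. Leibniz's rule in
the telescoped form \<open>D\<^sup>m (u w) = u D\<^sup>m w + (\<Sum>l<m. D\<^sup>m\<^sup>-\<^sup>1\<^sup>-\<^sup>l (u' D\<^sup>l w))\<close> amounts to
\<open>\<D> (u w) = u (\<D> w) + \<D> (u' (\<D> w))\<close> (\<open>toeplitz_D_mult_AE\<close>). Let \<open>u = z (k - 1)\<close> and
\<open>w = \<phi> k * alpha n \<phi> k\<close>. Then \<open>\<D> w = alpha n \<phi> (k - 1)\<close>, and the equation for \<open>\<phi> k\<close> says that the row vector
\<open>coeff_vec a\<close> annihilates \<open>\<D> w\<close>. As \<open>u w = (z k)' * alpha n \<phi> k\<close>, \<open>coeff_vec a\<close> takes the same value on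
\<open>\<D> ((z k)' * alpha n \<phi> k)\<close> and on \<open>\<D> ((z (k - 1))' * alpha n \<phi> (k - 1))\<close>. For \<open>k = n\<close> this value plus
\<open>a n * z n\<close> is the differential expression of the equation, applied to \<open>z n\<close>. For \<open>k = 1\<close>, where
\<open>alpha n \<phi> 1\<close> has the second component \<open>\<phi> 2 * \<dots> * \<phi> n\<close> and zeros after it, the sum is
\<open>a n * z n - \<phi> 2 * \<dots> * \<phi> n * (z 1)' = 0\<close> (\<open>cyclic_system_solves_equation\<close>).

At \<open>0\<close>, the function \<open>\<phi> m\<close> agrees with the constant \<open>1\<close> up to the derivative of order \<open>m - 2\<close>, so the
\<open>j\<close>-th derivative of \<open>z n\<close> at \<open>0\<close> is \<open>z (n - j) 0\<close> for \<open>j < n\<close> (\<open>cyclic_system_initial_values\<close>). Hence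
\<open>z n\<close> and \<open>\<psi> k\<close> have the same initial values, and they agree near \<open>0\<close> by a contraction argument on an
interval over which the coefficients have a small integral (\<open>local_uniqueness\<close>).

The coefficients are only integrable, so that derivatives of highest order exist only almost everywhere. This
calls for Lebesgue's theorem that an absolutely continuous function is differentiable almost everywhere and is
the integral of its derivative (\<open>AC_on_interval_FTC\<close>). It is obtained from the differentiability almost
everywhere of indefinite integrals (Henstock's lemma and Vitali's covering theorem), and, for the
representation as an integral, from the Radon-Nikodym theorem applied to the Stieltjes measure of a monotone
absolutely continuous function.\<close>

section \<open>Differentiating indefinite integrals\<close>

text \<open>At the points of the exceptional set the difference quotient misses the integrand by more than \<open>\<eta>\<close>, on
arbitrarily short intervals. Vitali's theorem selects disjoint such intervals that cover the set up to a null
set, and Henstock's lemma bounds \<open>\<eta>\<close> times their total length by \<open>\<eta> e\<close>.\<close>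

lemma negligible_derivative_defect:
  fixes g F :: "real \<Rightarrow> 'a::euclidean_space"
  assumes g: "g integrable_on {c..d}"
    and F: "\<And>u v. \<lbrakk>c \<le> u; u \<le> v; v \<le> d\<rbrakk> \<Longrightarrow> F v - F u = integral {u..v} g"
    and "\<eta> > 0"
  shows "negligible {x \<in> {c<..<d}. \<forall>\<delta>>0. \<exists>y\<in>{c..d}. y \<noteq> x \<and> \<bar>y - x\<bar> < \<delta> \<and>
           norm (F y - F x - (y - x) *\<^sub>R g x) > \<eta> * \<bar>y - x\<bar>}" (is "negligible ?E")
  unfolding negligible_outer_le
proof (intro allI impI)
  fix e :: real assume "e > 0"
  let ?a = "\<lambda>p::real \<times> real. (fst p + snd p) / 2"
  let ?r = "\<lambda>p::real \<times> real. \<bar>snd p - fst p\<bar> / 2"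
  let ?B = "\<lambda>p. cball (?a p) (?r p)"
  have "0 < e * \<eta>" using \<open>e > 0\<close> \<open>\<eta> > 0\<close> by simp
  with Henstock_lemma [of g c d "e * \<eta>"] g obtain \<gamma> where \<gamma>: "gauge \<gamma>"
    and hl: "\<And>p. \<lbrakk>p tagged_partial_division_of (cbox c d); \<gamma> fine p\<rbrakk> \<Longrightarrow>
             (\<Sum>(x,K)\<in>p. norm (measure lborel K *\<^sub>R g x - integral K g)) < e * \<eta>"
    by (auto simp: cbox_interval)
  define K where "K = {(x,y). x \<in> {c<..<d} \<and> y \<in> {c..d} \<and> y \<noteq> x \<and> ?B (x,y) \<subseteq> \<gamma> x \<and>
      norm (F y - F x - (y - x) *\<^sub>R g x) > \<eta> * \<bar>y - x\<bar>}"
  \<comment> \<open>a pair \<open>(x, y)\<close> encodes the interval between \<open>x\<close> and \<open>y\<close>, tagged at its endpoint \<open>x\<close>\<close>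
  have Beq: "?B (x,y) = cbox (min x y) (max x y)" for x y
    by (auto simp: cball_eq_atLeastAtMost min_def max_def abs_if field_simps)
  have vitali: "\<exists>i. i \<in> K \<and> x \<in> ?B i \<and> ?r i < \<delta>" if x: "x \<in> ?E" and \<delta>: "\<delta> > 0" for x \<delta>
  proof -
    have "open (\<gamma> x)" "x \<in> \<gamma> x" using \<gamma> by (auto simp: gauge_def)
    then obtain \<rho> where \<rho>: "\<rho> > 0" "ball x \<rho> \<subseteq> \<gamma> x" by (auto simp: open_contains_ball)
    obtain y where y: "y \<in> {c..d}" "y \<noteq> x" "\<bar>y - x\<bar> < min \<delta> \<rho>"
        "norm (F y - F x - (y - x) *\<^sub>R g x) > \<eta> * \<bar>y - x\<bar>"
      using x \<delta> \<rho> by (auto dest!: spec[of _ "min \<delta> \<rho>"])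
    have "?B (x,y) \<subseteq> ball x \<rho>"
      unfolding Beq using y(3) by (auto simp: dist_real_def)
    then have "(x,y) \<in> K" using x y \<rho> by (auto simp: K_def)
    moreover have "x \<in> ?B (x,y)" unfolding Beq by auto
    ultimately show ?thesis using y(3) \<delta> by (intro exI[of _ "(x,y)"]) auto
  qed
  have rpos: "0 < ?r i" if "i \<in> K" for i
    using that unfolding K_def by (cases i) simp
  obtain C where C: "countable C" "C \<subseteq> K"
     "pairwise (\<lambda>i j. disjnt (?B i) (?B j)) C" "negligible (?E - (\<Union>i \<in> C. ?B i))"
    by (rule Vitali_covering_theorem_cballs[of K ?r ?E ?a, OF rpos vitali]) blast+
  have bound: "measure lebesgue (\<Union>i\<in>C'. ?B i) \<le> e" if C': "C' \<subseteq> C" "finite C'" for C'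
  proof -
    define q where "q = (\<lambda>i. (fst i, ?B i)) ` C'"
    have memB: "fst i \<in> ?B i" for i using Beq[of "fst i" "snd i"] by auto
    have dis: "?B i \<inter> ?B j = {}" if "i \<in> C'" "j \<in> C'" "i \<noteq> j" for i j
      using C(3) C'(1) that by (auto simp: pairwise_def disjnt_def)
    have inj: "inj_on (\<lambda>i. (fst i, ?B i)) C'"
      using dis memB by (fastforce intro!: inj_onI)
    have part: "q tagged_partial_division_of cbox c d"
      unfolding tagged_partial_division_of_def
    proof (intro conjI allI impI)
      show "finite q" using C' by (simp add: q_def)
      fix x L assume "(x, L) \<in> q"
      then obtain i where i: "i \<in> C'" "x = fst i" "L = ?B i" by (auto simp: q_def)
      show "x \<in> L" using i memB by simp
      have "i \<in> K" using i C' C by auto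
      then show "L \<subseteq> cbox c d"
        using i Beq[of "fst i" "snd i"] by (auto simp: K_def cbox_interval)
      show "\<exists>a b. L = cbox a b" using i Beq[of "fst i" "snd i"] by auto
    next
      fix x L x' L' assume "(x, L) \<in> q \<and> (x', L') \<in> q \<and> (x,L) \<noteq> (x',L')"
      then obtain i j where "i \<in> C'" "L = ?B i" "j \<in> C'" "L' = ?B j" "i \<noteq> j"
        by (auto simp: q_def)
      then have "L \<inter> L' = {}" using dis[of i j] by (simp only: simp_thms)
      then show "interior L \<inter> interior L' = {}"
        using interior_subset by blast
    qed
    have fine: "\<gamma> fine q"
      unfolding fine_def
    proof (intro ballI, clarify del: subsetI)
      fix x L assume "(x, L) \<in> q"
      then obtain i where i: "i \<in> C'" "x = fst i" "L = ?B i" by (auto simp: q_def)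
      then have "i \<in> K" using C' C by auto
      then show "L \<subseteq> \<gamma> x" unfolding K_def i(2,3) by (cases i) simp
    qed
    have meas: "measure lebesgue (?B i) = \<bar>snd i - fst i\<bar>" for i
      using Beq[of "fst i" "snd i"] by (auto simp: cbox_interval min_def max_def)
    have contrib: "\<eta> * measure lebesgue (?B i) \<le> norm (measure lborel (?B i) *\<^sub>R g (fst i) - integral (?B i) g)"
      if "i \<in> C'" for i
    proof -
      obtain x y where i: "i = (x,y)" by (cases i)
      have "(x,y) \<in> K" using that i C' C by auto
      then have xy: "x \<in> {c<..<d}" "y \<in> {c..d}" "y \<noteq> x"
        "norm (F y - F x - (y - x) *\<^sub>R g x) > \<eta> * \<bar>y - x\<bar>" by (auto simp: K_def)
      show ?thesis
      proof (cases "x \<le> y")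
        case True
        then have "integral (?B i) g = F y - F x" "measure lborel (?B i) = y - x"
          using F[of x y] xy i Beq[of x y] by (auto simp: cbox_interval)
        then show ?thesis using xy True i meas[of i] by (simp add: norm_minus_commute)
      next
        case False
        then have "integral (?B i) g = F x - F y" "measure lborel (?B i) = x - y"
          using F[of y x] xy i Beq[of x y] by (auto simp: cbox_interval)
        moreover have "(x - y) *\<^sub>R g x - (F x - F y) = F y - F x - (y - x) *\<^sub>R g x"
          by (simp add: algebra_simps)
        ultimately have "measure lborel (?B i) *\<^sub>R g (fst i) - integral (?B i) g = F y - F x - (y - x) *\<^sub>R g x"
          using i by simp
        then show ?thesis using xy(4) meas[of i] i by simp
      qed
    qed
    have "\<eta> * measure lebesgue (\<Union>i\<in>C'. ?B i) \<le> \<eta> * (\<Sum>i\<in>C'. measure lebesgue (?B i))"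
      using \<open>\<eta> > 0\<close> C' by (intro mult_left_mono measure_UNION_le) auto
    also have "\<dots> \<le> (\<Sum>i\<in>C'. norm (measure lborel (?B i) *\<^sub>R g (fst i) - integral (?B i) g))"
      unfolding sum_distrib_left by (intro sum_mono contrib)
    also have "\<dots> = (\<Sum>(x,K)\<in>q. norm (measure lborel K *\<^sub>R g x - integral K g))"
      unfolding q_def by (subst sum.reindex[OF inj]) (simp add: o_def)
    also have "\<dots> < e * \<eta>" by (rule hl[OF part fine])
    finally show ?thesis using \<open>\<eta> > 0\<close> by (simp add: mult.commute)
  qed
  let ?N = "?E - (\<Union>i \<in> C. ?B i)"
  have U: "(\<Union>i\<in>C. ?B i) \<in> lmeasurable" "measure lebesgue (\<Union>i\<in>C. ?B i) \<le> e"
    using fmeasurable_UN_bound[of C ?B lebesgue e] measure_UN_bound[of C ?B lebesgue e] C bound by auto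
  have N: "?N \<in> lmeasurable" "measure lebesgue ?N = 0"
    using C(4) negligible_imp_measurable negligible_imp_measure0 by auto
  have "measure lebesgue (?N \<union> (\<Union>i\<in>C. ?B i)) \<le> measure lebesgue ?N + measure lebesgue (\<Union>i\<in>C. ?B i)"
    using U N by (intro measure_Un_le) auto
  moreover have "?N \<union> (\<Union>i\<in>C. ?B i) \<in> lmeasurable"
    by (rule fmeasurable.Un[OF N(1) U(1)])
  ultimately show "\<exists>T. ?E \<subseteq> T \<and> T \<in> lmeasurable \<and> measure lebesgue T \<le> e"
    using U(2) N(2) by (intro exI[of _ "?N \<union> (\<Union>i\<in>C. ?B i)"] conjI) (blast, simp_all only:)
qed

theorem indefinite_integral_derivative_AE:
  fixes g F :: "real \<Rightarrow> 'a::euclidean_space"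
  assumes g: "g integrable_on {c..d}"
    and F: "\<And>u v. \<lbrakk>c \<le> u; u \<le> v; v \<le> d\<rbrakk> \<Longrightarrow> F v - F u = integral {u..v} g"
  shows "AE x in lebesgue. x \<in> {c<..<d} \<longrightarrow> (F has_vector_derivative g x) (at x)"
proof -
  define E where "E k = {x \<in> {c<..<d}. \<forall>\<delta>>0. \<exists>y\<in>{c..d}. y \<noteq> x \<and> \<bar>y - x\<bar> < \<delta> \<and>
           norm (F y - F x - (y - x) *\<^sub>R g x) > inverse (real (Suc k)) * \<bar>y - x\<bar>}" for k
  have neg: "negligible (E k)" for k
    unfolding E_def using g F by (intro negligible_derivative_defect) auto
  have "(F has_vector_derivative g x) (at x)" if x: "x \<in> {c<..<d}" "\<forall>k. x \<notin> E k" for x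
    unfolding has_vector_derivative_def has_derivative_within_alt
  proof (intro conjI allI impI)
    show "bounded_linear (\<lambda>h. h *\<^sub>R g x)" by (rule bounded_linear_scaleR_left)
    fix e :: real assume "e > 0"
    then obtain k where k: "inverse (real (Suc k)) < e" using reals_Archimedean by blast
    have "x \<notin> E k" using x by blast
    then obtain \<delta> where \<delta>: "\<delta> > 0" "\<And>y. \<lbrakk>y \<in> {c..d}; y \<noteq> x; \<bar>y - x\<bar> < \<delta>\<rbrakk> \<Longrightarrow>
        norm (F y - F x - (y - x) *\<^sub>R g x) \<le> inverse (real (Suc k)) * \<bar>y - x\<bar>"
      using x(1) by (fastforce simp: E_def not_less)
    have "norm (F y - F x - (y - x) *\<^sub>R g x) \<le> e * norm (y - x)"
      if "norm (y - x) < min \<delta> (min (x - c) (d - x))" for y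
    proof (cases "y = x")
      case False
      have "norm (F y - F x - (y - x) *\<^sub>R g x) \<le> inverse (real (Suc k)) * \<bar>y - x\<bar>"
        using that x False by (intro \<delta>) (auto simp: abs_if split: if_splits)
      also have "\<dots> \<le> e * \<bar>y - x\<bar>" using k by (intro mult_right_mono) auto
      finally show ?thesis by simp
    qed simp
    then show "\<exists>d>0. \<forall>y\<in>UNIV. norm (y - x) < d \<longrightarrow> norm (F y - F x - (y - x) *\<^sub>R g x) \<le> e * norm (y - x)"
      using \<delta> x(1) by (intro exI[of _ "min \<delta> (min (x - c) (d - x))"]) auto
  qed
  then have "{x. \<not> (x \<in> {c<..<d} \<longrightarrow> (F has_vector_derivative g x) (at x))} \<subseteq> (\<Union>k. E k)"
    by blast
  moreover have "negligible (\<Union>k. E k)" using neg by blast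
  ultimately show ?thesis unfolding eventually_ae_filter_negligible by blast
qed

section \<open>Absolutely continuous functions and indefinite integrals\<close>

text \<open>The projection onto the interval \<open>{a..b}\<close> (for \<open>a \<le> b\<close>). Applied to the endpoints of disjoint intervals it
yields the disjoint intersections with \<open>{a..b}\<close>, which spares case distinctions when partitions are cut.\<close>

abbreviation clip :: "real \<Rightarrow> real \<Rightarrow> real \<Rightarrow> real" where
  "clip a b t \<equiv> max a (min t b)"

lemma clip_interval_subset: "{clip a b u<..<clip a b v} \<subseteq> {u<..<v}"
  by (auto simp: max_def min_def split: if_splits)

lemma disjoint_family_on_clip:
  assumes "disjoint_family_on (\<lambda>i. {u i<..<v i}) S"
  shows "disjoint_family_on (\<lambda>i. {clip a b (u i)<..<clip a b (v i)}) S"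
  using assms clip_interval_subset unfolding disjoint_family_on_def by blast

lemma sum_lengths_le_measure:
  fixes u v :: "'i \<Rightarrow> real"
  assumes "finite S" "\<And>i. i \<in> S \<Longrightarrow> u i \<le> v i" "disjoint_family_on (\<lambda>i. {u i<..<v i}) S"
    and T: "T \<in> lmeasurable" "\<And>i. i \<in> S \<Longrightarrow> {u i<..<v i} \<subseteq> T"
  shows "(\<Sum>i\<in>S. v i - u i) \<le> measure lebesgue T"
proof -
  have eq: "measure lebesgue {u i<..<v i} = v i - u i" if "i \<in> S" for i
    using assms(2)[OF that] by (simp add: measure_def)
  have "(\<Sum>i\<in>S. v i - u i) = (\<Sum>i\<in>S. measure lebesgue {u i<..<v i})"
    using eq by simp
  also have "\<dots> = measure lebesgue (\<Union>i\<in>S. {u i<..<v i})"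
    using assms by (intro measure_finite_Union[symmetric]) auto
  also have "\<dots> \<le> measure lebesgue T"
    using T by (intro measure_mono_fmeasurable) (auto simp: assms(1))
  finally show ?thesis .
qed

text \<open>The definition quantifies over families indexed by an initial segment of the natural numbers; arbitrary finite
index sets are more convenient for double families.\<close>

lemma AC_on_intervalE:
  fixes \<epsilon> :: real
  assumes "AC_on_interval c d f" "\<epsilon> > 0"
  obtains \<delta> where "\<delta> > 0"
    "\<And>(S::'i set) u v. \<lbrakk>finite S; \<And>i. i \<in> S \<Longrightarrow> c \<le> u i \<and> u i \<le> v i \<and> v i \<le> d;
        disjoint_family_on (\<lambda>i. {u i<..<v i}) S; (\<Sum>i\<in>S. v i - u i) < \<delta>\<rbrakk>
      \<Longrightarrow> (\<Sum>i\<in>S. norm (f (v i) - f (u i))) < \<epsilon>"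
proof -
  obtain \<delta> where \<delta>: "\<delta> > 0" "\<forall>(m::nat) u v.
        (\<forall>i<m. c \<le> u i \<and> u i \<le> v i \<and> v i \<le> d) \<longrightarrow>
        disjoint_family_on (\<lambda>i. {u i<..<v i}) {..<m} \<longrightarrow>
        (\<Sum>i<m. v i - u i) < \<delta> \<longrightarrow>
        (\<Sum>i<m. norm (f (v i) - f (u i))) < \<epsilon>"
    using assms unfolding AC_on_interval_def by blast
  have "(\<Sum>i\<in>S. norm (f (v i) - f (u i))) < \<epsilon>"
    if S: "finite S" "\<And>i. i \<in> S \<Longrightarrow> c \<le> u i \<and> u i \<le> v i \<and> v i \<le> d"
       "disjoint_family_on (\<lambda>i. {u i<..<v i}) S" "(\<Sum>i\<in>S. v i - u i) < \<delta>"
    for S :: "'i set" and u v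
  proof -
    obtain h where h: "bij_betw h {..<card S} S"
      using ex_bij_betw_nat_finite[OF S(1)] by (auto simp: atLeast0LessThan)
    have hS: "h i \<in> S" if "i < card S" for i using h that by (auto simp: bij_betw_def)
    have 1: "(\<Sum>i<card S. v (h i) - u (h i)) = (\<Sum>i\<in>S. v i - u i)"
      by (rule sum.reindex_bij_betw[OF h])
    have 2: "(\<Sum>i<card S. norm (f (v (h i)) - f (u (h i)))) = (\<Sum>i\<in>S. norm (f (v i) - f (u i)))"
      by (rule sum.reindex_bij_betw[OF h])
    have "disjoint_family_on (\<lambda>i. {u (h i)<..<v (h i)}) {..<card S}"
      using S(3) h hS unfolding disjoint_family_on_def bij_betw_def inj_on_def
      by (metis lessThan_iff)
    then show ?thesis
      using \<delta>(2)[rule_format, of "card S" "u \<circ> h" "v \<circ> h"] S(2,4) hS 1 2 by (simp add: o_def)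
  qed
  with \<delta>(1) show thesis using that by blast
qed

lemma AC_on_interval_subinterval:
  assumes "AC_on_interval c d f" "c \<le> c'" "d' \<le> d"
  shows "AC_on_interval c' d' f"
  unfolding AC_on_interval_def
proof (intro allI impI)
  fix \<epsilon> :: real assume "\<epsilon> > 0"
  with assms(1) obtain \<delta> where \<delta>: "\<delta> > 0" "\<And>S u v. \<lbrakk>finite (S::nat set); \<And>i. i \<in> S \<Longrightarrow> c \<le> u i \<and> u i \<le> v i \<and> v i \<le> d;
        disjoint_family_on (\<lambda>i. {u i<..<v i}) S; (\<Sum>i\<in>S. v i - u i) < \<delta>\<rbrakk>
      \<Longrightarrow> (\<Sum>i\<in>S. norm (f (v i) - f (u i))) < \<epsilon>"
    by (rule AC_on_intervalE) blast
  show "\<exists>\<delta>>0. \<forall>(m::nat) u v. (\<forall>i<m. c' \<le> u i \<and> u i \<le> v i \<and> v i \<le> d') \<longrightarrow>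
        disjoint_family_on (\<lambda>i. {u i<..<v i}) {..<m} \<longrightarrow> (\<Sum>i<m. v i - u i) < \<delta> \<longrightarrow>
        (\<Sum>i<m. norm (f (v i) - f (u i))) < \<epsilon>"
  proof (intro exI[of _ \<delta>] conjI \<delta>(1) allI impI)
    fix m :: nat and u v :: "nat \<Rightarrow> real"
    assume *: "\<forall>i<m. c' \<le> u i \<and> u i \<le> v i \<and> v i \<le> d'"
      "disjoint_family_on (\<lambda>i. {u i<..<v i}) {..<m}" "(\<Sum>i<m. v i - u i) < \<delta>"
    show "(\<Sum>i<m. norm (f (v i) - f (u i))) < \<epsilon>"
    proof (rule \<delta>(2))
      show "c \<le> u i \<and> u i \<le> v i \<and> v i \<le> d" if "i \<in> {..<m}" for i
        using *(1) that assms(2,3) by force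
    qed (use * in auto)
  qed
qed

lemma AC_on_interval_uniform:
  assumes "AC_on_interval c d f" "\<epsilon> > 0"
  obtains \<delta> where "\<delta> > 0" "\<And>x y. \<lbrakk>x \<in> {c..d}; y \<in> {c..d}; \<bar>y - x\<bar> < \<delta>\<rbrakk> \<Longrightarrow> norm (f y - f x) < \<epsilon>"
proof -
  obtain \<delta> where \<delta>: "\<delta> > 0" "\<And>S u v. \<lbrakk>finite (S::nat set); \<And>i. i \<in> S \<Longrightarrow> c \<le> u i \<and> u i \<le> v i \<and> v i \<le> d;
        disjoint_family_on (\<lambda>i. {u i<..<v i}) S; (\<Sum>i\<in>S. v i - u i) < \<delta>\<rbrakk>
      \<Longrightarrow> (\<Sum>i\<in>S. norm (f (v i) - f (u i))) < \<epsilon>"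
    using assms by (rule AC_on_intervalE) blast
  have *: "norm (f y - f x) < \<epsilon>" if "x \<in> {c..d}" "y \<in> {c..d}" "\<bar>y - x\<bar> < \<delta>" "x \<le> y" for x y
    using \<delta>(2)[of "{0}" "\<lambda>_. x" "\<lambda>_. y"] that by (auto simp: disjoint_family_on_def)
  have "norm (f y - f x) < \<epsilon>" if "x \<in> {c..d}" "y \<in> {c..d}" "\<bar>y - x\<bar> < \<delta>" for x y
    using *[of x y] *[of y x] that by (cases "x \<le> y") (auto simp: norm_minus_commute abs_minus_commute)
  with \<delta>(1) show thesis using that by blast
qed

lemma AC_on_interval_continuous:
  assumes "AC_on_interval c d f"
  shows "continuous_on {c..d} f"
  unfolding continuous_on_iff
proof (intro ballI allI impI)
  fix x \<epsilon> :: real assume x: "x \<in> {c..d}" and \<epsilon>: "\<epsilon> > 0"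
  obtain \<delta> where "\<delta> > 0" "\<And>x y. \<lbrakk>x \<in> {c..d}; y \<in> {c..d}; \<bar>y - x\<bar> < \<delta>\<rbrakk> \<Longrightarrow> norm (f y - f x) < \<epsilon>"
    using AC_on_interval_uniform[OF assms \<epsilon>] by blast
  then show "\<exists>\<delta>>0. \<forall>y\<in>{c..d}. dist y x < \<delta> \<longrightarrow> dist (f y) (f x) < \<epsilon>"
    using x by (intro exI[of _ \<delta>]) (auto simp: dist_norm)
qed

text \<open>With \<open>h = \<bar>g\<bar>\<close>, the integral of \<open>h\<close> over a union of short intervals is at most the integral of
\<open>h - min h k\<close>, which is small for large \<open>k\<close>, plus \<open>k\<close> times the total length.\<close>

lemma indefinite_integral_AC:
  fixes g F :: "real \<Rightarrow> complex"
  assumes g: "g absolutely_integrable_on {c..d}"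
    and F: "\<And>u v. \<lbrakk>c \<le> u; u \<le> v; v \<le> d\<rbrakk> \<Longrightarrow> F v - F u = integral {u..v} g"
  shows "AC_on_interval c d F"
  unfolding AC_on_interval_def
proof (intro allI impI)
  fix \<epsilon> :: real assume "\<epsilon> > 0"
  define h where "h x = indicator {c..d} x * norm (g x)" for x
  have hint: "integrable lebesgue h"
    using set_integrable_norm[OF g] by (simp add: set_integrable_def h_def[abs_def])
  have h0: "h x \<ge> 0" for x by (simp add: h_def)
  have meas: "h \<in> borel_measurable lebesgue" using hint by auto
  have "(\<lambda>k. integral\<^sup>L lebesgue (\<lambda>x. min (h x) (real k))) \<longlonglongrightarrow> integral\<^sup>L lebesgue h"
  proof (rule integral_dominated_convergence[where w=h])
    show "AE x in lebesgue. (\<lambda>k. min (h x) (real k)) \<longlonglongrightarrow> h x"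
    proof (intro AE_I2 tendsto_eventually)
      fix x
      obtain k0 where "h x \<le> real k0" using real_arch_simple by blast
      then show "\<forall>\<^sub>F k in sequentially. min (h x) (real k) = h x"
        by (intro eventually_sequentiallyI[of k0]) auto
    qed
  qed (use hint meas h0 in auto)
  then obtain k where k: "\<bar>integral\<^sup>L lebesgue (\<lambda>x. min (h x) (real k)) - integral\<^sup>L lebesgue h\<bar> < \<epsilon>/2"
    using \<open>\<epsilon> > 0\<close> by (metis LIMSEQ_D half_gt_zero order_refl real_norm_def)
  have mint: "integrable lebesgue (\<lambda>x. min (h x) (real k))"
    by (rule Bochner_Integration.integrable_bound[OF hint]) (use meas h0 in auto)
  define \<delta> where "\<delta> = \<epsilon> / (2 * (real k + 1))"
  have "\<delta> > 0" using \<open>\<epsilon> > 0\<close> by (simp add: \<delta>_def)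
  show "\<exists>\<delta>>0. \<forall>(m::nat) u v. (\<forall>i<m. c \<le> u i \<and> u i \<le> v i \<and> v i \<le> d) \<longrightarrow>
        disjoint_family_on (\<lambda>i. {u i<..<v i}) {..<m} \<longrightarrow> (\<Sum>i<m. v i - u i) < \<delta> \<longrightarrow>
        (\<Sum>i<m. norm (F (v i) - F (u i))) < \<epsilon>"
  proof (intro exI[of _ \<delta>] conjI \<open>\<delta> > 0\<close> allI impI)
    fix m :: nat and u v :: "nat \<Rightarrow> real"
    assume *: "\<forall>i<m. c \<le> u i \<and> u i \<le> v i \<and> v i \<le> d"
      and dis: "disjoint_family_on (\<lambda>i. {u i<..<v i}) {..<m}" and small: "(\<Sum>i<m. v i - u i) < \<delta>"
    define I where "I = (\<lambda>i x. indicator {u i<..<v i} x :: real)"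
    have Iint: "integrable lebesgue (\<lambda>x. I i x * h x)" for i
      using integrable_mult_indicator[OF _ hint, of "{u i<..<v i}"] by (simp add: I_def)
    have Iint': "integrable lebesgue (I i)" for i
      unfolding I_def
      using lmeasurable_interval(2)[of "u i" "v i"]
      by (intro integrable_real_indicator) (auto simp: fmeasurable_def I_def simp del: emeasure_lborel_Ioo)
    have one: "norm (F (v i) - F (u i)) \<le> integral\<^sup>L lebesgue (\<lambda>x. I i x * h x)" if "i < m" for i
    proof -
      have si: "set_integrable lebesgue {u i<..<v i} g"
        by (rule set_integrable_subset[OF g]) (use * that in force)+
      have "F (v i) - F (u i) = integral {u i<..<v i} g"
        using F[of "u i" "v i"] * that integral_open_interval_real[of "u i" "v i" g] by auto
      also have "\<dots> = (LINT x:{u i<..<v i}|lebesgue. g x)"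
        using set_lebesgue_integral_eq_integral(2)[OF si] by simp
      finally have "norm (F (v i) - F (u i)) \<le> (LINT x|lebesgue. norm (indicator {u i<..<v i} x *\<^sub>R g x))"
        unfolding set_lebesgue_integral_def by (metis integral_norm_bound)
      also have "\<dots> = integral\<^sup>L lebesgue (\<lambda>x. I i x * h x)"
        using * that by (intro Bochner_Integration.integral_cong) (force simp: h_def indicator_def I_def)+
      finally show ?thesis .
    qed
    have "(\<Sum>i<m. norm (F (v i) - F (u i))) \<le> (\<Sum>i<m. integral\<^sup>L lebesgue (\<lambda>x. I i x * h x))"
      by (intro sum_mono one) auto
    also have "\<dots> = integral\<^sup>L lebesgue (\<lambda>x. \<Sum>i<m. I i x * h x)"
      using Iint by (intro Bochner_Integration.integral_sum[symmetric])
    also have "\<dots> \<le> integral\<^sup>L lebesgue (\<lambda>x. (h x - min (h x) (real k)) + (\<Sum>i<m. real k * I i x))"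
    proof (intro integral_mono Bochner_Integration.integrable_sum Bochner_Integration.integrable_add
        Bochner_Integration.integrable_diff hint mint Iint integrable_mult_right Iint')
      fix x
      have "(\<Sum>i<m. I i x) = indicator (\<Union>i<m. {u i<..<v i}) x"
        using dis unfolding I_def by (subst indicator_UN_disjoint) auto
      then have S: "0 \<le> (\<Sum>i<m. I i x)" "(\<Sum>i<m. I i x) \<le> 1" by (auto simp: indicator_def)
      define s where "s = (\<Sum>i<m. I i x)"
      have "(\<Sum>i<m. I i x * h x) = s * (h x - min (h x) (real k)) + s * min (h x) (real k)"
        by (simp add: s_def sum_distrib_right[symmetric] sum_distrib_left[symmetric] algebra_simps)
      also have "\<dots> \<le> 1 * (h x - min (h x) (real k)) + s * real k"
        using S h0[of x] by (intro add_mono mult_right_mono mult_left_mono) (auto simp: s_def)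
      finally show "(\<Sum>i<m. I i x * h x) \<le> h x - min (h x) (real k) + (\<Sum>i<m. real k * I i x)"
        by (simp add: s_def sum_distrib_left mult.commute)
    qed
    also have "\<dots> = (integral\<^sup>L lebesgue h - integral\<^sup>L lebesgue (\<lambda>x. min (h x) (real k))) + (\<Sum>i<m. real k * integral\<^sup>L lebesgue (I i))"
      using hint mint Iint' by simp
    also have "(\<Sum>i<m. real k * integral\<^sup>L lebesgue (I i)) = real k * (\<Sum>i<m. v i - u i)"
      unfolding sum_distrib_left using * by (intro sum.cong) (auto simp: measure_def I_def)
    also have "\<dots> \<le> real k * \<delta>" using small by (intro mult_left_mono) auto
    also have "\<dots> \<le> \<epsilon> / 2" using \<open>\<epsilon> > 0\<close> by (simp add: \<delta>_def field_simps)
    finally show "(\<Sum>i<m. norm (F (v i) - F (u i))) < \<epsilon>" using k by linarith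
  qed
qed

lemma AC_of_real_iff:
  "AC_on_interval c d (\<lambda>x. complex_of_real (G x)) \<longleftrightarrow>
     (\<forall>\<epsilon>>0. \<exists>\<delta>>0. \<forall>(m::nat) u v.
        (\<forall>i<m. c \<le> u i \<and> u i \<le> v i \<and> v i \<le> d) \<longrightarrow>
        disjoint_family_on (\<lambda>i. {u i<..<v i}) {..<m} \<longrightarrow>
        (\<Sum>i<m. v i - u i) < \<delta> \<longrightarrow> (\<Sum>i<m. \<bar>G (v i) - G (u i)\<bar>) < \<epsilon>)"
  unfolding AC_on_interval_def of_real_diff[symmetric] norm_of_real ..

text \<open>The Stieltjes measure of a monotone absolutely continuous function has a density: a null set is covered by
intervals of small total length, on which the function increases little.\<close>

lemma mono_AC_is_integral:
  fixes G :: "real \<Rightarrow> real"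
  assumes mono: "\<And>x y. \<lbrakk>c \<le> x; x \<le> y; y \<le> d\<rbrakk> \<Longrightarrow> G x \<le> G y"
    and AC: "AC_on_interval c d (\<lambda>x. complex_of_real (G x))" and "c \<le> d"
  obtains g where "g absolutely_integrable_on {c..d}"
    "\<And>u v. \<lbrakk>c \<le> u; u \<le> v; v \<le> d\<rbrakk> \<Longrightarrow> (g has_integral G v - G u) {u..v}"
proof -
  \<comment> \<open>the function is continued by constants to the whole line\<close>
  define H where "H x = G (clip c d x)" for x
  have clip_in: "c \<le> clip c d x" "clip c d x \<le> d" for x using \<open>c \<le> d\<close> by auto
  have clip_mono: "clip c d x \<le> clip c d y" if "x \<le> y" for x y using that by auto
  have Hmono: "H x \<le> H y" if "x \<le> y" for x y
    unfolding H_def using clip_in clip_mono[OF that] by (intro mono) auto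
  have contG: "continuous_on {c..d} G"
    using continuous_on_Re[OF AC_on_interval_continuous[OF AC]] by simp
  have Hcont: "continuous_on UNIV H"
    unfolding H_def
    by (rule continuous_on_compose2[OF contG]) (use \<open>c \<le> d\<close> in \<open>auto intro!: continuous_intros\<close>)
  define \<mu> where "\<mu> = interval_measure H"
  have Icc: "emeasure \<mu> {u..v} = ennreal (H v - H u)" if "u \<le> v" for u v
    unfolding \<mu>_def by (rule emeasure_interval_measure_Icc[OF that Hmono Hcont])
  have sets_\<mu>: "sets \<mu> = sets borel" by (simp add: \<mu>_def)
  have null_bounded: "emeasure \<mu> A = 0" if A: "A \<in> sets borel" "emeasure lborel A = 0"
    and Ab: "A \<subseteq> {a..b}" "a < b" for A a b
  proof -
    have "emeasure \<mu> A \<le> 0 + ennreal \<epsilon>" if "\<epsilon> > 0" for \<epsilon>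
    proof -
      obtain \<delta> where \<delta>: "\<delta> > 0"
        "\<And>(S::real set set) u v. \<lbrakk>finite S; \<And>i. i \<in> S \<Longrightarrow> c \<le> u i \<and> u i \<le> v i \<and> v i \<le> d;
        disjoint_family_on (\<lambda>i. {u i<..<v i}) S; (\<Sum>i\<in>S. v i - u i) < \<delta>\<rbrakk>
          \<Longrightarrow> (\<Sum>i\<in>S. norm (complex_of_real (G (v i)) - complex_of_real (G (u i)))) < \<epsilon>"
        using AC_on_intervalE[OF AC \<open>\<epsilon> > 0\<close>] by blast
      have "A \<in> sets lebesgue" using A(1) by simp
      then obtain T where T: "open T" "A \<subseteq> T" "(T - A) \<in> lmeasurable" "emeasure lebesgue (T - A) < ennreal \<delta>"
        using sets_lebesgue_outer_open \<open>\<delta> > 0\<close> by blast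
      have "emeasure lebesgue T = emeasure lebesgue (T - A)"
        by (rule emeasure_Diff_null_set[symmetric]) (use A T in \<open>auto simp: null_sets_def\<close>)
      then have Tm: "T \<in> lmeasurable" and Tl: "measure lebesgue T < \<delta>"
        using T by (auto simp: fmeasurable_def measure_def enn2real_less_iff less_top)
      define \<gamma> where "\<gamma> x = (if x \<in> T then T else UNIV)" for x
      have "gauge \<gamma>" using T(1) by (auto simp: gauge_def \<gamma>_def)
      have cover: "A \<subseteq> cbox a b" "box a b \<noteq> {}" using Ab by (auto simp: cbox_interval box_real)
      obtain \<D> where \<D>: "countable \<D>" "\<Union>\<D> \<subseteq> cbox a b"
          "\<And>K. K \<in> \<D> \<Longrightarrow> interior K \<noteq> {} \<and> (\<exists>c d. K = cbox c d)"
          "pairwise (\<lambda>A B. interior A \<inter> interior B = {}) \<D>"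
          "\<And>K. K \<in> \<D> \<Longrightarrow> \<exists>x \<in> A \<inter> K. K \<subseteq> \<gamma> x" "A \<subseteq> \<Union>\<D>"
        apply (rule covering_lemma[OF cover \<open>gauge \<gamma>\<close>])
        subgoal premises p for \<D>' by (rule p(1)[OF p(2-6) p(8)])
        done
      have KT: "K \<subseteq> T" if "K \<in> \<D>" for K
        using \<D>(5)[OF that] T(2) by (auto simp: \<gamma>_def split: if_splits)
      define l r where "l K = Inf K" and "r K = Sup K" for K :: "real set"
      have K: "K = {l K..r K} \<and> l K \<le> r K" if "K \<in> \<D>" for K
      proof -
        from \<D>(3)[OF that] obtain x y where xy: "interior K \<noteq> {}" "K = cbox x y" by blast
        then have "x \<le> y" using interior_subset by (cases "x \<le> y") (auto simp: cbox_interval)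
        then show ?thesis using xy by (simp add: cbox_interval l_def r_def)
      qed
      have "emeasure \<mu> (\<Union>\<D>) \<le> ennreal \<epsilon>"
      proof -
        have fm: "D \<in> fmeasurable \<mu>" if "D \<in> \<D>" for D
        proof (rule fmeasurableI)
          have D: "D = {l D..r D}" "l D \<le> r D" using K[OF that] by blast+
          show "D \<in> sets \<mu>" unfolding sets_\<mu> by (subst D(1)) simp
          show "emeasure \<mu> D < \<infinity>" using Icc[OF D(2)] unfolding D(1)[symmetric] by simp
        qed
        have bnd: "measure \<mu> (\<Union>\<E>) \<le> \<epsilon>" if \<E>: "\<E> \<subseteq> \<D>" "finite \<E>" for \<E>
        proof -
          have "measure \<mu> (\<Union>\<E>) \<le> (\<Sum>D\<in>\<E>. measure \<mu> D)"
            using measure_UNION_le[of \<E> "\<lambda>D. D" \<mu>] \<E> fm by (auto simp: fmeasurable_def)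
          also have "\<dots> = (\<Sum>D\<in>\<E>. norm (complex_of_real (G (clip c d (r D))) - complex_of_real (G (clip c d (l D)))))"
          proof (rule sum.cong[OF refl])
            fix D assume "D \<in> \<E>"
            then have D: "D = {l D..r D}" "l D \<le> r D" using K[of D] \<E> by blast+
            have "measure \<mu> D = H (r D) - H (l D)"
              using Icc[OF D(2)] Hmono[OF D(2)] unfolding D(1)[symmetric] by (simp add: measure_def)
            then show "measure \<mu> D = norm (complex_of_real (G (clip c d (r D))) - complex_of_real (G (clip c d (l D))))"
              unfolding of_real_diff[symmetric] norm_of_real using Hmono[OF D(2)] by (simp add: H_def)
          qed
          also have "\<dots> < \<epsilon>"
          proof (rule \<delta>(2)[OF \<E>(2)])
            have intK: "interior D = {l D<..<r D}" if "D \<in> \<E>" for D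
            proof -
              have "D = {l D..r D}" using K[of D] that \<E> by blast
              then have "interior D = interior {l D..r D}" by (rule arg_cong)
              then show ?thesis by (simp only: interior_atLeastAtMost_real)
            qed
            have lr: "l D \<le> r D" if "D \<in> \<E>" for D using K[of D] that \<E> by blast
            have "disjoint_family_on (\<lambda>D. {l D<..<r D}) \<E>"
              using \<D>(4) \<E> intK unfolding pairwise_def disjoint_family_on_def by (metis subsetD)
            then show "disjoint_family_on (\<lambda>D. {clip c d (l D)<..<clip c d (r D)}) \<E>"
              by (rule disjoint_family_on_clip)
            show "c \<le> clip c d (l D) \<and> clip c d (l D) \<le> clip c d (r D) \<and> clip c d (r D) \<le> d" if "D \<in> \<E>" for D
              using lr[OF that] by (intro conjI clip_in clip_mono)
            have "(\<Sum>D\<in>\<E>. clip c d (r D) - clip c d (l D)) \<le> measure lebesgue T"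
            proof (rule sum_lengths_le_measure[OF \<E>(2)])
              show "clip c d (l D) \<le> clip c d (r D)" if "D \<in> \<E>" for D
                using lr[OF that] by (rule clip_mono)
              show "disjoint_family_on (\<lambda>D. {clip c d (l D)<..<clip c d (r D)}) \<E>" by fact
              show "{clip c d (l D)<..<clip c d (r D)} \<subseteq> T" if "D \<in> \<E>" for D
              proof -
                have "{l D<..<r D} \<subseteq> T"
                  unfolding intK[OF that, symmetric] using interior_subset KT[of D] that \<E> by (meson order.trans subsetD)
                then show ?thesis using clip_interval_subset by (rule order.trans[rotated])
              qed
            qed (rule Tm)
            then show "(\<Sum>D\<in>\<E>. clip c d (r D) - clip c d (l D)) < \<delta>" using Tl by simp
          qed
          finally show ?thesis by simp
        qed
        show ?thesis
          using fmeasurable_Union_bound[OF \<D>(1) fm bnd] measure_Union_bound[OF \<D>(1) fm bnd]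
          by (metis emeasure_eq_measure2 ennreal_leI)
      qed
      moreover have "emeasure \<mu> A \<le> emeasure \<mu> (\<Union>\<D>)"
      proof (rule emeasure_mono[OF \<D>(6)])
        have "D \<in> sets \<mu>" if "D \<in> \<D>" for D
          unfolding sets_\<mu> using K[OF that] by (metis atLeastAtMost_borel)
        then show "\<Union>\<D> \<in> sets \<mu>" using \<D>(1) by auto
      qed
      ultimately show ?thesis by simp
    qed
    then have "emeasure \<mu> A \<le> 0" by (rule ennreal_le_epsilon)
    then show ?thesis by simp
  qed
  have "absolutely_continuous lborel \<mu>"
    unfolding absolutely_continuous_def
  proof
    fix A :: "real set" assume A: "A \<in> null_sets lborel"
    have "A \<inter> {- real n..real n + 1} \<in> null_sets \<mu>" for n
    proof -
      have "A \<inter> {- real n..real n + 1} \<in> null_sets lborel"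
        by (rule null_sets_subset[OF A]) (use A in \<open>auto simp: null_sets_def\<close>)
      then have *: "A \<inter> {- real n..real n + 1} \<in> sets borel" "emeasure lborel (A \<inter> {- real n..real n + 1}) = 0"
        by (simp_all add: null_sets_def)
      show ?thesis
      proof (rule null_setsI)
        show "emeasure \<mu> (A \<inter> {- real n..real n + 1}) = 0"
          by (rule null_bounded[OF *, of "- real n" "real n + 1"]) simp_all
        show "A \<inter> {- real n..real n + 1} \<in> sets \<mu>" using *(1) by (simp only: sets_\<mu>)
      qed
    qed
    then have "(\<Union>n. A \<inter> {- real n..real n + 1}) \<in> null_sets \<mu>" by blast
    moreover have "(\<Union>n. A \<inter> {- real n..real n + 1}) = A"
    proof (intro equalityI subsetI)
      fix x assume "x \<in> A"
      obtain n where "\<bar>x\<bar> \<le> real n" using real_arch_simple by blast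
      then show "x \<in> (\<Union>n. A \<inter> {- real n..real n + 1})" using \<open>x \<in> A\<close> by (auto intro!: exI[of _ n])
    qed auto
    ultimately show "A \<in> null_sets \<mu>" by simp
  qed
  then obtain f where f: "f \<in> borel_measurable lborel" "density lborel f = \<mu>"
    using sigma_finite_measure.Radon_Nikodym[OF lborel.sigma_finite_measure_axioms, of \<mu>] sets_\<mu> by auto
  define g where "g x = enn2real (f x)" for x
  have g_meas: "g \<in> borel_measurable borel" using f(1) unfolding g_def by measurable
  have g0: "g x \<ge> 0" for x by (simp add: g_def)
  have fint: "(\<integral>\<^sup>+x. f x * indicator {u..v} x \<partial>lborel) = ennreal (H v - H u)" if "u \<le> v" for u v
    using Icc[OF that] emeasure_density[OF f(1), of "{u..v}"] f(2) by simp
  have gint: "(g has_integral G v - G u) {u..v}" if uv: "c \<le> u" "u \<le> v" "v \<le> d" for u v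
  proof -
    have "(\<integral>\<^sup>+x. f x * indicator {u..v} x \<partial>lborel) \<noteq> \<infinity>" using fint[OF uv(2)] by simp
    then have "AE x in lborel. f x * indicator {u..v} x \<noteq> \<infinity>"
      using f(1) by (intro nn_integral_PInf_AE) auto
    then have "AE x in lborel. ennreal (indicator {u..v} x * g x) = f x * indicator {u..v} x"
      by eventually_elim (auto simp: indicator_def g_def less_top)
    then have "(\<integral>\<^sup>+x. ennreal (indicator {u..v} x * g x) \<partial>lborel) = ennreal (H v - H u)"
      using fint[OF uv(2)] nn_integral_cong_AE by metis
    then have "((\<lambda>x. indicator {u..v} x * g x) has_integral (H v - H u)) UNIV"
      by (rule nn_integral_has_integral[rotated 2])
        (use g_meas Hmono[OF uv(2)] g0 in auto)
    moreover have "(\<lambda>x. indicator {u..v} x * g x) = (\<lambda>x. if x \<in> {u..v} then g x else 0)"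
      by (auto simp: indicator_def)
    ultimately have "(g has_integral (H v - H u)) {u..v}"
      using has_integral_restrict_UNIV[of "{u..v}" g] by simp
    moreover have "H v = G v" "H u = G u" using uv by (auto simp: H_def)
    ultimately show ?thesis by simp
  qed
  have "g absolutely_integrable_on {c..d}"
    using gint[of c d] \<open>c \<le> d\<close> by (intro nonnegative_absolutely_integrable_1) (auto simp: g_def)
  then show thesis using that gint by blast
qed

text \<open>Cutting \<open>{c..d}\<close> into \<open>N\<close> pieces shorter than the \<open>\<delta>\<close> belonging to \<open>\<epsilon> = 1\<close> bounds the variation by \<open>N\<close>.\<close>

lemma AC_bounded_variation:
  assumes AC: "AC_on_interval c d f" and "c \<le> d"
  obtains B where "\<And>(m::nat) u v. \<lbrakk>\<And>i. i < m \<Longrightarrow> c \<le> u i \<and> u i \<le> v i \<and> v i \<le> d;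
      disjoint_family_on (\<lambda>i. {u i<..<v i}) {..<m}\<rbrakk> \<Longrightarrow> (\<Sum>i<m. norm (f (v i) - f (u i))) \<le> B"
proof -
  obtain \<delta> where \<delta>: "\<delta> > 0" "\<And>S u v. \<lbrakk>finite (S::nat set); \<And>i. i \<in> S \<Longrightarrow> c \<le> u i \<and> u i \<le> v i \<and> v i \<le> d;
        disjoint_family_on (\<lambda>i. {u i<..<v i}) S; (\<Sum>i\<in>S. v i - u i) < \<delta>\<rbrakk>
      \<Longrightarrow> (\<Sum>i\<in>S. norm (f (v i) - f (u i))) < 1"
    using AC_on_intervalE[OF AC zero_less_one] by blast
  obtain N where N: "(d - c) / \<delta> < real N" using reals_Archimedean2 by blast
  have "0 \<le> (d - c) / \<delta>" using \<open>c \<le> d\<close> \<delta>(1) by simp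
  then have N0: "real N > 0" using N by linarith
  define q where "q = (d - c) / real N"
  define t where "t k = c + real k * q" for k
  have "q \<ge> 0" "q < \<delta>" "real N * q = d - c"
    using N N0 \<delta>(1) \<open>c \<le> d\<close> by (simp_all add: q_def field_simps)
  have t_step: "t (Suc k) - t k = q" for k
    by (simp add: t_def distrib_right)
  have t_small: "t (Suc k) - t k < \<delta>" for k
    unfolding t_step by fact
  have t_mono: "t k \<le> t (Suc k)" for k using t_step[of k] \<open>q \<ge> 0\<close> by simp
  have t0: "t 0 = c" and tN: "t N = d" using \<open>real N * q = d - c\<close> by (auto simp: t_def)
  have t_lo: "c \<le> t k" for k using \<open>q \<ge> 0\<close> by (simp add: t_def)
  have t_hi: "t (Suc k) \<le> d" if "k < N" for k
  proof -
    have "t (Suc k) \<le> t N" unfolding t_def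
      using that \<open>q \<ge> 0\<close> by (intro add_left_mono mult_right_mono) auto
    then show ?thesis using tN by simp
  qed
  have tele: "(\<Sum>k<N. f (clip (t k) (t (Suc k)) y) - f (t k)) = f y - f c" if "c \<le> y" "y \<le> d" for y
  proof -
    have "f (clip (t k) (t (Suc k)) y) - f (t k) = f (min y (t (Suc k))) - f (min y (t k))" for k
      using t_mono[of k] by (cases "y \<le> t k") (auto simp: min_def max_def)
    then have "(\<Sum>k<N. f (clip (t k) (t (Suc k)) y) - f (t k)) = f (min y (t N)) - f (min y (t 0))"
      by (simp add: sum_lessThan_telescope[of "\<lambda>k. f (min y (t k))"])
    then show ?thesis using that by (simp add: t0 tN min_absorb1 min_absorb2)
  qed
  have "(\<Sum>i<m. norm (f (v i) - f (u i))) \<le> real N"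
    if uv: "\<And>i. i < m \<Longrightarrow> c \<le> u i \<and> u i \<le> v i \<and> v i \<le> d"
      and dis: "disjoint_family_on (\<lambda>i. {u i<..<v i}) {..<m}" for m :: nat and u v
  proof -
    let ?p = "\<lambda>k s. f (clip (t k) (t (Suc k)) s)"
    have "norm (f (v i) - f (u i)) \<le> (\<Sum>k<N. norm (?p k (v i) - ?p k (u i)))" if "i < m" for i
    proof -
      have "f (v i) - f (u i) = (\<Sum>k<N. ?p k (v i) - f (t k)) - (\<Sum>k<N. ?p k (u i) - f (t k))"
        using tele[of "u i"] tele[of "v i"] uv[OF that] by simp
      also have "\<dots> = (\<Sum>k<N. ?p k (v i) - ?p k (u i))"
        by (simp add: sum_subtractf)
      finally show ?thesis using norm_sum by metis
    qed
    then have "(\<Sum>i<m. norm (f (v i) - f (u i))) \<le> (\<Sum>i<m. \<Sum>k<N. norm (?p k (v i) - ?p k (u i)))"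
      by (intro sum_mono) auto
    also have "\<dots> = (\<Sum>k<N. \<Sum>i<m. norm (?p k (v i) - ?p k (u i)))" by (rule sum.swap)
    also have "\<dots> \<le> (\<Sum>k<N. 1)"
    proof (intro sum_mono less_imp_le)
      fix k assume "k \<in> {..<N}"
      show "(\<Sum>i<m. norm (?p k (v i) - ?p k (u i))) < 1"
      proof (rule \<delta>(2))
        show dis': "disjoint_family_on (\<lambda>i. {clip (t k) (t (Suc k)) (u i)<..<clip (t k) (t (Suc k)) (v i)}) {..<m}"
          by (rule disjoint_family_on_clip[OF dis])
        show "c \<le> clip (t k) (t (Suc k)) (u i) \<and> clip (t k) (t (Suc k)) (u i) \<le> clip (t k) (t (Suc k)) (v i)
            \<and> clip (t k) (t (Suc k)) (v i) \<le> d" if "i \<in> {..<m}" for i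
        proof (intro conjI)
          show "c \<le> clip (t k) (t (Suc k)) (u i)" using t_lo[of k] by (rule max.coboundedI1)
          show "clip (t k) (t (Suc k)) (u i) \<le> clip (t k) (t (Suc k)) (v i)"
            using uv[of i] that by (intro max.mono min.mono) auto
          show "clip (t k) (t (Suc k)) (v i) \<le> d"
            using t_hi[of k] t_mono[of k] \<open>k \<in> {..<N}\<close> by auto
        qed
        have "(\<Sum>i<m. clip (t k) (t (Suc k)) (v i) - clip (t k) (t (Suc k)) (u i)) \<le> measure lebesgue {t k<..<t (Suc k)}"
        proof (rule sum_lengths_le_measure[OF _ _ dis'])
          show "{clip (t k) (t (Suc k)) (u i)<..<clip (t k) (t (Suc k)) (v i)} \<subseteq> {t k<..<t (Suc k)}" for i
            using t_mono[of k] by (auto simp: max_def min_def split: if_splits)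
          show "clip (t k) (t (Suc k)) (u i) \<le> clip (t k) (t (Suc k)) (v i)" if "i \<in> {..<m}" for i
            using uv[of i] that by (intro max.mono min.mono) auto
        qed auto
        then show "(\<Sum>i<m. clip (t k) (t (Suc k)) (v i) - clip (t k) (t (Suc k)) (u i)) < \<delta>"
          using t_mono[of k] t_small[of k] by (simp add: measure_def)
      qed simp
    qed
    finally show ?thesis by simp
  qed
  then show thesis by (rule that)
qed

text \<open>\<open>V x\<close> is the total variation of \<open>f\<close> on \<open>{c..x}\<close>, as a supremum over families of disjoint intervals in
\<open>{c..d}\<close> that are clipped to \<open>{c..x}\<close>.\<close>

lemma AC_variation:
  assumes AC: "AC_on_interval c d f" and "c \<le> d"
  obtains V :: "real \<Rightarrow> real" where
    "\<And>x y. \<lbrakk>c \<le> x; x \<le> y; y \<le> d\<rbrakk> \<Longrightarrow> norm (f y - f x) \<le> V y - V x"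
    "AC_on_interval c d (\<lambda>x. complex_of_real (V x))"
proof -
  define Fam where "Fam = {(m::nat, u::nat\<Rightarrow>real, v::nat\<Rightarrow>real).
     (\<forall>i<m. c \<le> u i \<and> u i \<le> v i \<and> v i \<le> d) \<and> disjoint_family_on (\<lambda>i. {u i<..<v i}) {..<m}}"
  define S where "S a b p = (case p of (m,u,v) \<Rightarrow>
     (\<Sum>i<m. norm (f (clip a b (v i)) - f (clip a b (u i)))))"
    for a b :: real and p :: "nat \<times> (nat \<Rightarrow> real) \<times> (nat \<Rightarrow> real)"
  define V where "V x = (SUP p\<in>Fam. S c x p)" for x
  have clip_Fam: "(m, \<lambda>i. clip a b (u i), \<lambda>i. clip a b (v i)) \<in> Fam"
    if "(m,u,v) \<in> Fam" "c \<le> a" "a \<le> b" "b \<le> d" for m u v a b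
    using that disjoint_family_on_clip[of u v "{..<m}" a b]
    by (auto simp: Fam_def le_max_iff_disj min_le_iff_disj intro!: max.mono min.mono)
  obtain B where B: "\<And>(m::nat) u v. \<lbrakk>\<And>i. i < m \<Longrightarrow> c \<le> u i \<and> u i \<le> v i \<and> v i \<le> d;
      disjoint_family_on (\<lambda>i. {u i<..<v i}) {..<m}\<rbrakk> \<Longrightarrow> (\<Sum>i<m. norm (f (v i) - f (u i))) \<le> B"
    using AC_bounded_variation[OF AC \<open>c \<le> d\<close>] by blast
  have bdd: "bdd_above (S c x ` Fam)" if x: "c \<le> x" "x \<le> d" for x
  proof (rule bdd_aboveI2)
    fix p assume p: "p \<in> Fam"
    obtain m u v where muv: "p = (m,u,v)" by (cases p)
    then have "(m, \<lambda>i. clip c x (u i), \<lambda>i. clip c x (v i)) \<in> Fam"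
      using clip_Fam[of m u v c x] p x by auto
    then show "S c x p \<le> B"
      unfolding S_def muv prod.case by (intro B) (auto simp: Fam_def)
  qed
  have "(0, \<lambda>_. 0, \<lambda>_. 0) \<in> Fam" by (auto simp: Fam_def disjoint_family_on_def)
  then have ne: "Fam \<noteq> {}" by blast
  have S_le: "S c x p \<le> V x" if "p \<in> Fam" "c \<le> x" "x \<le> d" for p x
    unfolding V_def using that by (intro cSUP_upper bdd) auto
  have incr: "norm (f y - f x) \<le> V y - V x" if xy: "c \<le> x" "x \<le> y" "y \<le> d" for x y
  proof -
    have "V x \<le> V y - norm (f y - f x)"
      unfolding V_def[of x]
    proof (rule cSUP_least[OF ne])
      fix p assume p: "p \<in> Fam"
      obtain m u v where muv: "p = (m,u,v)" by (cases p)
      \<comment> \<open>the family clipped to \<open>{c..x}\<close>, with the interval from \<open>x\<close> to \<open>y\<close> added\<close>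
      define u' v' where "u' i = (if i < m then clip c x (u i) else x)"
        and "v' i = (if i < m then clip c x (v i) else y)" for i
      have cl: "(m, \<lambda>i. clip c x (u i), \<lambda>i. clip c x (v i)) \<in> Fam"
        using clip_Fam[of m u v c x] p xy muv by auto
      have dis0: "disjoint_family_on (\<lambda>i. {clip c x (u i)<..<clip c x (v i)}) {..<m}"
        using cl by (auto simp: Fam_def)
      have le_x: "clip c x s \<le> x" for s using xy by auto
      have "(Suc m, u', v') \<in> Fam"
        unfolding Fam_def mem_Collect_eq prod.case
      proof (intro conjI allI impI)
        fix i assume "i < Suc m"
        show "c \<le> u' i" using xy by (auto simp: u'_def)
        show "u' i \<le> v' i" using xy cl unfolding Fam_def u'_def v'_def by auto
        show "v' i \<le> d" using xy le_x[of "v i"] by (auto simp: v'_def)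
      next
        show "disjoint_family_on (\<lambda>i. {u' i<..<v' i}) {..<Suc m}"
          unfolding disjoint_family_on_def
        proof (intro ballI impI)
          fix i j assume ij: "i \<in> {..<Suc m}" "j \<in> {..<Suc m}" "i \<noteq> j"
          have last: "{u' i<..<v' i} \<inter> {x<..<y} = {}" if "i < m" for i
            using le_x[of "v i"] that by (auto simp: v'_def)
          consider "i < m" "j < m" | "i < m" "j = m" | "i = m" "j < m" using ij by force
          then show "{u' i<..<v' i} \<inter> {u' j<..<v' j} = {}"
          proof cases
            case 1
            then show ?thesis using dis0 ij unfolding disjoint_family_on_def u'_def v'_def by auto
          next
            case 2
            then show ?thesis using last[of i] by (simp add: u'_def v'_def)
          next
            case 3
            then show ?thesis using last[of j] by (simp add: u'_def v'_def Int_commute)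
          qed
        qed
      qed
      then have "S c y (Suc m, u', v') \<le> V y" using xy by (intro S_le) auto
      moreover have "clip c y (u' i) = clip c x (u i)" "clip c y (v' i) = clip c x (v i)" if "i < m" for i
        using that xy by (auto simp: u'_def v'_def)
      then have "S c y (Suc m, u', v') = S c x p + norm (f y - f x)"
        unfolding S_def muv using xy by (simp add: u'_def v'_def)
      ultimately show "S c x p \<le> V y - norm (f y - f x)" by simp
    qed
    then show ?thesis by simp
  qed
  have S_diff: "S c y p - S c x p \<le> S x y p" if xy: "c \<le> x" "x \<le> y" for x y p
  proof -
    obtain m u v where muv: "p = (m,u,v)" by (cases p)
    have split: "f (clip c y s) = f (clip c x s) + f (clip x y s) - f x" for s
      using xy by (auto simp: max_def min_def)
    have "norm (f (clip c y (v i)) - f (clip c y (u i))) \<le>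
        norm (f (clip c x (v i)) - f (clip c x (u i))) + norm (f (clip x y (v i)) - f (clip x y (u i)))" for i
      unfolding split[of "v i"] split[of "u i"]
      by (rule order.trans[OF _ norm_triangle_ineq]) (simp add: algebra_simps)
    then have "S c y p \<le> S c x p + S x y p"
      unfolding S_def muv prod.case sum.distrib[symmetric] by (intro sum_mono)
    then show ?thesis by simp
  qed
  have "AC_on_interval c d (\<lambda>x. complex_of_real (V x))"
    unfolding AC_of_real_iff
  proof (intro allI impI)
    fix \<epsilon> :: real assume "\<epsilon> > 0"
    then obtain \<delta> where \<delta>: "\<delta> > 0" "\<And>S u v. \<lbrakk>finite (S::(nat\<times>nat) set); \<And>i. i \<in> S \<Longrightarrow> c \<le> u i \<and> u i \<le> v i \<and> v i \<le> d;
        disjoint_family_on (\<lambda>i. {u i<..<v i}) S; (\<Sum>i\<in>S. v i - u i) < \<delta>\<rbrakk>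
      \<Longrightarrow> (\<Sum>i\<in>S. norm (f (v i) - f (u i))) < \<epsilon>/2"
      using AC_on_intervalE[OF AC half_gt_zero] by blast
    show "\<exists>\<delta>>0. \<forall>(m::nat) u v. (\<forall>i<m. c \<le> u i \<and> u i \<le> v i \<and> v i \<le> d) \<longrightarrow>
        disjoint_family_on (\<lambda>i. {u i<..<v i}) {..<m} \<longrightarrow>
        (\<Sum>i<m. v i - u i) < \<delta> \<longrightarrow> (\<Sum>i<m. \<bar>V (v i) - V (u i)\<bar>) < \<epsilon>"
    proof (intro exI[of _ \<delta>] conjI \<delta>(1) allI impI)
      fix m :: nat and x y :: "nat \<Rightarrow> real"
      assume xy: "\<forall>i<m. c \<le> x i \<and> x i \<le> y i \<and> y i \<le> d"
        and dis: "disjoint_family_on (\<lambda>i. {x i<..<y i}) {..<m}" and small: "(\<Sum>i<m. y i - x i) < \<delta>"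
      define e where "e = \<epsilon> / (2 * (real m + 1))"
      have "e > 0" using \<open>\<epsilon> > 0\<close> by (simp add: e_def)
      have "\<exists>p\<in>Fam. V (y i) - e < S c (y i) p" if "i < m" for i
        using less_cSUP_iff[OF ne bdd[of "y i"], of "V (y i) - e"] xy that \<open>e > 0\<close>
        by (force simp: V_def)
      \<comment> \<open>a nearly optimal family for each interval; their clippings form one double family\<close>
      then obtain p where p: "\<And>i. i < m \<Longrightarrow> p i \<in> Fam" "\<And>i. i < m \<Longrightarrow> V (y i) - e < S c (y i) (p i)"
        by metis
      define M U W where "M i = fst (p i)" and "U i = fst (snd (p i))" and "W i = snd (snd (p i))" for i
      have pM: "p i = (M i, U i, W i)" for i by (simp add: M_def U_def W_def)
      have Fam_i: "\<And>k. k < M i \<Longrightarrow> U i k \<le> W i k" "disjoint_family_on (\<lambda>k. {U i k<..<W i k}) {..<M i}"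
        if "i < m" for i
        using p(1)[OF that] unfolding pM Fam_def by auto
      let ?D = "SIGMA i:{..<m}. {..<M i}"
      let ?u = "\<lambda>(i,k). clip (x i) (y i) (U i k)" and ?w = "\<lambda>(i,k). clip (x i) (y i) (W i k)"
      have in_xy: "x i \<le> clip (x i) (y i) s \<and> clip (x i) (y i) s \<le> y i" if "i < m" for i s
        using xy that by auto
      have disD: "disjoint_family_on (\<lambda>q. {?u q<..<?w q}) ?D"
        unfolding disjoint_family_on_def
      proof (intro ballI impI)
        fix q q' assume q: "q \<in> ?D" "q' \<in> ?D" "q \<noteq> q'"
        obtain i k i' k' where qq: "q = (i,k)" "q' = (i',k')" by (cases q, cases q')
        show "{?u q<..<?w q} \<inter> {?u q'<..<?w q'} = {}"
        proof (cases "i = i'")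
          case True
          then have "k \<noteq> k'" "i < m" "k < M i" "k' < M i" using q qq by auto
          then have "{clip (x i) (y i) (U i k)<..<clip (x i) (y i) (W i k)} \<inter>
              {clip (x i) (y i) (U i k')<..<clip (x i) (y i) (W i k')} = {}"
            using disjoint_family_on_clip[OF Fam_i(2)[OF \<open>i < m\<close>], of "x i" "y i"]
            \<open>k < M i\<close> \<open>k' < M i\<close> \<open>k \<noteq> k'\<close>
            unfolding disjoint_family_on_def by (metis lessThan_iff)
          then show ?thesis unfolding qq prod.case True[symmetric] .
        next
          case False
          then have im: "i < m" "i' < m" using q qq by auto
          have "{x i<..<y i} \<inter> {x i'<..<y i'} = {}"
            using dis im False unfolding disjoint_family_on_def by auto
          moreover have "{?u q<..<?w q} \<subseteq> {x i<..<y i}" "{?u q'<..<?w q'} \<subseteq> {x i'<..<y i'}"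
            using in_xy[OF im(1)] in_xy[OF im(2)] unfolding qq prod.case
            by (simp_all only: greaterThanLessThan_subseteq_greaterThanLessThan simp_thms)
          ultimately show ?thesis by blast
        qed
      qed
      have uw: "?u q \<le> ?w q" if "q \<in> ?D" for q
        using that Fam_i(1) by (cases q) (auto simp del: max.bounded_iff intro!: max.mono min.mono)
      have len: "(\<Sum>q\<in>?D. ?w q - ?u q) \<le> (\<Sum>i<m. y i - x i)"
      proof -
        have "(\<Sum>k<M i. clip (x i) (y i) (W i k) - clip (x i) (y i) (U i k)) \<le> y i - x i" if "i < m" for i
        proof -
          have "(\<Sum>k<M i. clip (x i) (y i) (W i k) - clip (x i) (y i) (U i k)) \<le> measure lebesgue {x i<..<y i}"
          proof (rule sum_lengths_le_measure[OF _ _ disjoint_family_on_clip[OF Fam_i(2)[OF that]]])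
            show "{clip (x i) (y i) (U i k)<..<clip (x i) (y i) (W i k)} \<subseteq> {x i<..<y i}" for k
              using in_xy[OF that] by (simp only: greaterThanLessThan_subseteq_greaterThanLessThan simp_thms)
            show "clip (x i) (y i) (U i k) \<le> clip (x i) (y i) (W i k)" if "k \<in> {..<M i}" for k
              using Fam_i(1)[OF \<open>i < m\<close>] that by (intro max.mono min.mono) auto
          qed auto
          then show ?thesis using xy that by (simp add: measure_def)
        qed
        then have "(\<Sum>i<m. \<Sum>k<M i. clip (x i) (y i) (W i k) - clip (x i) (y i) (U i k)) \<le> (\<Sum>i<m. y i - x i)"
          by (intro sum_mono) auto
        then show ?thesis by (subst (asm) sum.Sigma) (auto simp: case_prod_unfold)
      qed
      have "(\<Sum>i<m. \<bar>V (y i) - V (x i)\<bar>) \<le> (\<Sum>i<m. S (x i) (y i) (p i) + e)"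
      proof (intro sum_mono)
        fix i assume "i \<in> {..<m}"
        then have i: "i < m" "c \<le> x i" "x i \<le> y i" "y i \<le> d" using xy by auto
        have "0 \<le> V (y i) - V (x i)" using incr[OF i(2-4)] by (meson norm_ge_zero order.trans)
        moreover have "V (y i) - V (x i) \<le> S (x i) (y i) (p i) + e"
          using p(2)[OF i(1)] S_le[OF p(1)[OF i(1)], of "x i"] S_diff[OF i(2,3), of "p i"] i by linarith
        ultimately show "\<bar>V (y i) - V (x i)\<bar> \<le> S (x i) (y i) (p i) + e" by simp
      qed
      also have "\<dots> = (\<Sum>q\<in>?D. norm (f (?w q) - f (?u q))) + real m * e"
        unfolding sum.distrib pM S_def prod.case by (subst sum.Sigma) (auto simp: case_prod_unfold)
      also have "(\<Sum>q\<in>?D. norm (f (?w q) - f (?u q))) < \<epsilon>/2"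
      proof (rule \<delta>(2)[OF _ _ disD])
        show "c \<le> ?u q \<and> ?u q \<le> ?w q \<and> ?w q \<le> d" if q: "q \<in> ?D" for q
        proof -
          obtain i k where qq: "q = (i,k)" by (cases q)
          then have i: "i < m" "c \<le> x i" "y i \<le> d" using q xy by auto
          show ?thesis using uw[OF q] in_xy[OF i(1)] i unfolding qq prod.case by (meson order.trans)
        qed
      qed (use len small in auto)
      also have "\<epsilon>/2 + real m * e \<le> \<epsilon>"
        using \<open>\<epsilon> > 0\<close> by (simp add: e_def field_simps)
      finally show "(\<Sum>i<m. \<bar>V (y i) - V (x i)\<bar>) < \<epsilon>" by simp
    qed
  qed
  with incr show thesis by (rule that)
qed

lemma AC_on_interval_dominated:
  assumes f: "AC_on_interval c d f" and g: "AC_on_interval c d g" and "0 \<le> K"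
    and dom: "\<And>u v. \<lbrakk>c \<le> u; u \<le> v; v \<le> d\<rbrakk> \<Longrightarrow>
      norm (h v - h u) \<le> K * norm (f v - f u) + K * norm (g v - g u)"
  shows "AC_on_interval c d h"
  unfolding AC_on_interval_def
proof (intro allI impI)
  fix \<epsilon> :: real assume "\<epsilon> > 0"
  define e where "e = \<epsilon> / (2 * (K + 1))"
  have "e > 0" using \<open>\<epsilon> > 0\<close> \<open>0 \<le> K\<close> by (simp add: e_def)
  obtain \<delta>1 where \<delta>1: "\<delta>1 > 0" "\<And>S u v. \<lbrakk>finite (S::nat set); \<And>i. i \<in> S \<Longrightarrow> c \<le> u i \<and> u i \<le> v i \<and> v i \<le> d;
        disjoint_family_on (\<lambda>i. {u i<..<v i}) S; (\<Sum>i\<in>S. v i - u i) < \<delta>1\<rbrakk>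
      \<Longrightarrow> (\<Sum>i\<in>S. norm (f (v i) - f (u i))) < e"
    using AC_on_intervalE[OF f \<open>e > 0\<close>] by blast
  obtain \<delta>2 where \<delta>2: "\<delta>2 > 0" "\<And>S u v. \<lbrakk>finite (S::nat set); \<And>i. i \<in> S \<Longrightarrow> c \<le> u i \<and> u i \<le> v i \<and> v i \<le> d;
        disjoint_family_on (\<lambda>i. {u i<..<v i}) S; (\<Sum>i\<in>S. v i - u i) < \<delta>2\<rbrakk>
      \<Longrightarrow> (\<Sum>i\<in>S. norm (g (v i) - g (u i))) < e"
    using AC_on_intervalE[OF g \<open>e > 0\<close>] by blast
  show "\<exists>\<delta>>0. \<forall>(m::nat) u v. (\<forall>i<m. c \<le> u i \<and> u i \<le> v i \<and> v i \<le> d) \<longrightarrow>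
        disjoint_family_on (\<lambda>i. {u i<..<v i}) {..<m} \<longrightarrow> (\<Sum>i<m. v i - u i) < \<delta> \<longrightarrow>
        (\<Sum>i<m. norm (h (v i) - h (u i))) < \<epsilon>"
  proof (intro exI[of _ "min \<delta>1 \<delta>2"] conjI allI impI)
    show "0 < min \<delta>1 \<delta>2" using \<delta>1 \<delta>2 by simp
    fix m :: nat and u v :: "nat \<Rightarrow> real"
    assume *: "\<forall>i<m. c \<le> u i \<and> u i \<le> v i \<and> v i \<le> d"
      "disjoint_family_on (\<lambda>i. {u i<..<v i}) {..<m}" "(\<Sum>i<m. v i - u i) < min \<delta>1 \<delta>2"
    have 1: "(\<Sum>i<m. norm (f (v i) - f (u i))) < e" by (rule \<delta>1(2)) (use * in auto)
    have 2: "(\<Sum>i<m. norm (g (v i) - g (u i))) < e" by (rule \<delta>2(2)) (use * in auto)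
    have "(\<Sum>i<m. norm (h (v i) - h (u i))) \<le>
        (\<Sum>i<m. K * norm (f (v i) - f (u i)) + K * norm (g (v i) - g (u i)))"
      using * by (intro sum_mono dom) auto
    also have "\<dots> = K * (\<Sum>i<m. norm (f (v i) - f (u i))) + K * (\<Sum>i<m. norm (g (v i) - g (u i)))"
      by (simp add: sum.distrib sum_distrib_left)
    also have "\<dots> \<le> K * e + K * e"
      using 1 2 \<open>0 \<le> K\<close> by (intro add_mono mult_left_mono) auto
    also have "\<dots> < \<epsilon>"
    proof -
      have "2 * (K + 1) * e = \<epsilon>" using \<open>0 \<le> K\<close> by (simp add: e_def)
      then show ?thesis using \<open>e > 0\<close> by (simp add: algebra_simps)
    qed
    finally show "(\<Sum>i<m. norm (h (v i) - h (u i))) < \<epsilon>" .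
  qed
qed

text \<open>The real and imaginary parts of \<open>f\<close> are differences of the monotone absolutely continuous functions
\<open>V + Re f\<close>, \<open>V + Im f\<close> and \<open>V\<close>, where \<open>V\<close> is the total variation.\<close>

lemma AC_on_interval_integral_form:
  assumes AC: "AC_on_interval c d f" and "c \<le> d"
  obtains g where "g absolutely_integrable_on {c..d}"
    "\<And>u v. \<lbrakk>c \<le> u; u \<le> v; v \<le> d\<rbrakk> \<Longrightarrow> (g has_integral f v - f u) {u..v}"
proof -
  obtain V where V: "\<And>x y. \<lbrakk>c \<le> x; x \<le> y; y \<le> d\<rbrakk> \<Longrightarrow> norm (f y - f x) \<le> V y - V x"
    "AC_on_interval c d (\<lambda>x. complex_of_real (V x))"
    using AC_variation[OF AC \<open>c \<le> d\<close>] by blast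
  have Vmono: "V x \<le> V y" if "c \<le> x" "x \<le> y" "y \<le> d" for x y
    using V(1)[OF that] norm_ge_zero[of "f y - f x"] by linarith
  have part: "\<exists>h. h absolutely_integrable_on {c..d} \<and>
      (\<forall>u v. c \<le> u \<longrightarrow> u \<le> v \<longrightarrow> v \<le> d \<longrightarrow> (h has_integral P (f v) - P (f u)) {u..v})"
    if P: "\<And>z w. \<bar>P z - P w\<bar> \<le> norm (z - w)" for P :: "complex \<Rightarrow> real"
  proof -
    have Pm: "\<bar>P (f y) - P (f x)\<bar> \<le> V y - V x" if "c \<le> x" "x \<le> y" "y \<le> d" for x y
      using P[of "f y" "f x"] V(1)[OF that] by linarith
    have "AC_on_interval c d (\<lambda>x. complex_of_real (V x + P (f x)))"
    proof (rule AC_on_interval_dominated[OF V(2) AC, of 1])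
      fix u v
      have "\<bar>V v + P (f v) - (V u + P (f u))\<bar> \<le> \<bar>V v - V u\<bar> + norm (f v - f u)"
        using P[of "f v" "f u"] by linarith
      then show "norm (complex_of_real (V v + P (f v)) - complex_of_real (V u + P (f u)))
         \<le> 1 * norm (complex_of_real (V v) - complex_of_real (V u)) + 1 * norm (f v - f u)"
        unfolding of_real_diff[symmetric] norm_of_real by simp
    qed simp
    moreover have "V x + P (f x) \<le> V y + P (f y)" if "c \<le> x" "x \<le> y" "y \<le> d" for x y
      using Pm[OF that] by linarith
    ultimately obtain g1 where g1: "g1 absolutely_integrable_on {c..d}"
      "\<And>u v. \<lbrakk>c \<le> u; u \<le> v; v \<le> d\<rbrakk> \<Longrightarrow> (g1 has_integral (V v + P (f v)) - (V u + P (f u))) {u..v}"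
      using mono_AC_is_integral[of c d "\<lambda>x. V x + P (f x)"] \<open>c \<le> d\<close> by blast
    obtain g2 where g2: "g2 absolutely_integrable_on {c..d}"
      "\<And>u v. \<lbrakk>c \<le> u; u \<le> v; v \<le> d\<rbrakk> \<Longrightarrow> (g2 has_integral V v - V u) {u..v}"
      using mono_AC_is_integral[of c d V] V(2) Vmono \<open>c \<le> d\<close> by blast
    have "((\<lambda>x. g1 x - g2 x) has_integral P (f v) - P (f u)) {u..v}"
      if "c \<le> u" "u \<le> v" "v \<le> d" for u v
      using has_integral_diff[OF g1(2)[OF that] g2(2)[OF that]] by (simp add: algebra_simps)
    moreover have "(\<lambda>x. g1 x - g2 x) absolutely_integrable_on {c..d}"
      using set_integral_diff(1)[OF g1(1) g2(1)] .
    ultimately show ?thesis by blast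
  qed
  obtain p where p: "p absolutely_integrable_on {c..d}"
      "\<And>u v. \<lbrakk>c \<le> u; u \<le> v; v \<le> d\<rbrakk> \<Longrightarrow> (p has_integral Re (f v) - Re (f u)) {u..v}"
    using part[of Re] abs_Re_le_cmod by (metis minus_complex.sel(1))
  obtain q where q: "q absolutely_integrable_on {c..d}"
      "\<And>u v. \<lbrakk>c \<le> u; u \<le> v; v \<le> d\<rbrakk> \<Longrightarrow> (q has_integral Im (f v) - Im (f u)) {u..v}"
    using part[of Im] abs_Im_le_cmod by (metis minus_complex.sel(2))
  define g where "g x = complex_of_real (p x) + \<i> * complex_of_real (q x)" for x
  have "g absolutely_integrable_on {c..d}"
    unfolding g_def using p(1) q(1)
    by (intro set_integral_add(1) set_integrable_mult_right) (auto simp: set_integrable_def scaleR_conv_of_real simp flip: of_real_mult)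
  moreover have "(g has_integral f v - f u) {u..v}" if "c \<le> u" "u \<le> v" "v \<le> d" for u v
  proof -
    have "(g has_integral complex_of_real (Re (f v) - Re (f u)) + \<i> * complex_of_real (Im (f v) - Im (f u))) {u..v}"
      unfolding g_def
      by (intro has_integral_add has_integral_mult_right has_integral_of_real p(2) q(2) that)
    moreover have "complex_of_real (Re (f v) - Re (f u)) + \<i> * complex_of_real (Im (f v) - Im (f u)) = f v - f u"
      by (simp add: complex_eq_iff)
    ultimately show ?thesis by (simp only:)
  qed
  ultimately show thesis by (rule that)
qed

text \<open>Lebesgue's fundamental theorem of calculus. The value of \<open>vector_derivative\<close> at the points without a
derivative is irrelevant, as these form a null set.\<close>

theorem AC_on_interval_FTC:
  assumes AC: "AC_on_interval c d f" and "c \<le> d"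
  shows AC_AE_differentiable: "AE x in lebesgue. x \<in> {c<..<d} \<longrightarrow> f differentiable (at x)"
    and "(\<lambda>x. vector_derivative f (at x)) absolutely_integrable_on {c..d}"
    and "\<And>u v. \<lbrakk>c \<le> u; u \<le> v; v \<le> d\<rbrakk> \<Longrightarrow>
      ((\<lambda>x. vector_derivative f (at x)) has_integral f v - f u) {u..v}"
proof -
  obtain g where g: "g absolutely_integrable_on {c..d}"
    "\<And>u v. \<lbrakk>c \<le> u; u \<le> v; v \<le> d\<rbrakk> \<Longrightarrow> (g has_integral f v - f u) {u..v}"
    using AC_on_interval_integral_form[OF assms] by blast
  have AE: "AE x in lebesgue. x \<in> {c<..<d} \<longrightarrow> (f has_vector_derivative g x) (at x)"
    using g(2) set_lebesgue_integral_eq_integral(1)[OF g(1)]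
    by (intro indefinite_integral_derivative_AE) (metis integral_unique)+
  then show "AE x in lebesgue. x \<in> {c<..<d} \<longrightarrow> f differentiable (at x)"
    by eventually_elim (auto intro: differentiableI_vector)
  have "AE x in lebesgue. x \<in> {c<..<d} \<longrightarrow> vector_derivative f (at x) = g x"
    using AE by eventually_elim (auto intro: vector_derivative_at)
  then obtain N where N: "negligible N" "{x. \<not> (x \<in> {c<..<d} \<longrightarrow> vector_derivative f (at x) = g x)} \<subseteq> N"
    unfolding eventually_ae_filter_negligible by blast
  have neg: "negligible (N \<union> {c, d})" using N(1) by simp
  have eq: "g x = vector_derivative f (at x)" if "x \<in> {c..d} - (N \<union> {c,d})" for x
    using that N(2) by force
  show "(\<lambda>x. vector_derivative f (at x)) absolutely_integrable_on {c..d}"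
    using g(1) neg by (rule absolutely_integrable_spike) (use eq in auto)
  show "((\<lambda>x. vector_derivative f (at x)) has_integral f v - f u) {u..v}"
    if "c \<le> u" "u \<le> v" "v \<le> d" for u v
    by (rule has_integral_spike[OF neg _ g(2)[OF that]]) (use eq that in auto)
qed

lemma locally_AC_AE_differentiable:
  assumes "open I" "locally_AC_on I f"
  shows "AE x in lebesgue. x \<in> I \<longrightarrow> f differentiable (at x)"
proof -
  have "AE x in lebesgue. {a..b} \<subseteq> I \<longrightarrow> x \<in> {a<..<b} \<longrightarrow> f differentiable (at x)" for a b
  proof (cases "{a..b} \<subseteq> I \<and> a \<le> b")
    case True
    then have "AC_on_interval a b f" using assms(2) by (simp add: locally_AC_on_def)
    then show ?thesis using AC_AE_differentiable[of a b f] True by simp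
  qed auto
  then have "AE x in lebesgue. \<forall>a b. {of_rat a..of_rat b} \<subseteq> I \<longrightarrow> x \<in> {of_rat a<..<of_rat b} \<longrightarrow> f differentiable (at x)"
    by (simp add: AE_all_countable)
  then show ?thesis
  proof eventually_elim
    case (elim x)
    show ?case
    proof
      assume "x \<in> I"
      then obtain e where e: "e > 0" "cball x e \<subseteq> I" using assms(1) open_contains_cball by blast
      obtain a where a: "x - e < of_rat a" "of_rat a < x" using of_rat_dense[of "x - e" x] e by auto
      obtain b where b: "x < of_rat b" "of_rat b < x + e" using of_rat_dense[of x "x + e"] e by auto
      have "{of_rat a..of_rat b} \<subseteq> I" using a b e(2) by (auto simp: cball_eq_atLeastAtMost)
      then show "f differentiable (at x)" using elim a b by auto
    qed
  qed
qed

section \<open>Functions with absolutely continuous derivatives\<close>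

lemma AC_on_interval_add:
  assumes "AC_on_interval c d f" "AC_on_interval c d g"
  shows "AC_on_interval c d (\<lambda>x. f x + g x)"
proof (rule AC_on_interval_dominated[OF assms, of 1])
  fix u v
  have "f v + g v - (f u + g u) = (f v - f u) + (g v - g u)" by simp
  then show "norm (f v + g v - (f u + g u)) \<le> 1 * norm (f v - f u) + 1 * norm (g v - g u)"
    by (metis mult_1 norm_triangle_ineq)
qed simp

lemma AC_on_interval_mult:
  assumes f: "AC_on_interval c d f" and g: "AC_on_interval c d g"
  shows "AC_on_interval c d (\<lambda>x. f x * g x)"
proof -
  have bnd: "\<exists>A. \<forall>x\<in>{c..d}. norm (h x) \<le> A" if "AC_on_interval c d h" for h
    using compact_imp_bounded[OF compact_continuous_image[OF AC_on_interval_continuous[OF that] compact_Icc]]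
    by (simp add: bounded_iff)
  obtain A B where A: "\<forall>x\<in>{c..d}. norm (f x) \<le> A" and B: "\<forall>x\<in>{c..d}. norm (g x) \<le> B"
    using bnd[OF f] bnd[OF g] by (elim exE)
  define K where "K = max 0 (max A B)"
  show ?thesis
  proof (rule AC_on_interval_dominated[OF f g, of K])
    fix u v assume uv: "c \<le> u" "u \<le> v" "v \<le> d"
    have fu: "norm (f u) \<le> K" and gv: "norm (g v) \<le> K" and K0: "0 \<le> K"
      using bspec[OF A, of u] bspec[OF B, of v] uv unfolding K_def by (simp_all add: le_max_iff_disj)
    have "f v * g v - f u * g u = (f v - f u) * g v + f u * (g v - g u)" by (simp add: algebra_simps)
    then have "norm (f v * g v - f u * g u) \<le> norm ((f v - f u) * g v) + norm (f u * (g v - g u))"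
      by (simp only: norm_triangle_ineq)
    also have "\<dots> = norm (f v - f u) * norm (g v) + norm (f u) * norm (g v - g u)"
      by (simp only: norm_mult)
    also have "\<dots> \<le> norm (f v - f u) * K + K * norm (g v - g u)"
      using fu gv K0 by (intro add_mono mult_mono) simp_all
    finally show "norm (f v * g v - f u * g u) \<le> K * norm (f v - f u) + K * norm (g v - g u)"
      unfolding mult.commute[of "norm (f v - f u)" K] .
  next
    show "0 \<le> K" unfolding K_def by (rule max.cobounded1)
  qed
qed

lemma C1_AC_on_interval:
  assumes der: "\<And>x. x \<in> {c..d} \<Longrightarrow> (f has_vector_derivative f' x) (at x)" and cont: "continuous_on {c..d} f'"
  shows "AC_on_interval c d f"
proof (rule indefinite_integral_AC)
  show "f' absolutely_integrable_on {c..d}"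
    using cont by (rule absolutely_integrable_continuous_real)
  show "f v - f u = integral {u..v} f'" if "c \<le> u" "u \<le> v" "v \<le> d" for u v
  proof -
    have "(f' has_integral f v - f u) {u..v}"
      using that der by (intro fundamental_theorem_of_calculus) (auto intro: has_vector_derivative_at_within)
    then show ?thesis by (rule integral_unique[symmetric])
  qed
qed

lemma nderiv_0 [simp]: "nderiv 0 f = f"
  by (simp add: nderiv_def)

lemma nderiv_Suc: "nderiv (Suc m) f x = vector_derivative (nderiv m f) (at x)"
  by (simp add: nderiv_def)

lemma nderiv_1: "nderiv (Suc 0) f x = vector_derivative f (at x)"
  by (simp add: nderiv_Suc)

lemma nderiv_nderiv: "nderiv m (nderiv k f) = nderiv (m + k) f"
  by (simp add: nderiv_def funpow_add)

lemma nderiv_Suc_shift: "nderiv (Suc m) f = nderiv m (nderiv (Suc 0) f)"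
  by (simp add: nderiv_nderiv)

lemma nderiv_cong:
  assumes "open J" "\<And>x. x \<in> J \<Longrightarrow> f x = g x" "x \<in> J"
  shows "nderiv m f x = nderiv m g x"
  using assms(3)
proof (induction m arbitrary: x)
  case (Suc m)
  have "\<forall>\<^sub>F y in nhds x. nderiv m f y = nderiv m g y"
    using eventually_nhds_in_open[OF assms(1) Suc.prems] by (rule eventually_mono) (rule Suc.IH)
  then show ?case
    unfolding nderiv_Suc by (intro vector_derivative_cong_eq) auto
qed (simp add: assms(2))

lemma nderiv_const: "nderiv m (\<lambda>x. c) = (\<lambda>x. if m = 0 then c else 0)"
proof (induction m)
  case (Suc m)
  show ?case unfolding fun_eq_iff nderiv_Suc Suc by simp
qed simp

text \<open>\<open>AC_class J m f\<close>: the derivatives of \<open>f\<close> of orders below \<open>m\<close> exist on \<open>J\<close>, and the one of order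
\<open>m - 1\<close> is locally absolutely continuous there, so that the one of order \<open>m\<close> exists almost everywhere (the
local Sobolev class \<open>W\<^sup>m\<^sup>,\<^sup>1\<close>). Order \<open>0\<close> carries no condition at all, which makes statements that
hold almost everywhere uniform in \<open>m\<close>.\<close>

definition AC_class :: "real set \<Rightarrow> nat \<Rightarrow> (real \<Rightarrow> complex) \<Rightarrow> bool" where
  "AC_class J m f \<longleftrightarrow> m = 0 \<or> AC_nderiv_on J (m - 1) f"

lemma AC_class_0 [simp]: "AC_class J 0 f"
  by (simp add: AC_class_def)

lemma AC_class_Suc: "AC_class J (Suc m) f \<longleftrightarrow> AC_nderiv_on J m f"
  by (simp add: AC_class_def)

lemma AC_class_1: "AC_class J (Suc 0) f \<longleftrightarrow> locally_AC_on J f"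
  by (simp add: AC_class_def AC_nderiv_on_def)

lemma AC_class_Suc_Suc:
  "AC_class J (Suc (Suc m)) f \<longleftrightarrow> (\<forall>x\<in>J. f differentiable (at x)) \<and> AC_class J (Suc m) (nderiv (Suc 0) f)"
  by (auto simp: AC_class_Suc AC_nderiv_on_def All_less_Suc2 nderiv_Suc_shift[symmetric])

lemma AC_class_nderiv_Suc: "AC_class J (Suc m) f \<Longrightarrow> AC_class J m (nderiv (Suc 0) f)"
  by (cases m) (auto simp: AC_class_Suc_Suc)

lemma AC_class_nderiv: "AC_class J (m + k) f \<Longrightarrow> AC_class J m (nderiv k f)"
proof (induction k arbitrary: f)
  case (Suc k)
  then have "AC_class J (m + k) (nderiv (Suc 0) f)" using AC_class_nderiv_Suc[of J "m + k" f] by simp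
  then show ?case unfolding nderiv_Suc_shift[of k] by (rule Suc.IH)
qed simp

lemma AC_class_differentiable: "AC_class J (Suc (Suc m)) f \<Longrightarrow> x \<in> J \<Longrightarrow> f differentiable (at x)"
  by (simp add: AC_class_Suc_Suc)

lemma AC_class_has_derivative:
  "AC_class J (Suc (Suc m)) f \<Longrightarrow> x \<in> J \<Longrightarrow> (f has_vector_derivative nderiv (Suc 0) f x) (at x)"
  using AC_class_differentiable[of J m f x] by (simp add: nderiv_1 vector_derivative_works)

lemma AC_class_has_derivative_AE:
  assumes "open J" "AC_class J (Suc m) f"
  shows "AE x in lebesgue. x \<in> J \<longrightarrow> (f has_vector_derivative nderiv (Suc 0) f x) (at x)"
proof (cases m)
  case 0
  then show ?thesis
    using locally_AC_AE_differentiable[OF assms(1)] assms(2)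
    by (simp add: AC_class_1 nderiv_1 vector_derivative_works)
next
  case (Suc k)
  then show ?thesis using AC_class_has_derivative assms(2) by auto
qed

lemma AC_class_cong:
  assumes J: "open J" and eq: "\<And>x. x \<in> J \<Longrightarrow> f x = g x" and "AC_class J m f"
  shows "AC_class J m g"
  using assms(3) eq
proof (induction m arbitrary: f g rule: induct_nat_012)
  case 1
  have "AC_on_interval c d g" if "{c..d} \<subseteq> J" "AC_on_interval c d f" for c d
  proof (rule AC_on_interval_dominated[OF that(2) that(2), of 1])
    fix u v assume "c \<le> u" "u \<le> v" "v \<le> d"
    then have "u \<in> J" "v \<in> J" using that(1) by auto
    then have "g v - g u = f v - f u" using 1(2) by simp
    then show "norm (g v - g u) \<le> 1 * norm (f v - f u) + 1 * norm (f v - f u)" by simp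
  qed simp
  then show ?case using 1 by (simp add: AC_class_1 locally_AC_on_def)
next
  case (ge2 m)
  have "(g has_vector_derivative nderiv (Suc 0) f x) (at x)" if "x \<in> J" for x
    using J that ge2.prems(2)
    by (rule has_vector_derivative_transform_within_open[OF AC_class_has_derivative[OF ge2.prems(1) that]])
  then have "\<forall>x\<in>J. g differentiable (at x)" by (auto intro: differentiableI_vector)
  moreover have "AC_class J (Suc m) (nderiv (Suc 0) g)"
    by (rule ge2.IH(2)[OF AC_class_nderiv_Suc[OF ge2.prems(1)] nderiv_cong[OF J ge2.prems(2)]])
  ultimately show ?case unfolding AC_class_Suc_Suc by (rule conjI)
qed (rule AC_class_0)

lemma AC_class_continuous:
  assumes "AC_class J (Suc m) f" "open J"
  shows "continuous_on J f"
proof (cases m)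
  case 0
  have "isCont f x" if "x \<in> J" for x
  proof -
    obtain e where e: "e > 0" "cball x e \<subseteq> J" using \<open>x \<in> J\<close> assms(2) open_contains_cball by blast
    then have "AC_on_interval (x - e) (x + e) f"
      using assms 0 by (simp add: AC_class_1 locally_AC_on_def cball_eq_atLeastAtMost)
    then have "continuous_on {x - e..x + e} f" by (rule AC_on_interval_continuous)
    then show ?thesis using e by (intro continuous_on_interior) auto
  qed
  then show ?thesis by (simp add: continuous_at_imp_continuous_on)
next
  case (Suc k)
  then show ?thesis using assms
    by (intro continuous_at_imp_continuous_on ballI differentiable_imp_continuous_within AC_class_differentiable) auto
qed

lemma AC_class_Suc_imp: "open J \<Longrightarrow> AC_class J (Suc m) f \<Longrightarrow> AC_class J m f"
proof (induction m arbitrary: f rule: induct_nat_012)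
  case 1
  show ?case
    unfolding AC_class_1 locally_AC_on_def
  proof (intro allI impI)
    fix c d assume "{c..d} \<subseteq> J"
    then show "AC_on_interval c d f"
      using AC_class_has_derivative[OF 1(2)] continuous_on_subset[OF AC_class_continuous[OF AC_class_nderiv_Suc[OF 1(2)] 1(1)]]
      by (intro C1_AC_on_interval[of c d f "nderiv (Suc 0) f"]) blast+
  qed
next
  case (ge2 m)
  then have "AC_class J (Suc m) (nderiv (Suc 0) f)"
    using ge2.IH(2)[OF ge2.prems(1) AC_class_nderiv_Suc[OF ge2.prems(2)]] by blast
  then show ?case using AC_class_differentiable[OF ge2.prems(2)] unfolding AC_class_Suc_Suc by blast
qed simp

lemma AC_class_le: "open J \<Longrightarrow> AC_class J k f \<Longrightarrow> m \<le> k \<Longrightarrow> AC_class J m f"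
  by (induction k) (auto simp: le_Suc_eq dest: AC_class_Suc_imp)

lemma AC_class_subset: "AC_class J m f \<Longrightarrow> K \<subseteq> J \<Longrightarrow> AC_class K m f"
  by (auto simp: AC_class_def AC_nderiv_on_def locally_AC_on_def)

lemma AC_class_const: "AC_class J m (\<lambda>x. c)"
proof -
  have "AC_on_interval a b (\<lambda>x. k)" for a b k
    unfolding AC_on_interval_def by (auto intro: exI[of _ 1])
  then show ?thesis by (auto simp: AC_class_def AC_nderiv_on_def nderiv_const locally_AC_on_def)
qed

lemma nderiv_1_add:
  assumes "(f has_vector_derivative nderiv (Suc 0) f x) (at x)" "(g has_vector_derivative nderiv (Suc 0) g x) (at x)"
  shows "((\<lambda>x. f x + g x) has_vector_derivative nderiv (Suc 0) f x + nderiv (Suc 0) g x) (at x)"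
    "nderiv (Suc 0) (\<lambda>x. f x + g x) x = nderiv (Suc 0) f x + nderiv (Suc 0) g x"
  using has_vector_derivative_add[OF assms] vector_derivative_at by (auto simp: nderiv_1)

lemma nderiv_1_mult:
  assumes "(f has_vector_derivative nderiv (Suc 0) f x) (at x)" "(g has_vector_derivative nderiv (Suc 0) g x) (at x)"
  shows "((\<lambda>x. f x * g x) has_vector_derivative nderiv (Suc 0) f x * g x + f x * nderiv (Suc 0) g x) (at x)"
    "nderiv (Suc 0) (\<lambda>x. f x * g x) x = nderiv (Suc 0) f x * g x + f x * nderiv (Suc 0) g x"
  using has_vector_derivative_mult[OF assms] vector_derivative_at by (auto simp: nderiv_1 add.commute)

lemma AC_class_add:
  assumes J: "open J"
  shows "AC_class J m f \<Longrightarrow> AC_class J m g \<Longrightarrow> AC_class J m (\<lambda>x. f x + g x)"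
proof (induction m arbitrary: f g rule: induct_nat_012)
  case 1
  then show ?case by (auto simp: AC_class_1 locally_AC_on_def intro: AC_on_interval_add)
next
  case (ge2 m)
  note d = ge2.prems[THEN AC_class_has_derivative]
  have "AC_class J (Suc m) (\<lambda>x. nderiv (Suc 0) f x + nderiv (Suc 0) g x)"
    by (rule ge2.IH(2)[OF ge2.prems[THEN AC_class_nderiv_Suc]])
  then have "AC_class J (Suc m) (nderiv (Suc 0) (\<lambda>x. f x + g x))"
    by (rule AC_class_cong[OF J, rotated]) (use nderiv_1_add(2) d in auto)
  moreover have "\<forall>x\<in>J. (\<lambda>x. f x + g x) differentiable (at x)"
    using nderiv_1_add(1)[OF d] by (blast intro: differentiableI_vector)
  ultimately show ?case unfolding AC_class_Suc_Suc by (intro conjI)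
qed (rule AC_class_0)

lemma AC_class_mult:
  assumes J: "open J"
  shows "AC_class J m f \<Longrightarrow> AC_class J m g \<Longrightarrow> AC_class J m (\<lambda>x. f x * g x)"
proof (induction m arbitrary: f g rule: induct_nat_012)
  case 1
  then show ?case by (auto simp: AC_class_1 locally_AC_on_def intro: AC_on_interval_mult)
next
  case (ge2 m)
  note d = ge2.prems[THEN AC_class_has_derivative]
  have "AC_class J (Suc m) f" "AC_class J (Suc m) g" using ge2.prems[THEN AC_class_Suc_imp[OF J]] by auto
  then have "AC_class J (Suc m) (\<lambda>x. nderiv (Suc 0) f x * g x + f x * nderiv (Suc 0) g x)"
    by (intro AC_class_add[OF J] ge2.IH(2) ge2.prems[THEN AC_class_nderiv_Suc]) assumption+
  then have "AC_class J (Suc m) (nderiv (Suc 0) (\<lambda>x. f x * g x))"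
    by (rule AC_class_cong[OF J, rotated]) (use nderiv_1_mult(2) d in auto)
  moreover have "\<forall>x\<in>J. (\<lambda>x. f x * g x) differentiable (at x)"
    using nderiv_1_mult(1)[OF d] by (blast intro: differentiableI_vector)
  ultimately show ?case unfolding AC_class_Suc_Suc by (intro conjI)
qed (rule AC_class_0)

lemma AC_class_sum:
  assumes "open J" "\<And>i. i \<in> S \<Longrightarrow> AC_class J m (f i)"
  shows "AC_class J m (\<lambda>x. \<Sum>i\<in>S. f i x)"
  using assms(2) by (induction S rule: infinite_finite_induct) (auto intro: AC_class_add[OF assms(1)] AC_class_const)

lemma nderiv_add_AE:
  assumes J: "open J"
  shows "AC_class J m f \<Longrightarrow> AC_class J m g \<Longrightarrow>
    AE x in lebesgue. x \<in> J \<longrightarrow> nderiv m (\<lambda>x. f x + g x) x = nderiv m f x + nderiv m g x"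
proof (induction m arbitrary: f g rule: induct_nat_012)
  case 1
  note d = 1[THEN AC_class_has_derivative_AE[OF J]]
  from d show ?case by eventually_elim (auto intro: nderiv_1_add(2))
next
  case (ge2 m)
  note d = ge2.prems[THEN AC_class_has_derivative]
  have "nderiv (Suc (Suc m)) (\<lambda>x. f x + g x) x = nderiv (Suc m) (\<lambda>x. nderiv (Suc 0) f x + nderiv (Suc 0) g x) x"
    if "x \<in> J" for x
    unfolding nderiv_Suc_shift[of "Suc m"]
    by (rule nderiv_cong[OF J _ that]) (use nderiv_1_add(2) d in auto)
  moreover have "AE x in lebesgue. x \<in> J \<longrightarrow> nderiv (Suc m) (\<lambda>x. nderiv (Suc 0) f x + nderiv (Suc 0) g x) x =
     nderiv (Suc (Suc m)) f x + nderiv (Suc (Suc m)) g x"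
    unfolding nderiv_Suc_shift[of "Suc m"] by (rule ge2.IH(2)[OF ge2.prems[THEN AC_class_nderiv_Suc]])
  ultimately show ?case by simp
qed simp

lemma nderiv_sum_AE:
  assumes J: "open J" and W: "\<And>i. i \<in> S \<Longrightarrow> AC_class J m (f i)"
  shows "AE x in lebesgue. x \<in> J \<longrightarrow> nderiv m (\<lambda>x. \<Sum>i\<in>S. f i x) x = (\<Sum>i\<in>S. nderiv m (f i) x)"
  using W
proof (induction S rule: infinite_finite_induct)
  case (insert i S)
  have "AE x in lebesgue. x \<in> J \<longrightarrow> nderiv m (\<lambda>x. f i x + (\<Sum>i\<in>S. f i x)) x = nderiv m (f i) x + nderiv m (\<lambda>x. \<Sum>i\<in>S. f i x) x"
    using insert by (intro nderiv_add_AE[OF J] AC_class_sum[OF J]) auto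
  moreover have "AE x in lebesgue. x \<in> J \<longrightarrow> nderiv m (\<lambda>x. \<Sum>i\<in>S. f i x) x = (\<Sum>i\<in>S. nderiv m (f i) x)"
    using insert by auto
  ultimately show ?case by eventually_elim (use insert in auto)
qed (auto simp: nderiv_const)

text \<open>Leibniz's rule in telescoped form. At the top order \<open>m\<close> it holds only almost everywhere.\<close>

lemma nderiv_mult_AE:
  assumes J: "open J"
  shows "AC_class J m z \<Longrightarrow> AC_class J m w \<Longrightarrow>
    AE x in lebesgue. x \<in> J \<longrightarrow> nderiv m (\<lambda>x. z x * w x) x =
      z x * nderiv m w x + (\<Sum>l<m. nderiv (m - 1 - l) (\<lambda>x. nderiv (Suc 0) z x * nderiv l w x) x)"
proof (induction m arbitrary: z w rule: induct_nat_012)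
  case 1
  note d = 1[THEN AC_class_has_derivative_AE[OF J]]
  from d show ?case
  proof eventually_elim
    case (elim x)
    then show ?case by (auto simp: nderiv_1_mult(2))
  qed
next
  case (ge2 m)
  note d = ge2.prems[THEN AC_class_has_derivative]
  let ?z = "nderiv (Suc 0) z" and ?w = "nderiv (Suc 0) w"
  have W: "AC_class J (Suc m) ?z" "AC_class J (Suc m) ?w" "AC_class J (Suc m) z" "AC_class J (Suc m) w"
    using ge2.prems[THEN AC_class_nderiv_Suc] ge2.prems[THEN AC_class_Suc_imp[OF J]] by auto
  have 1: "nderiv (Suc (Suc m)) (\<lambda>x. z x * w x) x = nderiv (Suc m) (\<lambda>x. ?z x * w x + z x * ?w x) x"
    if "x \<in> J" for x
    unfolding nderiv_Suc_shift[of "Suc m"]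
    by (rule nderiv_cong[OF J _ that]) (use nderiv_1_mult(2) d in auto)
  have 2: "AE x in lebesgue. x \<in> J \<longrightarrow> nderiv (Suc m) (\<lambda>x. ?z x * w x + z x * ?w x) x =
      nderiv (Suc m) (\<lambda>x. ?z x * w x) x + nderiv (Suc m) (\<lambda>x. z x * ?w x) x"
    using W by (intro nderiv_add_AE[OF J] AC_class_mult[OF J])
  have 3: "AE x in lebesgue. x \<in> J \<longrightarrow> nderiv (Suc m) (\<lambda>x. z x * ?w x) x =
      z x * nderiv (Suc m) ?w x + (\<Sum>l<Suc m. nderiv (Suc m - 1 - l) (\<lambda>x. ?z x * nderiv l ?w x) x)"
    using W by (intro ge2.IH(2))
  from 2 3 show ?case
  proof eventually_elim
    case (elim x)
    have shift: "nderiv l ?w = nderiv (Suc l) w" for l by (simp add: nderiv_nderiv)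
    have sum: "(\<Sum>l<Suc (Suc m). nderiv (Suc (Suc m) - 1 - l) (\<lambda>x. ?z x * nderiv l w x) x) =
        nderiv (Suc m) (\<lambda>x. ?z x * w x) x + (\<Sum>l<Suc m. nderiv (Suc m - 1 - l) (\<lambda>x. ?z x * nderiv l ?w x) x)"
      unfolding sum.lessThan_Suc_shift[of _ "Suc m"] shift
      by (simp only: One_nat_def diff_Suc_Suc diff_zero nderiv_0)
    show ?case
    proof
      assume x: "x \<in> J"
      show "nderiv (Suc (Suc m)) (\<lambda>x. z x * w x) x = z x * nderiv (Suc (Suc m)) w x +
        (\<Sum>l<Suc (Suc m). nderiv (Suc (Suc m) - 1 - l) (\<lambda>x. ?z x * nderiv l w x) x)"
        unfolding sum 1[OF x] elim(1)[rule_format, OF x] elim(2)[rule_format, OF x] shift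
        by (rule add.left_commute)
    qed
  qed
qed simp

lemma nderiv_add:
  assumes J: "open J" and x: "x \<in> J"
  shows "AC_class J (Suc m) f \<Longrightarrow> AC_class J (Suc m) g \<Longrightarrow> nderiv m (\<lambda>x. f x + g x) x = nderiv m f x + nderiv m g x"
proof (induction m arbitrary: f g)
  case (Suc m)
  note d = Suc.prems[THEN AC_class_has_derivative]
  have "nderiv (Suc m) (\<lambda>x. f x + g x) x = nderiv m (\<lambda>x. nderiv (Suc 0) f x + nderiv (Suc 0) g x) x"
    unfolding nderiv_Suc_shift[of m]
    by (rule nderiv_cong[OF J _ x]) (use nderiv_1_add(2) d in auto)
  also have "\<dots> = nderiv m (nderiv (Suc 0) f) x + nderiv m (nderiv (Suc 0) g) x"
    by (rule Suc.IH[OF AC_class_nderiv_Suc[OF Suc.prems(1)] AC_class_nderiv_Suc[OF Suc.prems(2)]])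
  finally show ?case unfolding nderiv_Suc_shift[of m] .
qed simp

text \<open>A factor that agrees at \<open>x\<close> with a constant up to order \<open>m\<close> can be pulled out of the \<open>m\<close>-th derivative
at \<open>x\<close>.\<close>

lemma nderiv_mult_flat:
  assumes J: "open J" and x: "x \<in> J"
  shows "AC_class J (Suc m) f \<Longrightarrow> AC_class J (Suc m) g \<Longrightarrow>
    (\<And>i. i \<le> m \<Longrightarrow> nderiv i f x = (if i = 0 then c else 0)) \<Longrightarrow>
    nderiv m (\<lambda>x. f x * g x) x = c * nderiv m g x"
proof (induction m arbitrary: f g c)
  case 0
  then show ?case by simp
next
  case (Suc m)
  note d = Suc.prems(1,2)[THEN AC_class_has_derivative]
  let ?f = "nderiv (Suc 0) f" and ?g = "nderiv (Suc 0) g"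
  have W: "AC_class J (Suc m) ?f" "AC_class J (Suc m) ?g" "AC_class J (Suc m) f" "AC_class J (Suc m) g"
    using Suc.prems(1,2)[THEN AC_class_nderiv_Suc] Suc.prems(1,2)[THEN AC_class_Suc_imp[OF J]] by auto
  have 1: "nderiv (Suc m) (\<lambda>x. f x * g x) x = nderiv m (\<lambda>x. ?f x * g x + f x * ?g x) x"
    unfolding nderiv_Suc_shift[of m "\<lambda>x. f x * g x"]
    by (rule nderiv_cong[OF J _ x]) (use nderiv_1_mult(2) d in auto)
  have 2: "nderiv m (\<lambda>x. ?f x * g x + f x * ?g x) x = nderiv m (\<lambda>x. ?f x * g x) x + nderiv m (\<lambda>x. f x * ?g x) x"
    using W by (intro nderiv_add[OF J x] AC_class_mult[OF J])
  have 3: "nderiv m (\<lambda>x. ?f x * g x) x = 0 * nderiv m g x"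
  proof (rule Suc.IH[OF W(1,4)])
    fix i assume "i \<le> m"
    then show "nderiv i ?f x = (if i = 0 then 0 else 0)"
      using Suc.prems(3)[of "Suc i"] unfolding nderiv_Suc_shift[of i f] by simp
  qed
  have 4: "nderiv m (\<lambda>x. f x * ?g x) x = c * nderiv m ?g x"
    by (rule Suc.IH[OF W(3,2)]) (rule Suc.prems(3), simp)
  show ?case unfolding 1 2 3 4 nderiv_Suc_shift[of m g] by simp
qed

section \<open>Iterated integrals over simplices\<close>

lemma sigma_finite_lebesgue: "sigma_finite_measure (lebesgue :: real measure)"
proof
  let ?A = "range (\<lambda>n::nat. {- real n..real n})"
  have "x \<in> \<Union>?A" for x
  proof -
    obtain n :: nat where "\<bar>x\<bar> \<le> real n" using real_arch_simple by blast
    then have "x \<in> {- real n..real n}" by (simp add: abs_le_iff)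
    then show ?thesis by blast
  qed
  then have "\<Union>?A = space lebesgue" by auto
  moreover have "\<forall>a\<in>?A. emeasure lebesgue a \<noteq> \<infinity>" by auto
  moreover have "?A \<subseteq> sets lebesgue" by auto
  ultimately show "\<exists>A. countable A \<and> A \<subseteq> sets (lebesgue::real measure) \<and> \<Union>A = space lebesgue \<and> (\<forall>a\<in>A. emeasure lebesgue a \<noteq> \<infinity>)"
    by (intro exI[of _ ?A] conjI) auto
qed

interpretation lebesgue_product: product_sigma_finite "\<lambda>_::nat. lebesgue :: real measure"
  by (rule product_sigma_finite.intro) (rule sigma_finite_lebesgue)

abbreviation lebesgue_pow :: "nat \<Rightarrow> (nat \<Rightarrow> real) measure" where
  "lebesgue_pow j \<equiv> Pi\<^sub>M {1..j} (\<lambda>_. lebesgue :: real measure)"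

text \<open>The condition \<open>0 < s\<^sub>1 < \<dots> < s\<^sub>j < x\<close> for \<open>\<sigma> = 1\<close>, and \<open>x < s\<^sub>j < \<dots> < s\<^sub>1 < 0\<close> for \<open>\<sigma> = -1\<close>, so that both
signs of \<open>x\<close> are treated at once. For \<open>j = 0\<close> it says that \<open>x\<close> lies strictly on the side of \<open>\<sigma>\<close>.\<close>

definition simplex_chain :: "real \<Rightarrow> nat \<Rightarrow> real \<Rightarrow> (nat \<Rightarrow> real) \<Rightarrow> bool" where
  "simplex_chain \<sigma> j x s \<longleftrightarrow> (\<forall>i<j. \<sigma> * (if i = 0 then 0 else s i) < \<sigma> * s (Suc i)) \<and>
     \<sigma> * (if j = 0 then 0 else s j) < \<sigma> * x"

text \<open>The iterated integral of \<open>g\<^sub>1(s\<^sub>1) \<cdots> g\<^sub>j(s\<^sub>j)\<close> over the simplex, without the sign \<open>(-1)\<^sup>j\<close> that the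
definition of \<open>trig_S\<close> carries for negative \<open>x\<close>.\<close>

definition simplex_integral :: "real \<Rightarrow> (nat \<Rightarrow> real \<Rightarrow> complex) \<Rightarrow> nat \<Rightarrow> real \<Rightarrow> complex" where
  "simplex_integral \<sigma> g j x =
     (\<integral>s. indicator {s. simplex_chain \<sigma> j x s} s *\<^sub>R (\<Prod>i=1..j. g i (s i)) \<partial>lebesgue_pow j)"

lemma simplex_chain_0: "simplex_chain \<sigma> 0 x s \<longleftrightarrow> 0 < \<sigma> * x"
  by (simp add: simplex_chain_def)

lemma simplex_chain_Suc: "simplex_chain \<sigma> (Suc j) x s \<longleftrightarrow> simplex_chain \<sigma> j (s (Suc j)) s \<and> \<sigma> * s (Suc j) < \<sigma> * x"
  by (auto simp: simplex_chain_def All_less_Suc)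

lemma simplex_chain_cong: "(\<And>i. i \<in> {1..j} \<Longrightarrow> s i = s' i) \<Longrightarrow> simplex_chain \<sigma> j x s \<longleftrightarrow> simplex_chain \<sigma> j x s'"
proof (induction j arbitrary: x)
  case 0
  then show ?case by (simp add: simplex_chain_0)
next
  case (Suc j)
  have "s (Suc j) = s' (Suc j)" using Suc.prems[of "Suc j"] by simp
  moreover have "simplex_chain \<sigma> j y s \<longleftrightarrow> simplex_chain \<sigma> j y s'" for y
    using Suc.prems by (intro Suc.IH) auto
  ultimately show ?case by (simp add: simplex_chain_Suc)
qed

lemma simplex_chain_bounds:
  "simplex_chain \<sigma> j x s \<Longrightarrow> 0 < \<sigma> * x \<and> (\<forall>i\<in>{1..j}. 0 < \<sigma> * s i \<and> \<sigma> * s i < \<sigma> * x)"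
proof (induction j arbitrary: x)
  case (Suc j)
  then have 1: "simplex_chain \<sigma> j (s (Suc j)) s" and 2: "\<sigma> * s (Suc j) < \<sigma> * x" by (auto simp: simplex_chain_Suc)
  note IH = Suc.IH[OF 1]
  show ?case
  proof (intro conjI ballI)
    show "0 < \<sigma> * x" using IH 2 by linarith
    fix i assume "i \<in> {1..Suc j}"
    then consider "i \<in> {1..j}" | "i = Suc j" by (auto simp: le_Suc_eq)
    then show "0 < \<sigma> * s i" "\<sigma> * s i < \<sigma> * x" using IH 2 by (cases; fastforce)+
  qed
qed (simp add: simplex_chain_0)

lemma component_measurable:
  assumes "i \<in> {1..j}"
  shows "(\<lambda>p. snd p i) \<in> borel_measurable ((lebesgue :: real measure) \<Otimes>\<^sub>M lebesgue_pow j)"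
proof -
  have "(\<lambda>p. snd p i) \<in> (lebesgue :: real measure) \<Otimes>\<^sub>M lebesgue_pow j \<rightarrow>\<^sub>M lebesgue"
    using measurable_compose[OF measurable_snd measurable_component_singleton[OF assms, of "\<lambda>_. lebesgue"]] .
  moreover have "(\<lambda>x. x) \<in> (lebesgue :: real measure) \<rightarrow>\<^sub>M borel"
    by (rule measurable_completion) simp
  ultimately show ?thesis using measurable_compose by blast
qed

lemma simplex_chain_measurable:
  "Measurable.pred ((lebesgue :: real measure) \<Otimes>\<^sub>M lebesgue_pow j) (\<lambda>p. simplex_chain \<sigma> j (fst p) (snd p))"
proof -
  have [measurable]: "fst \<in> borel_measurable ((lebesgue :: real measure) \<Otimes>\<^sub>M lebesgue_pow j)"
    using measurable_compose[OF measurable_fst measurable_completion[of "\<lambda>x. x" lborel borel]] by simp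
  have c: "(\<lambda>p. if i = 0 then 0 else snd p i) \<in> borel_measurable ((lebesgue :: real measure) \<Otimes>\<^sub>M lebesgue_pow j)"
    if "i \<le> j" for i
    using component_measurable[of i j] that by (cases "i = 0") auto
  have c': "(\<lambda>p. snd p (Suc i)) \<in> borel_measurable ((lebesgue :: real measure) \<Otimes>\<^sub>M lebesgue_pow j)"
    if "i < j" for i
    using component_measurable[of "Suc i" j] that by simp
  have 1: "Measurable.pred ((lebesgue :: real measure) \<Otimes>\<^sub>M lebesgue_pow j)
      (\<lambda>p. \<forall>i\<in>{..<j}. \<sigma> * (if i = 0 then 0 else snd p i) < \<sigma> * snd p (Suc i))"
  proof (rule pred_intros_finite(3))
    fix i assume "i \<in> {..<j}"
    then have [measurable]: "(\<lambda>p. if i = 0 then 0 else snd p i) \<in> borel_measurable ((lebesgue :: real measure) \<Otimes>\<^sub>M lebesgue_pow j)"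
      "(\<lambda>p. snd p (Suc i)) \<in> borel_measurable ((lebesgue :: real measure) \<Otimes>\<^sub>M lebesgue_pow j)"
      using c[of i] c'[of i] by auto
    show "Measurable.pred ((lebesgue :: real measure) \<Otimes>\<^sub>M lebesgue_pow j)
      (\<lambda>p. \<sigma> * (if i = 0 then 0 else snd p i) < \<sigma> * snd p (Suc i))"
      by measurable
  qed simp
  have [measurable]: "(\<lambda>p. if j = 0 then 0 else snd p j) \<in> borel_measurable ((lebesgue :: real measure) \<Otimes>\<^sub>M lebesgue_pow j)"
    by (rule c) simp
  have 2: "Measurable.pred ((lebesgue :: real measure) \<Otimes>\<^sub>M lebesgue_pow j)
     (\<lambda>p. \<sigma> * (if j = 0 then 0 else snd p j) < \<sigma> * fst p)"
    by measurable
  show ?thesis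
    using pred_intros_logic(3)[OF 1 2] unfolding simplex_chain_def Ball_def lessThan_iff .
qed

lemma simplex_chain_set_measurable: "{s \<in> space (lebesgue_pow j). simplex_chain \<sigma> j x s} \<in> sets (lebesgue_pow j)"
proof -
  have "(\<lambda>s. (x, s)) \<in> lebesgue_pow j \<rightarrow>\<^sub>M (lebesgue :: real measure) \<Otimes>\<^sub>M lebesgue_pow j" by simp
  from measurable_compose[OF this simplex_chain_measurable[where j=j and \<sigma>=\<sigma>]]
  show ?thesis by (simp add: pred_def)
qed

lemma product_integrand_integrable:
  assumes "\<And>i. i \<in> {1..j} \<Longrightarrow> integrable lebesgue (g i :: real \<Rightarrow> complex)"
  shows "integrable (lebesgue_pow j) (\<lambda>s. \<Prod>i=1..j. g i (s i))"
  using lebesgue_product.product_integrable_prod[of "{1..j}" g] assms by simp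

lemma simplex_integrand_integrable:
  assumes "\<And>i. i \<in> {1..j} \<Longrightarrow> integrable lebesgue (g i :: real \<Rightarrow> complex)"
  shows "integrable (lebesgue_pow j) (\<lambda>s. indicator {s. simplex_chain \<sigma> j x s} s *\<^sub>R (\<Prod>i=1..j. g i (s i)))"
proof -
  have "integrable (lebesgue_pow j)
     (\<lambda>s. indicator {s \<in> space (lebesgue_pow j). simplex_chain \<sigma> j x s} s *\<^sub>R (\<Prod>i=1..j. g i (s i)))"
    by (rule integrable_mult_indicator[OF simplex_chain_set_measurable product_integrand_integrable[OF assms]])
  then show ?thesis
    by (rule Bochner_Integration.integrable_cong[THEN iffD1, rotated 2]) (auto simp: indicator_def)
qed

lemma norm_simplex_integral_le:
  assumes "\<And>i. i \<in> {1..j} \<Longrightarrow> integrable lebesgue (g i)"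
    and "\<And>i. i \<in> {1..j} \<Longrightarrow> (\<integral>t. norm (g i t) \<partial>lebesgue) \<le> q"
  shows "norm (simplex_integral \<sigma> g j x) \<le> q ^ j"
proof -
  have "norm (simplex_integral \<sigma> g j x) \<le> (\<integral>s. norm (indicator {s. simplex_chain \<sigma> j x s} s *\<^sub>R (\<Prod>i=1..j. g i (s i))) \<partial>lebesgue_pow j)"
    unfolding simplex_integral_def by (rule integral_norm_bound)
  also have "\<dots> \<le> (\<integral>s. (\<Prod>i=1..j. norm (g i (s i))) \<partial>lebesgue_pow j)"
  proof (rule integral_mono)
    show "integrable (lebesgue_pow j) (\<lambda>s. norm (indicator {s. simplex_chain \<sigma> j x s} s *\<^sub>R (\<Prod>i=1..j. g i (s i))))"
      by (intro integrable_norm simplex_integrand_integrable assms)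
    show "integrable (lebesgue_pow j) (\<lambda>s. \<Prod>i=1..j. norm (g i (s i)))"
      using integrable_norm[OF product_integrand_integrable[of j g, OF assms(1)]] by (simp add: prod_norm)
    show "norm (indicator {s. simplex_chain \<sigma> j x s} s *\<^sub>R (\<Prod>i=1..j. g i (s i))) \<le> (\<Prod>i=1..j. norm (g i (s i)))" for s
      by (auto simp: indicator_def prod_norm intro: prod_nonneg)
  qed
  also have "\<dots> = (\<Prod>i=1..j. \<integral>t. norm (g i t) \<partial>lebesgue)"
    by (rule lebesgue_product.product_integral_prod) (auto intro!: assms integrable_norm)
  also have "\<dots> \<le> (\<Prod>i=1..j. q)"
    by (intro prod_mono) (auto intro: assms)
  finally show ?thesis by simp
qed

lemma simplex_integral_measurable:
  assumes g: "\<And>i. i \<in> {1..j} \<Longrightarrow> integrable lebesgue (g i)"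
  shows "simplex_integral \<sigma> g j \<in> borel_measurable lebesgue"
proof -
  interpret P: sigma_finite_measure "lebesgue_pow j"
    by (rule lebesgue_product.sigma_finite) simp
  have 1: "(\<lambda>p. \<Prod>i=1..j. g i (snd p i)) \<in> borel_measurable ((lebesgue :: real measure) \<Otimes>\<^sub>M lebesgue_pow j)"
    using measurable_compose[OF measurable_snd borel_measurable_integrable[OF product_integrand_integrable[of j g, OF g]]] .
  have 2: "(\<lambda>p. indicator {p. simplex_chain \<sigma> j (fst p) (snd p)} p :: real) \<in> borel_measurable ((lebesgue :: real measure) \<Otimes>\<^sub>M lebesgue_pow j)"
    by (rule borel_measurable_indicator') (use simplex_chain_measurable[where j=j and \<sigma>=\<sigma>] in simp)
  have "(\<lambda>p. indicator {p. simplex_chain \<sigma> j (fst p) (snd p)} p *\<^sub>R (\<Prod>i=1..j. g i (snd p i)))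
      \<in> borel_measurable ((lebesgue :: real measure) \<Otimes>\<^sub>M lebesgue_pow j)"
    by (rule borel_measurable_scaleR[OF 2 1])
  then have "(\<lambda>(x, s). indicator {s. simplex_chain \<sigma> j x s} s *\<^sub>R (\<Prod>i=1..j. g i (s i)))
      \<in> borel_measurable ((lebesgue :: real measure) \<Otimes>\<^sub>M lebesgue_pow j)"
    by (simp add: case_prod_unfold indicator_def)
  then show ?thesis
    unfolding simplex_integral_def[abs_def] by (rule P.borel_measurable_lebesgue_integral)
qed

lemma simplex_integral_0: "simplex_integral \<sigma> g 0 x = (if 0 < \<sigma> * x then 1 else 0)"
  by (simp add: simplex_integral_def simplex_chain_0 PiM_empty lebesgue_integral_count_space_finite)

lemma simplex_integral_eq_0: "\<not> 0 < \<sigma> * x \<Longrightarrow> simplex_integral \<sigma> g j x = 0"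
proof -
  assume "\<not> 0 < \<sigma> * x"
  then have "\<not> simplex_chain \<sigma> j x s" for s using simplex_chain_bounds[of \<sigma> j x s] by blast
  then show ?thesis by (simp add: simplex_integral_def)
qed

text \<open>Fubini's theorem, with the last variable integrated last: its fibres are the simplices of one dimension less.\<close>

lemma simplex_integral_Suc:
  assumes g: "\<And>i. i \<in> {1..Suc j} \<Longrightarrow> integrable lebesgue (g i)"
  shows "simplex_integral \<sigma> g (Suc j) x =
    (\<integral>t. indicator {t. \<sigma> * t < \<sigma> * x} t *\<^sub>R (g (Suc j) t * simplex_integral \<sigma> g j t) \<partial>lebesgue)"
proof -
  let ?F = "\<lambda>s. indicator {s. simplex_chain \<sigma> (Suc j) x s} s *\<^sub>R (\<Prod>i=1..Suc j. g i (s i))"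
  let ?G = "\<lambda>t. indicator {t. \<sigma> * t < \<sigma> * x} t *\<^sub>R (g (Suc j) t * simplex_integral \<sigma> g j t)"
  have I: "{Suc j} \<union> {1..j} = {1..Suc j}" by auto
  have fold: "integral\<^sup>L (Pi\<^sub>M ({Suc j} \<union> {1..j}) (\<lambda>_. lebesgue)) ?F =
     (\<integral>u. (\<integral>y. ?F (merge {Suc j} {1..j} (u, y)) \<partial>lebesgue_pow j) \<partial>Pi\<^sub>M {Suc j} (\<lambda>_. lebesgue))"
  proof (rule lebesgue_product.product_integral_fold)
    show "integrable (Pi\<^sub>M ({Suc j} \<union> {1..j}) (\<lambda>_. lebesgue)) ?F"
      unfolding I by (rule simplex_integrand_integrable[OF g])
  qed auto
  have inner: "(\<integral>y. ?F (merge {Suc j} {1..j} (u, y)) \<partial>lebesgue_pow j) = ?G (u (Suc j))" for u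
  proof -
    let ?t = "u (Suc j)"
    have eq: "?F (merge {Suc j} {1..j} (u, y)) =
       (indicator {t. \<sigma> * t < \<sigma> * x} ?t *\<^sub>R g (Suc j) ?t) * (indicator {s. simplex_chain \<sigma> j ?t s} y *\<^sub>R (\<Prod>i=1..j. g i (y i)))" for y
    proof -
      let ?m = "merge {Suc j} {1..j} (u, y)"
      have m: "?m (Suc j) = ?t" "\<And>i. i \<in> {1..j} \<Longrightarrow> ?m i = y i" by (auto simp: merge_def)
      have "simplex_chain \<sigma> (Suc j) x ?m \<longleftrightarrow> simplex_chain \<sigma> j ?t y \<and> \<sigma> * ?t < \<sigma> * x"
        unfolding simplex_chain_Suc m(1) using simplex_chain_cong[of j ?m y] m(2) by blast
      moreover have "(\<Prod>i=1..j. g i (?m i)) = (\<Prod>i=1..j. g i (y i))"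
        by (rule prod.cong) (simp_all add: m(2))
      then have "(\<Prod>i=1..Suc j. g i (?m i)) = (\<Prod>i=1..j. g i (y i)) * g (Suc j) ?t"
        by (simp add: m(1))
      ultimately show ?thesis by (simp add: indicator_def)
    qed
    show ?thesis
      unfolding eq simplex_integral_def Bochner_Integration.integral_mult_right_zero by simp
  qed
  have "g (Suc j) \<in> borel_measurable lebesgue" using g[of "Suc j"] by auto
  moreover have "simplex_integral \<sigma> g j \<in> borel_measurable lebesgue"
    using g by (intro simplex_integral_measurable) auto
  moreover have "{t. \<sigma> * t < \<sigma> * x} \<in> sets lebesgue"
  proof -
    have "open {t. \<sigma> * t < \<sigma> * x}" by (intro open_Collect_less continuous_intros)
    then show ?thesis by (simp add: borel_open)
  qed
  ultimately have G: "?G \<in> borel_measurable lebesgue"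
    by (intro borel_measurable_scaleR borel_measurable_indicator borel_measurable_times) auto
  show ?thesis
    using fold lebesgue_product.product_integral_singleton[OF G, of "Suc j"]
    unfolding inner I simplex_integral_def[of \<sigma> g "Suc j"] by simp
qed

lemma simplex_chain_alt:
  assumes "j > 0"
  shows "simplex_chain \<sigma> j x s \<longleftrightarrow> 0 < \<sigma> * s 1 \<and> (\<forall>i\<in>{1..<j}. \<sigma> * s i < \<sigma> * s (i + 1)) \<and> \<sigma> * s j < \<sigma> * x"
proof -
  obtain k where j: "j = Suc k" using assms gr0_conv_Suc by blast
  have eq: "{1..<Suc k} = Suc ` {..<k}"
    by (simp only: image_Suc_lessThan atLeastLessThanSuc_atLeastAtMost)
  have "(\<forall>i\<in>{1..<Suc k}. \<sigma> * s i < \<sigma> * s (i + 1)) \<longleftrightarrow> (\<forall>i<k. \<sigma> * s (Suc i) < \<sigma> * s (Suc (Suc i)))"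
    unfolding eq by simp (simp add: Ball_def)
  then show ?thesis unfolding j simplex_chain_def All_less_Suc2 by simp
qed

lemma trig_S_eq:
  "trig_S n f j x = (if x \<ge> 0 then simplex_integral 1 (\<lambda>i. f (residue_index n i)) j x
     else (-1) ^ j * simplex_integral (-1) (\<lambda>i. f (residue_index n i)) j x)" if "j > 0"
proof -
  have "{s \<in> space M. 0 < s 1 \<and> (\<forall>i\<in>{1..<j}. s i < s (i + 1)) \<and> s j < x} = {s \<in> space M. simplex_chain 1 j x s}" for M :: "(nat \<Rightarrow> real) measure"
    and x
  proof -
    have "0 < s 1 \<and> (\<forall>i\<in>{1..<j}. s i < s (i + 1)) \<and> s j < x \<longleftrightarrow> simplex_chain 1 j x s" for s :: "nat \<Rightarrow> real"
      unfolding simplex_chain_alt[OF that] by simp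
    then show ?thesis by (simp only:)
  qed
  moreover have "{s \<in> space M. x < s j \<and> (\<forall>i\<in>{1..<j}. s (i + 1) < s i) \<and> s 1 < 0} = {s \<in> space M. simplex_chain (-1) j x s}" for M :: "(nat \<Rightarrow> real) measure"
    and x
  proof -
    have "x < s j \<and> (\<forall>i\<in>{1..<j}. s (i + 1) < s i) \<and> s 1 < 0 \<longleftrightarrow> simplex_chain (-1) j x s" for s :: "nat \<Rightarrow> real"
      unfolding simplex_chain_alt[OF that] by (simp add: conj_ac)
    then show ?thesis by (simp only:)
  qed
  moreover have "set_lebesgue_integral M {s \<in> space M. P s} F = (\<integral>s. indicator {s. P s} s *\<^sub>R F s \<partial>M)"
    for M :: "(nat \<Rightarrow> real) measure" and P and F :: "_ \<Rightarrow> complex"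
    unfolding set_lebesgue_integral_def by (intro Bochner_Integration.integral_cong) (auto simp: indicator_def)
  ultimately show ?thesis
    using that by (simp add: trig_S_def Let_def simplex_integral_def)
qed

section \<open>The cyclic first-order system of the trigonometric functions\<close>

text \<open>The integral of \<open>h\<close> from \<open>0\<close> to \<open>x\<close>, with the usual sign for negative \<open>x\<close>.\<close>

definition signed_integral :: "(real \<Rightarrow> complex) \<Rightarrow> real \<Rightarrow> complex" where
  "signed_integral h x = (if 0 \<le> x then (\<integral>t. indicator {0<..<x} t *\<^sub>R h t \<partial>lebesgue)
     else - (\<integral>t. indicator {x<..<0} t *\<^sub>R h t \<partial>lebesgue))"

lemma signed_integral_has_integral:
  assumes h: "integrable lebesgue h" and "u \<le> v"
  shows "(h has_integral signed_integral h v - signed_integral h u) {u..v}"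
proof -
  have sh: "set_integrable lebesgue S h" if "S \<in> sets lebesgue" for S
    unfolding set_integrable_def by (rule integrable_mult_indicator[OF that h])
  have J: "(\<integral>t. indicator {a<..<b} t *\<^sub>R h t \<partial>lebesgue) = integral {a..b} h" for a b
    using set_lebesgue_integral_eq_integral(2)[OF sh[of "{a<..<b}"]] integral_open_interval_real[of a b h]
    by (simp add: set_lebesgue_integral_def)
  have hi: "h integrable_on {a..b}" for a b
    using set_lebesgue_integral_eq_integral(1)[OF sh[of "{a..b}"]] by simp
  have eq: "signed_integral h x = (if 0 \<le> x then integral {0..x} h else - integral {x..0} h)" for x
    unfolding signed_integral_def J ..
  consider "0 \<le> u" | "u < 0" "0 \<le> v" | "v < 0" by linarith
  then have "signed_integral h v - signed_integral h u = integral {u..v} h"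
  proof cases
    case 1
    then show ?thesis using \<open>u \<le> v\<close> Henstock_Kurzweil_Integration.integral_combine[of 0 u v h, OF 1 \<open>u \<le> v\<close> hi]
      by (simp add: eq algebra_simps)
  next
    case 2
    then show ?thesis using Henstock_Kurzweil_Integration.integral_combine[of u 0 v h, OF _ _ hi]
      by (simp add: eq algebra_simps)
  next
    case 3
    then show ?thesis using \<open>u \<le> v\<close> Henstock_Kurzweil_Integration.integral_combine[of u v 0 h, OF _ _ hi]
      by (simp add: eq algebra_simps)
  qed
  then show ?thesis using hi integrable_integral by metis
qed

lemma signed_integral_0 [simp]: "signed_integral h 0 = 0"
  by (simp add: signed_integral_def)

lemma residue_index_in: "n \<ge> 1 \<Longrightarrow> residue_index n k \<in> {1..n}"
  by (rule residue_index_cong(1))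

lemma residue_index_Suc_eq_iff:
  assumes "n \<ge> 1" "i \<in> {1..n}"
  shows "residue_index n (Suc k) = i \<longleftrightarrow> residue_index n k = shift_perm n i"
proof -
  have "k mod n \<noteq> n" using assms mod_less_divisor[of n k] by linarith
  then show ?thesis
    using assms by (cases "k mod n = 0") (auto simp: \<open>k mod n \<noteq> n\<close> residue_index_def shift_perm_def mod_Suc)
qed

lemma trig_S_0 [simp]: "trig_S n f 0 x = 1"
  by (simp add: trig_S_def Let_def)

text \<open>The bound \<open>1/2\<close> on the integrals of the \<open>F i\<close> makes the series for \<open>trig_T\<close> dominated by a geometric series.
This suffices since the functions are only studied near \<open>0\<close>.\<close>

context
  fixes n :: nat and F :: "nat \<Rightarrow> real \<Rightarrow> complex" and q :: real
  assumes n: "n \<ge> 1" and F: "\<And>i. i \<in> {1..n} \<Longrightarrow> integrable lebesgue (F i)"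
    and Fq: "\<And>i. i \<in> {1..n} \<Longrightarrow> (\<integral>t. norm (F i t) \<partial>lebesgue) \<le> q" and q: "0 \<le> q" "q \<le> 1/2"
begin

lemma residue_integrable: "integrable lebesgue (F (residue_index n i))"
  using F residue_index_in[OF n] by blast

lemma trig_S_simplex:
  "0 < x \<Longrightarrow> trig_S n F k x = simplex_integral 1 (\<lambda>i. F (residue_index n i)) k x"
  "x < 0 \<Longrightarrow> trig_S n F k x = (-1) ^ k * simplex_integral (-1) (\<lambda>i. F (residue_index n i)) k x"
  by (cases "k = 0"; simp add: trig_S_eq simplex_integral_0)+

lemma trig_S_measurable: "trig_S n F k \<in> borel_measurable lebesgue"
proof (cases "k = 0")
  case False
  let ?g = "\<lambda>i. F (residue_index n i)"
  have m: "simplex_integral \<sigma> ?g k \<in> borel_measurable lebesgue" for \<sigma>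
    by (rule simplex_integral_measurable) (rule residue_integrable)
  have "{x::real. 0 \<le> x} \<in> sets lebesgue"
    using borel_closed[OF closed_Collect_le[of "\<lambda>_. 0" "\<lambda>x. x::real"]] by simp
  then have p: "Measurable.pred lebesgue (\<lambda>x::real. 0 \<le> x)" by (simp add: pred_def)
  have "(\<lambda>x. if 0 \<le> x then simplex_integral 1 ?g k x else (-1) ^ k * simplex_integral (-1) ?g k x)
      \<in> borel_measurable lebesgue"
    by (rule measurable_If[OF m borel_measurable_times[OF borel_measurable_const m]]) (use p in \<open>simp add: pred_def\<close>)
  moreover have "trig_S n F k = (\<lambda>x. if 0 \<le> x then simplex_integral 1 ?g k x else (-1) ^ k * simplex_integral (-1) ?g k x)"
    using False by (intro ext trig_S_eq) simp
  ultimately show ?thesis by simp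
next
  case True
  then show ?thesis by (simp add: trig_S_def[abs_def] Let_def)
qed

lemma norm_trig_S_le: "norm (trig_S n F k x) \<le> q ^ k"
proof (cases "k = 0")
  case False
  have "norm (simplex_integral \<sigma> (\<lambda>i. F (residue_index n i)) k x) \<le> q ^ k" for \<sigma>
    by (rule norm_simplex_integral_le) (auto intro: residue_integrable Fq residue_index_in[OF n])
  then show ?thesis using False by (simp add: trig_S_eq norm_mult norm_power)
qed simp

lemma trig_S_Suc:
  "trig_S n F (Suc k) x = signed_integral (\<lambda>t. F (residue_index n (Suc k)) t * trig_S n F k t) x"
proof (cases "0 \<le> x")
  case True
  let ?g = "\<lambda>i. F (residue_index n i)"
  have "trig_S n F (Suc k) x = simplex_integral 1 ?g (Suc k) x"
    using True by (simp add: trig_S_eq)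
  also have "\<dots> = (\<integral>t. indicator {t. 1 * t < 1 * x} t *\<^sub>R (?g (Suc k) t * simplex_integral 1 ?g k t) \<partial>lebesgue)"
    by (rule simplex_integral_Suc) (rule residue_integrable)
  also have "\<dots> = (\<integral>t. indicator {0<..<x} t *\<^sub>R (?g (Suc k) t * trig_S n F k t) \<partial>lebesgue)"
  proof (rule Bochner_Integration.integral_cong[OF refl])
    fix t
    show "indicator {t. 1 * t < 1 * x} t *\<^sub>R (?g (Suc k) t * simplex_integral 1 ?g k t) =
      indicator {0<..<x} t *\<^sub>R (?g (Suc k) t * trig_S n F k t)"
      using simplex_integral_eq_0[of 1 t ?g k] by (cases "0 < t") (auto simp: indicator_def trig_S_simplex)
  qed
  finally show ?thesis using True by (simp add: signed_integral_def)
next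
  case False
  let ?g = "\<lambda>i. F (residue_index n i)"
  have "trig_S n F (Suc k) x = (-1) ^ Suc k * simplex_integral (-1) ?g (Suc k) x"
    using False by (simp add: trig_S_eq)
  also have "simplex_integral (-1) ?g (Suc k) x =
      (\<integral>t. indicator {t. -1 * t < -1 * x} t *\<^sub>R (?g (Suc k) t * simplex_integral (-1) ?g k t) \<partial>lebesgue)"
    by (rule simplex_integral_Suc) (rule residue_integrable)
  also have "(-1) ^ Suc k * \<dots> = - (\<integral>t. (-1) ^ k * (indicator {t. -1 * t < -1 * x} t *\<^sub>R (?g (Suc k) t * simplex_integral (-1) ?g k t)) \<partial>lebesgue)"
    unfolding Bochner_Integration.integral_mult_right_zero power_Suc by simp
  also have "(\<integral>t. (-1) ^ k * (indicator {t. -1 * t < -1 * x} t *\<^sub>R (?g (Suc k) t * simplex_integral (-1) ?g k t)) \<partial>lebesgue) =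
     (\<integral>t. indicator {x<..<0} t *\<^sub>R (?g (Suc k) t * trig_S n F k t) \<partial>lebesgue)"
  proof (rule Bochner_Integration.integral_cong[OF refl])
    fix t
    show "(-1) ^ k * (indicator {t. -1 * t < -1 * x} t *\<^sub>R (?g (Suc k) t * simplex_integral (-1) ?g k t)) =
      indicator {x<..<0} t *\<^sub>R (?g (Suc k) t * trig_S n F k t)"
      using simplex_integral_eq_0[of "-1" t ?g k] by (cases "t < 0") (auto simp: indicator_def trig_S_simplex)
  qed
  finally show ?thesis using False by (simp add: signed_integral_def)
qed

text \<open>The series for \<open>trig_T n F i\<close> runs over the residue class of \<open>i\<close>; its \<open>k\<close>-th term is set to \<open>0\<close> for the other
\<open>k\<close>, which makes it an ordinary series.\<close>

definition trig_term :: "nat \<Rightarrow> nat \<Rightarrow> real \<Rightarrow> complex" where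
  "trig_term i k x = (if residue_index n k = i then trig_S n F k x else 0)"

lemma norm_trig_term_le: "norm (trig_term i k x) \<le> q ^ k"
  using norm_trig_S_le q by (simp add: trig_term_def)

lemma summable_trig_term: "summable (\<lambda>k. norm (trig_term i k x))"
  by (rule summable_comparison_test[OF _ summable_geometric[of q]]) (use q norm_trig_term_le in auto)

lemma trig_T_suminf: "trig_T n F i x = (\<Sum>k. trig_term i k x)"
proof -
  have "((\<lambda>k. trig_term i k x) has_sum (\<Sum>k. trig_term i k x)) UNIV"
    by (rule norm_summable_imp_has_sum[OF summable_trig_term summable_sums[OF summable_norm_cancel[OF summable_trig_term]]])
  then have "((\<lambda>k. trig_S n F k x) has_sum (\<Sum>k. trig_term i k x)) {k. residue_index n k = i}"
    by (rule has_sum_cong_neutral[THEN iffD1, rotated 3]) (auto simp: trig_term_def)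
  then show ?thesis unfolding trig_T_def by (rule infsumI)
qed

lemma trig_T_measurable: "trig_T n F i \<in> borel_measurable lebesgue"
proof -
  have "trig_term i k \<in> borel_measurable lebesgue" for k
    using trig_S_measurable[of k] by (cases "residue_index n k = i") (simp_all add: trig_term_def[abs_def])
  then have "(\<lambda>x. \<Sum>k. trig_term i k x) \<in> borel_measurable lebesgue"
    by (rule borel_measurable_suminf)
  then show ?thesis by (simp add: trig_T_suminf[abs_def])
qed

lemma norm_trig_T_le: "norm (trig_T n F i x) \<le> 2"
proof -
  have "norm (trig_T n F i x) \<le> (\<Sum>k. norm (trig_term i k x))"
    unfolding trig_T_suminf by (rule summable_norm[OF summable_trig_term])
  also have "\<dots> \<le> (\<Sum>k. q ^ k)"
    using q by (intro suminf_le norm_trig_term_le summable_trig_term summable_geometric) auto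
  also have "\<dots> = 1 / (1 - q)" using q by (intro suminf_geometric) auto
  also have "\<dots> \<le> 2" using q by (simp add: field_simps)
  finally show ?thesis .
qed

lemma trig_T_integrable:
  assumes "i \<in> {1..n}"
  shows "integrable lebesgue (\<lambda>t. F i t * trig_T n F j t)"
proof (rule Bochner_Integration.integrable_bound[where f="\<lambda>t. 2 * F i t"])
  show "integrable lebesgue (\<lambda>t. 2 * F i t)" using F[OF assms] by simp
  show "(\<lambda>t. F i t * trig_T n F j t) \<in> borel_measurable lebesgue"
    by (rule borel_measurable_times[OF borel_measurable_integrable[OF F[OF assms]] trig_T_measurable])
  show "AE t in lebesgue. norm (F i t * trig_T n F j t) \<le> norm (2 * F i t)"
  proof (rule AE_I2)
    fix t
    have "norm (F i t) * norm (trig_T n F j t) \<le> norm (F i t) * 2"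
      by (intro mult_left_mono norm_trig_T_le) simp
    then show "norm (F i t * trig_T n F j t) \<le> norm (2 * F i t)"
      by (simp add: norm_mult)
  qed
qed

lemma trig_T_eq:
  assumes i: "i \<in> {1..n}"
  shows "trig_T n F i x = (if i = n then 1 else 0) + signed_integral (\<lambda>t. F i t * trig_T n F (shift_perm n i) t) x"
proof -
  let ?j = "shift_perm n i"
  have zero: "signed_integral (\<lambda>t. 0) x = 0" by (simp add: signed_integral_def)
  have step: "trig_term i (Suc k) x = signed_integral (\<lambda>t. F i t * trig_term ?j k t) x" for k
    using residue_index_Suc_eq_iff[OF n i, of k] trig_S_Suc[of k x] zero
    by (auto simp: trig_term_def)
  have int: "integrable lebesgue (\<lambda>t. F i t * trig_term ?j k t)" for k
  proof (rule Bochner_Integration.integrable_bound[OF F[OF i]])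
    show "(\<lambda>t. F i t * trig_term ?j k t) \<in> borel_measurable lebesgue"
      using borel_measurable_times[OF borel_measurable_integrable[OF F[OF i]] trig_S_measurable[of k]]
      by (cases "residue_index n k = ?j") (simp_all add: trig_term_def)
    have "norm (trig_term ?j k t) \<le> 1" for t
      using norm_trig_term_le[of ?j k t] power_le_one[of q k] q by linarith
    then show "AE t in lebesgue. norm (F i t * trig_term ?j k t) \<le> norm (F i t)"
      by (intro AE_I2) (simp add: norm_mult mult_left_le)
  qed
  have sum: "(\<Sum>k. signed_integral (\<lambda>t. F i t * trig_term ?j k t) x) =
      signed_integral (\<lambda>t. F i t * trig_T n F ?j t) x"
  proof -
    have S: "(\<Sum>k. \<integral>t. indicator A t *\<^sub>R (F i t * trig_term ?j k t) \<partial>lebesgue) =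
        (\<integral>t. indicator A t *\<^sub>R (F i t * trig_T n F ?j t) \<partial>lebesgue)"
      "summable (\<lambda>k. \<integral>t. indicator A t *\<^sub>R (F i t * trig_term ?j k t) \<partial>lebesgue)"
      if A: "A \<in> sets lebesgue" for A
    proof -
      let ?h = "\<lambda>k t. indicator A t *\<^sub>R (F i t * trig_term ?j k t)"
      have hint: "integrable lebesgue (?h k)" for k
        by (rule integrable_mult_indicator[OF A int])
      have hsum: "summable (\<lambda>k. norm (?h k t))" for t
        using summable_mult[OF summable_trig_term[of ?j t], of "indicator A t * norm (F i t)"]
        by (simp add: norm_mult mult.assoc)
      have hle: "(\<integral>t. norm (?h k t) \<partial>lebesgue) \<le> q ^ k * q" for k
      proof -
        have "(\<integral>t. norm (?h k t) \<partial>lebesgue) \<le> (\<integral>t. q ^ k * norm (F i t) \<partial>lebesgue)"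
        proof (rule integral_mono)
          show "integrable lebesgue (\<lambda>t. norm (?h k t))" using hint by (rule integrable_norm)
          show "integrable lebesgue (\<lambda>t. q ^ k * norm (F i t))" using integrable_norm[OF F[OF i]] by simp
          have "norm (F i t) * norm (trig_term ?j k t) \<le> norm (F i t) * q ^ k" for t
            by (intro mult_left_mono norm_trig_term_le) simp
          then show "norm (?h k t) \<le> q ^ k * norm (F i t)" for t
            using q by (auto simp: norm_mult indicator_def mult.commute)
        qed
        also have "\<dots> = q ^ k * (\<integral>t. norm (F i t) \<partial>lebesgue)" by simp
        also have "\<dots> \<le> q ^ k * q" using Fq[OF i] q by (intro mult_left_mono) auto
        finally show ?thesis .
      qed
      have hs2: "summable (\<lambda>k. \<integral>t. norm (?h k t) \<partial>lebesgue)"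
      proof (rule summable_comparison_test)
        show "summable (\<lambda>k. q ^ k * q)" using q by (intro summable_mult2 summable_geometric) auto
        show "\<exists>N. \<forall>k\<ge>N. norm (\<integral>t. norm (?h k t) \<partial>lebesgue) \<le> q ^ k * q"
          using hle by (auto intro!: exI[of _ 0] simp: abs_of_nonneg)
      qed
      have hT: "(\<Sum>k. ?h k t) = indicator A t *\<^sub>R (F i t * trig_T n F ?j t)" for t
      proof -
        have s: "summable (\<lambda>k. trig_term ?j k t)" by (rule summable_norm_cancel[OF summable_trig_term])
        have "(\<Sum>k. F i t * trig_term ?j k t) = F i t * trig_T n F ?j t"
          unfolding trig_T_suminf by (rule suminf_mult[OF s])
        then show ?thesis using suminf_scaleR_right[OF summable_mult[OF s, of "F i t"], of "indicator A t"] by simp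
      qed
      show "(\<Sum>k. \<integral>t. ?h k t \<partial>lebesgue) = (\<integral>t. indicator A t *\<^sub>R (F i t * trig_T n F ?j t) \<partial>lebesgue)"
        using integral_suminf[OF hint _ hs2] hsum by (simp add: hT)
      show "summable (\<lambda>k. \<integral>t. ?h k t \<partial>lebesgue)"
        using summable_integral[OF hint _ hs2] hsum by simp
    qed
    show ?thesis
      unfolding signed_integral_def
      using S[of "{0<..<x}"] S[of "{x<..<0}"] by (simp add: suminf_minus)
  qed
  have "trig_T n F i x = trig_term i 0 x + (\<Sum>k. trig_term i (Suc k) x)"
    unfolding trig_T_suminf using suminf_split_head[OF summable_norm_cancel[OF summable_trig_term[of i x]]] by simp
  also have "trig_term i 0 x = (if i = n then 1 else 0)"
    using n by (auto simp: trig_term_def residue_index_def)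
  finally show ?thesis unfolding step sum .
qed

end

lemma simplex_integral_cong:
  assumes "\<And>i t. \<lbrakk>i \<in> {1..j}; 0 < \<sigma> * t; \<sigma> * t < \<sigma> * x\<rbrakk> \<Longrightarrow> g i t = h i t"
  shows "simplex_integral \<sigma> g j x = simplex_integral \<sigma> h j x"
  unfolding simplex_integral_def
proof (rule Bochner_Integration.integral_cong[OF refl])
  fix s
  show "indicator {s. simplex_chain \<sigma> j x s} s *\<^sub>R (\<Prod>i=1..j. g i (s i)) =
        indicator {s. simplex_chain \<sigma> j x s} s *\<^sub>R (\<Prod>i=1..j. h i (s i))"
  proof (cases "simplex_chain \<sigma> j x s")
    case True
    then have "(\<Prod>i=1..j. g i (s i)) = (\<Prod>i=1..j. h i (s i))"
      using simplex_chain_bounds[OF True] assms by (intro prod.cong) auto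
    then show ?thesis by simp
  qed simp
qed

theorem trig_T_cyclic_system:
  assumes n: "n \<ge> 1" and r: "r \<ge> 0"
    and f: "\<And>i. i \<in> {1..n} \<Longrightarrow> f i absolutely_integrable_on {-r..r}"
    and small: "\<And>i. i \<in> {1..n} \<Longrightarrow> integral {-r..r} (\<lambda>t. norm (f i t)) \<le> 1/2"
    and i: "i \<in> {1..n}"
  shows "trig_T n f i 0 = (if i = n then 1 else 0)"
    and "(\<lambda>t. f i t * trig_T n f (shift_perm n i) t) absolutely_integrable_on {-r..r}"
    and "\<And>u v. \<lbrakk>-r \<le> u; u \<le> v; v \<le> r\<rbrakk> \<Longrightarrow>
      ((\<lambda>t. f i t * trig_T n f (shift_perm n i) t) has_integral trig_T n f i v - trig_T n f i u) {u..v}"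
proof -
  \<comment> \<open>only values of \<open>f i\<close> between \<open>0\<close> and the argument matter, so \<open>f i\<close> may be cut off outside \<open>{-r..r}\<close>\<close>
  define F where "F i t = indicator {-r..r} t *\<^sub>R f i t" for i t
  have Fint: "integrable lebesgue (F k)" if "k \<in> {1..n}" for k
    using f[OF that] unfolding F_def set_integrable_def .
  have Fq: "(\<integral>t. norm (F k t) \<partial>lebesgue) \<le> 1/2" if "k \<in> {1..n}" for k
  proof -
    have "(\<integral>t. norm (F k t) \<partial>lebesgue) = (LINT t:{-r..r}|lebesgue. norm (f k t))"
      unfolding set_lebesgue_integral_def by (simp add: F_def)
    also have "\<dots> = integral {-r..r} (\<lambda>t. norm (f k t))"
      by (rule set_lebesgue_integral_eq_integral(2)[OF set_integrable_norm[OF f[OF that]]])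
    finally show ?thesis using small[OF that] by simp
  qed
  have q: "(0::real) \<le> 1/2" "(1/2::real) \<le> 1/2" by auto
  have T_eq: "trig_T n F i x = (if i = n then 1 else 0) + signed_integral (\<lambda>t. F i t * trig_T n F (shift_perm n i) t) x" for x
    by (rule trig_T_eq[OF n Fint Fq q i])
  have T_int: "integrable lebesgue (\<lambda>t. F i t * trig_T n F (shift_perm n i) t)"
    by (rule trig_T_integrable[OF n Fint Fq q i])
  have S: "trig_S n F k x = trig_S n f k x" if x: "x \<in> {-r..r}" for k x
  proof (cases "k = 0")
    case False
    have "F (residue_index n l) t = f (residue_index n l) t" if "\<bar>t\<bar> \<le> r" for l t
    proof -
      have "t \<in> {-r..r}" using that by (simp add: abs_le_iff)
      then show ?thesis by (simp add: F_def)
    qed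
    then have "simplex_integral \<sigma> (\<lambda>l. F (residue_index n l)) k x = simplex_integral \<sigma> (\<lambda>l. f (residue_index n l)) k x"
      if "\<sigma> = 1 \<or> \<sigma> = -1" for \<sigma>
      using x that by (intro simplex_integral_cong) auto
    then show ?thesis using False by (simp add: trig_S_eq)
  qed simp
  have T: "trig_T n F k x = trig_T n f k x" if "x \<in> {-r..r}" for k x
    unfolding trig_T_def S[OF that] ..
  have eq: "indicator {-r..r} t *\<^sub>R (f i t * trig_T n f (shift_perm n i) t) = F i t * trig_T n F (shift_perm n i) t" for t
    by (cases "t \<in> {-r..r}") (simp_all add: T F_def)
  show "trig_T n f i 0 = (if i = n then 1 else 0)"
  proof -
    have "trig_T n f i 0 = trig_T n F i 0" using T[of 0 i] r by simp
    also have "\<dots> = (if i = n then 1 else 0)" unfolding T_eq[of 0] signed_integral_0 by simp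
    finally show ?thesis .
  qed
  show "(\<lambda>t. f i t * trig_T n f (shift_perm n i) t) absolutely_integrable_on {-r..r}"
    unfolding set_integrable_def eq by (rule T_int)
  show "((\<lambda>t. f i t * trig_T n f (shift_perm n i) t) has_integral trig_T n f i v - trig_T n f i u) {u..v}"
    if uv: "-r \<le> u" "u \<le> v" "v \<le> r" for u v
  proof -
    have "((\<lambda>t. F i t * trig_T n F (shift_perm n i) t) has_integral trig_T n F i v - trig_T n F i u) {u..v}"
      unfolding T_eq[of u] T_eq[of v] using signed_integral_has_integral[OF T_int uv(2)] by simp
    then have "((\<lambda>t. f i t * trig_T n f (shift_perm n i) t) has_integral trig_T n F i v - trig_T n F i u) {u..v}"
    proof (rule has_integral_eq[rotated])
      show "F i t * trig_T n F (shift_perm n i) t = f i t * trig_T n f (shift_perm n i) t" if "t \<in> {u..v}" for t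
        using that uv T[of t] by (simp add: F_def)
    qed
    moreover have "trig_T n F i v = trig_T n f i v" "trig_T n F i u = trig_T n f i u"
      using T uv by auto
    ultimately show ?thesis by (simp only:)
  qed
qed

section \<open>Factorisation of the differential operator\<close>

lemma alpha_rec:
  assumes "1 \<le> k" "k < n"
  shows "alpha n \<phi> k = toeplitz_D n (\<lambda>j x. \<phi> (Suc k) x * alpha n \<phi> (Suc k) j x)"
  using alpha_step[of "Suc k" n \<phi>] assms by simp

lemma toeplitz_D_cong:
  assumes "open J" "\<And>j x. x \<in> J \<Longrightarrow> v j x = w j x" "x \<in> J"
  shows "toeplitz_D n v i x = toeplitz_D n w i x"
  unfolding toeplitz_D_def using assms by (intro sum.cong nderiv_cong[of J]) auto

text \<open>The vector \<open>\<alpha>\<^sup>k\<close> vanishes beyond its component of index \<open>k + 1\<close>.\<close>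

lemma alpha_eq_0:
  assumes "1 \<le> k" "k \<le> n"
  shows "\<forall>j\<in>{k+2..n+1}. alpha n \<phi> k j = (\<lambda>x. 0)"
  using assms(2,1)
proof (induction rule: inc_induct)
  case base
  show ?case by (simp add: alpha_top)
next
  case (step k)
  have rec: "alpha n \<phi> k = toeplitz_D n (\<lambda>j x. \<phi> (Suc k) x * alpha n \<phi> (Suc k) j x)"
    by (rule alpha_rec) (use step in auto)
  show ?case
  proof
    fix i assume i: "i \<in> {k+2..n+1}"
    have "nderiv (j - i - 1) (\<lambda>x. \<phi> (Suc k) x * alpha n \<phi> (Suc k) j x) x = 0" if "j \<in> {i+1..n+1}" for j x
    proof -
      have "alpha n \<phi> (Suc k) j = (\<lambda>x. 0)" using step i that by simp
      then show ?thesis by (simp add: nderiv_const)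
    qed
    then show "alpha n \<phi> k i = (\<lambda>x. 0)"
      unfolding rec toeplitz_D_def by simp
  qed
qed

lemma alpha_diag:
  assumes "1 \<le> k" "k \<le> n"
  shows "alpha n \<phi> k (k + 1) = (\<lambda>x. \<Prod>l=k+1..n. \<phi> l x)"
  using assms(2,1)
proof (induction rule: inc_induct)
  case base
  show ?case by (simp add: alpha_top)
next
  case (step k)
  have rec: "alpha n \<phi> k = toeplitz_D n (\<lambda>j x. \<phi> (Suc k) x * alpha n \<phi> (Suc k) j x)"
    by (rule alpha_rec) (use step in auto)
  let ?w = "\<lambda>j x. \<phi> (Suc k) x * alpha n \<phi> (Suc k) j x"
  have z: "nderiv (j - (k+1) - 1) (?w j) x = 0" if "j \<in> {k+3..n+1}" for j x
  proof -
    have "alpha n \<phi> (Suc k) j = (\<lambda>x. 0)" using alpha_eq_0[of "Suc k" n \<phi>] step that by simp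
    then show ?thesis by (simp add: nderiv_const)
  qed
  have "alpha n \<phi> k (k + 1) x = (\<Prod>l=k+1..n. \<phi> l x)" for x
  proof -
    have "{k+1+1..n+1} = insert (k+2) {k+3..n+1}" using step by auto
    then have "alpha n \<phi> k (k + 1) x = nderiv 0 (?w (k+2)) x + (\<Sum>j\<in>{k+3..n+1}. nderiv (j - (k+1) - 1) (?w j) x)"
      unfolding rec toeplitz_D_def by simp
    also have "(\<Sum>j\<in>{k+3..n+1}. nderiv (j - (k+1) - 1) (?w j) x) = 0"
      using z by (intro sum.neutral) blast
    also have "nderiv 0 (?w (k+2)) x + 0 = \<phi> (Suc k) x * (\<Prod>l=k+2..n. \<phi> l x)"
      using step.IH by (simp add: fun_eq_iff)
    also have "\<dots> = (\<Prod>l=k+1..n. \<phi> l x)"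
      using step prod.atLeast_Suc_atMost[of "k+1" n "\<lambda>l. \<phi> l x"] by simp
    finally show ?thesis .
  qed
  then show ?case by blast
qed

lemma alpha_product_AC_class:
  assumes J: "open J" and k: "1 \<le> k" "k \<le> n" and \<phi>: "AC_class J (k - 1) (\<phi> k)"
    and \<alpha>: "\<forall>j\<in>{1..n+1}. AC_class J (j - 1) (alpha n \<phi> k j)" and j: "j \<in> {1..n+1}"
  shows "AC_class J (j - 2) (\<lambda>x. \<phi> k x * alpha n \<phi> k j x)"
proof (cases "j \<le> k + 1")
  case True
  have "AC_class J (j - 1) (alpha n \<phi> k j)" using \<alpha> j by blast
  then have "AC_class J (j - 2) (alpha n \<phi> k j)" by (rule AC_class_le[OF J]) simp
  moreover have "AC_class J (j - 2) (\<phi> k)" by (rule AC_class_le[OF J \<phi>]) (use True in simp)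
  ultimately show ?thesis by (intro AC_class_mult[OF J])
next
  case False
  then have "alpha n \<phi> k j = (\<lambda>x. 0)" using alpha_eq_0[OF k] j by simp
  then show ?thesis by (simp add: AC_class_const)
qed

text \<open>The regularity of the components: \<open>\<alpha>\<^sup>k\<^sub>j\<close> has \<open>j - 1\<close> integrable derivatives. The product with \<open>\<phi>\<^sub>k\<close>
loses one order, at \<open>j = k + 1\<close> only, and applying \<open>toeplitz_D\<close> restores the pattern.\<close>

lemma alpha_AC_class:
  assumes J: "open J" and \<phi>: "\<And>k. k \<in> {2..n} \<Longrightarrow> AC_class J (k - 1) (\<phi> k)" and k: "1 \<le> k" "k \<le> n"
  shows "\<forall>j\<in>{1..n+1}. AC_class J (j - 1) (alpha n \<phi> k j)"
  using k(2,1)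
proof (induction rule: inc_induct)
  case base
  show ?case by (simp add: alpha_top AC_class_const)
next
  case (step k)
  have rec: "alpha n \<phi> k = toeplitz_D n (\<lambda>j x. \<phi> (Suc k) x * alpha n \<phi> (Suc k) j x)"
    by (rule alpha_rec) (use step in auto)
  let ?w = "\<lambda>j x. \<phi> (Suc k) x * alpha n \<phi> (Suc k) j x"
  show ?case
  proof
    fix i assume i: "i \<in> {1..n+1}"
    have "AC_class J (i - 1) (\<lambda>x. \<Sum>j=i+1..n+1. nderiv (j - i - 1) (?w j) x)"
    proof (rule AC_class_sum[OF J])
      fix j assume j: "j \<in> {i+1..n+1}"
      have "AC_class J (j - 2) (?w j)"
        using step i j by (intro alpha_product_AC_class[OF J _ _ \<phi>]) auto
      moreover have "j - 2 = (i - 1) + (j - i - 1)" using i j by auto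
      ultimately show "AC_class J (i - 1) (nderiv (j - i - 1) (?w j))" using AC_class_nderiv by metis
    qed
    moreover have "alpha n \<phi> k i = (\<lambda>x. \<Sum>j=i+1..n+1. nderiv (j - i - 1) (?w j) x)"
      unfolding rec toeplitz_D_def ..
    ultimately show "AC_class J (i - 1) (alpha n \<phi> k i)" by simp
  qed
qed

text \<open>The telescoped Leibniz rule for the operator \<open>toeplitz_D\<close>. The component \<open>w j\<close> is differentiated at most
\<open>j - 2\<close> times, namely in row \<open>i = 1\<close>; the component \<open>w 1\<close> does not occur.\<close>

lemma toeplitz_D_mult_AE:
  assumes J: "open J" and z: "AC_class J (k - 1) z"
    and w: "\<And>j. j \<in> {2..k+1} \<Longrightarrow> AC_class J (j - 2) (w j)"
    and w0: "\<And>j. j \<in> {k+2..n+1} \<Longrightarrow> w j = (\<lambda>x. 0)" and i: "1 \<le> i"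
  shows "AE x in lebesgue. x \<in> J \<longrightarrow> toeplitz_D n (\<lambda>j x. z x * w j x) i x =
     z x * toeplitz_D n w i x + toeplitz_D n (\<lambda>j x. nderiv (Suc 0) z x * toeplitz_D n w j x) i x"
proof -
  let ?z = "nderiv (Suc 0) z"
  have leibniz: "AE x in lebesgue. x \<in> J \<longrightarrow> nderiv (j - i - 1) (\<lambda>x. z x * w j x) x =
      z x * nderiv (j - i - 1) (w j) x +
      (\<Sum>l<j - i - 1. nderiv (j - i - 1 - 1 - l) (\<lambda>x. ?z x * nderiv l (w j) x) x)"
    if j: "j \<in> {i+1..n+1}" for j
  proof (cases "j \<le> k + 1")
    case True
    have "AC_class J (j - i - 1) z" by (rule AC_class_le[OF J z]) (use True i in simp)
    moreover have "AC_class J (j - i - 1) (w j)"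
      by (rule AC_class_le[OF J w]) (use True i j in auto)
    ultimately show ?thesis by (rule nderiv_mult_AE[OF J])
  next
    case False
    then have "w j = (\<lambda>x. 0)" using w0 j by simp
    then show ?thesis by (simp add: nderiv_const)
  qed
  have inner: "AE x in lebesgue. x \<in> J \<longrightarrow> nderiv (p - i - 1) (\<lambda>x. ?z x * toeplitz_D n w p x) x =
      (\<Sum>j=p+1..n+1. nderiv (p - i - 1) (\<lambda>x. ?z x * nderiv (j - p - 1) (w j) x) x)"
    if p: "p \<in> {i+1..n+1}" for p
  proof -
    have eq: "(\<lambda>x. ?z x * toeplitz_D n w p x) = (\<lambda>x. \<Sum>j=p+1..n+1. ?z x * nderiv (j - p - 1) (w j) x)"
      by (simp only: toeplitz_D_def sum_distrib_left)
    have Wp: "AC_class J (p - i - 1) (\<lambda>x. ?z x * nderiv (j - p - 1) (w j) x)" if j: "j \<in> {p+1..n+1}" for j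
    proof (cases "j \<le> k + 1")
      case True
      have "k - 1 = Suc (k - 2)" using True i p j by auto
      then have "AC_class J (k - 2) ?z" using z AC_class_nderiv_Suc by metis
      then have 1: "AC_class J (p - i - 1) ?z" by (rule AC_class_le[OF J]) (use True i p j in auto)
      have "AC_class J (j - 2) (w j)" using w True i p j by auto
      moreover have "j - 2 = (p - 1) + (j - p - 1)" using i p j by auto
      ultimately have "AC_class J (p - 1) (nderiv (j - p - 1) (w j))" using AC_class_nderiv by metis
      then have 2: "AC_class J (p - i - 1) (nderiv (j - p - 1) (w j))" by (rule AC_class_le[OF J]) simp
      show ?thesis by (rule AC_class_mult[OF J 1 2])
    next
      case False
      then have "w j = (\<lambda>x. 0)" using w0 j by simp
      then show ?thesis by (simp add: nderiv_const AC_class_const)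
    qed
    show ?thesis unfolding eq by (rule nderiv_sum_AE[OF J Wp])
  qed
  have L: "AE x in lebesgue. \<forall>j\<in>{i+1..n+1}. x \<in> J \<longrightarrow> nderiv (j - i - 1) (\<lambda>x. z x * w j x) x =
      z x * nderiv (j - i - 1) (w j) x +
      (\<Sum>l<j - i - 1. nderiv (j - i - 1 - 1 - l) (\<lambda>x. ?z x * nderiv l (w j) x) x)"
    using leibniz by (intro eventually_ball_finite) auto
  have R: "AE x in lebesgue. \<forall>p\<in>{i+1..n+1}. x \<in> J \<longrightarrow> nderiv (p - i - 1) (\<lambda>x. ?z x * toeplitz_D n w p x) x =
      (\<Sum>j=p+1..n+1. nderiv (p - i - 1) (\<lambda>x. ?z x * nderiv (j - p - 1) (w j) x) x)"
    using inner by (intro eventually_ball_finite) auto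
  from L R show ?thesis
  proof eventually_elim
    case (elim x)
    show ?case
    proof
      assume x: "x \<in> J"
      let ?G = "\<lambda>p j. nderiv (p - i - 1) (\<lambda>x. ?z x * nderiv (j - p - 1) (w j) x) x"
      let ?H = "\<lambda>j l. nderiv (j - i - 1 - 1 - l) (\<lambda>x. ?z x * nderiv l (w j) x) x"
      have "toeplitz_D n (\<lambda>j x. z x * w j x) i x =
          (\<Sum>j=i+1..n+1. z x * nderiv (j - i - 1) (w j) x + (\<Sum>l<j - i - 1. ?H j l))"
        unfolding toeplitz_D_def using elim(1) x by (intro sum.cong) auto
      also have "\<dots> = z x * toeplitz_D n w i x + (\<Sum>j=i+1..n+1. \<Sum>l<j - i - 1. ?H j l)"
        by (simp only: toeplitz_D_def sum.distrib sum_distrib_left)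
      also have "(\<Sum>j=i+1..n+1. \<Sum>l<j - i - 1. ?H j l) = (\<Sum>p=i+1..n+1. \<Sum>j=p+1..n+1. ?G p j)"
      proof -
        have "(\<Sum>q\<in>(SIGMA j:{i+1..n+1}. {..<j - i - 1}). ?H (fst q) (snd q)) =
            (\<Sum>q\<in>(SIGMA p:{i+1..n+1}. {p+1..n+1}). ?G (fst q) (snd q))"
          \<comment> \<open>the terms correspond through \<open>p = j - 1 - l\<close>\<close>
          by (rule sum.reindex_bij_witness[of _ "\<lambda>(p, j). (j, j - p - 1)" "\<lambda>(j, l). (j - 1 - l, j)"])
            (auto simp: diff_diff_eq add.commute)
        moreover have "(\<Sum>j\<in>A. \<Sum>l\<in>B j. h j l) = (\<Sum>q\<in>Sigma A B. h (fst q) (snd q))"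
          if "finite A" "\<And>j. finite (B j)" for A :: "nat set" and B :: "nat \<Rightarrow> nat set" and h :: "nat \<Rightarrow> nat \<Rightarrow> complex"
          by (simp add: sum.Sigma that case_prod_unfold)
        ultimately show ?thesis by (simp only: finite_atLeastAtMost finite_lessThan)
      qed
      also have "\<dots> = toeplitz_D n (\<lambda>j x. ?z x * toeplitz_D n w j x) i x"
        unfolding toeplitz_D_def[of n "\<lambda>j x. ?z x * toeplitz_D n w j x"] using elim(2) x by (intro sum.cong) auto
      finally show "toeplitz_D n (\<lambda>j x. z x * w j x) i x =
        z x * toeplitz_D n w i x + toeplitz_D n (\<lambda>j x. ?z x * toeplitz_D n w j x) i x" .
    qed
  qed
qed

text \<open>The cyclic system encodes a factorisation of the differential operator into operators of first order.
No division by the \<open>\<phi> k\<close> takes place, so that their zeros do no harm here.\<close>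

theorem cyclic_system_solves_equation:
  fixes z :: "nat \<Rightarrow> real \<Rightarrow> complex"
  assumes J: "open J" and n: "n \<ge> 1"
    and \<phi>: "\<And>k. k \<in> {2..n} \<Longrightarrow> AC_class J (k - 1) (\<phi> k)"
    and eq: "\<And>k. k \<in> {2..n} \<Longrightarrow> AE x in lebesgue. x \<in> J \<longrightarrow>
      (\<Sum>i=1..n+1. coeff_vec a i x * toeplitz_D n (\<lambda>j x. \<phi> k x * alpha n \<phi> k j x) i x) = 0"
    and prod: "AE x in lebesgue. x \<in> J \<longrightarrow> (\<Prod>k=1..n. \<phi> k x) = a n x"
    and z: "\<And>k. k \<in> {1..n} \<Longrightarrow> AC_class J k (z k)"
    and dz: "\<And>k x. \<lbrakk>k \<in> {2..n}; x \<in> J\<rbrakk> \<Longrightarrow> nderiv (Suc 0) (z k) x = \<phi> k x * z (k - 1) x"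
    and dz1: "AE x in lebesgue. x \<in> J \<longrightarrow> nderiv (Suc 0) (z 1) x = \<phi> 1 x * z n x"
  shows "AE x in lebesgue. x \<in> J \<longrightarrow> nderiv n (z n) x = (\<Sum>j=1..n. a j x * nderiv (n - j) (z n) x)"
proof -
  let ?y = "z n"
  let ?L = "\<lambda>x. (\<Sum>j=1..n. a j x * nderiv (n - j) ?y x) - nderiv n ?y x"
  let ?v = "\<lambda>k j x. nderiv (Suc 0) (z k) x * alpha n \<phi> k j x"
  let ?R = "\<lambda>k x. a n x * ?y x + (\<Sum>i=1..n+1. coeff_vec a i x * toeplitz_D n (?v k) i x)"
  \<comment> \<open>up to null sets, \<open>?R k\<close> is independent of \<open>k\<close>: it is the differential expression for \<open>k = n\<close>, and vanishes for \<open>k = 1\<close>\<close>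
  have main: "AE x in lebesgue. x \<in> J \<longrightarrow> ?L x = ?R k x" if k: "k \<le> n" "1 \<le> k" for k
    using k
  proof (induction rule: inc_induct)
    case base
    have T: "toeplitz_D n (?v n) i x = (if i \<le> n then nderiv (n + 1 - i) ?y x else 0)" if i: "1 \<le> i" for i x
    proof (cases "i \<le> n")
      case True
      have "{i+1..n+1} = insert (n+1) {i+1..n}" using True by auto
      then have "toeplitz_D n (?v n) i x = nderiv (n - i) (\<lambda>x. nderiv (Suc 0) ?y x * 1) x +
          (\<Sum>j\<in>{i+1..n}. nderiv (j - i - 1) (\<lambda>x. nderiv (Suc 0) ?y x * 0) x)"
        by (simp add: toeplitz_D_def alpha_top)
      also have "\<dots> = nderiv (n + 1 - i) ?y x"
        using True by (simp add: nderiv_const nderiv_nderiv Suc_diff_le)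
      finally show ?thesis using True by simp
    qed (simp add: toeplitz_D_def)
    have "?L x = ?R n x" for x
    proof -
      have "(\<Sum>i=1..n+1. coeff_vec a i x * toeplitz_D n (?v n) i x) =
          (\<Sum>i=1..n. coeff_vec a i x * nderiv (n + 1 - i) ?y x)"
        by (simp add: T)
      also have "\<dots> = - nderiv n ?y x + (\<Sum>i=2..n. coeff_vec a i x * nderiv (n + 1 - i) ?y x)"
        using n by (simp add: sum.atLeast_Suc_atMost coeff_vec_def numeral_2_eq_2)
      also have "(\<Sum>i=2..n. coeff_vec a i x * nderiv (n + 1 - i) ?y x) = (\<Sum>j=1..n-1. a j x * nderiv (n - j) ?y x)"
        by (rule sum.reindex_bij_witness[of _ Suc "\<lambda>i. i - 1"]) (auto simp: coeff_vec_def)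
      also have "(\<Sum>j=1..n-1. a j x * nderiv (n - j) ?y x) = (\<Sum>j=1..n. a j x * nderiv (n - j) ?y x) - a n x * ?y x"
        using n by (cases n) auto
      finally show ?thesis by simp
    qed
    then show ?case by simp
  next
    case (step k)
    let ?w = "\<lambda>j x. \<phi> (Suc k) x * alpha n \<phi> (Suc k) j x"
    have rec: "toeplitz_D n ?w = alpha n \<phi> k"
      by (rule alpha_rec[symmetric]) (use step in auto)
    have Sk: "Suc k \<in> {2..n}" "1 \<le> k" "k \<in> {1..n}" using step by auto
    have w: "AC_class J (j - 2) (?w j)" if "j \<in> {2..Suc k + 1}" for j
    proof (rule alpha_product_AC_class[OF J _ _ \<phi>])
      show "\<forall>j\<in>{1..n+1}. AC_class J (j - 1) (alpha n \<phi> (Suc k) j)"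
        by (rule alpha_AC_class[OF J \<phi>]) (use Sk in auto)
    qed (use that Sk in auto)
    have w0: "?w j = (\<lambda>x. 0)" if "j \<in> {Suc k + 2..n+1}" for j
    proof -
      have "alpha n \<phi> (Suc k) j = (\<lambda>x. 0)" using alpha_eq_0[of "Suc k" n \<phi>] Sk that by simp
      then show ?thesis by simp
    qed
    have Wz: "AC_class J (Suc k - 1) (z k)" using z[OF Sk(3)] by simp
    have "AE x in lebesgue. x \<in> J \<longrightarrow> toeplitz_D n (\<lambda>j x. z k x * ?w j x) i x =
        z k x * toeplitz_D n ?w i x + toeplitz_D n (\<lambda>j x. nderiv (Suc 0) (z k) x * toeplitz_D n ?w j x) i x"
      if "i \<in> {1..n+1}" for i
      using that by (intro toeplitz_D_mult_AE[OF J Wz w w0]) auto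
    then have "AE x in lebesgue. \<forall>i\<in>{1..n+1}. x \<in> J \<longrightarrow> toeplitz_D n (\<lambda>j x. z k x * ?w j x) i x =
        z k x * toeplitz_D n ?w i x + toeplitz_D n (?v k) i x"
      unfolding rec by (intro eventually_ball_finite) auto
    moreover have "AE x in lebesgue. x \<in> J \<longrightarrow> ?L x = ?R (Suc k) x"
      using step by simp
    ultimately show ?case using eq[OF Sk(1)]
    proof eventually_elim
      case (elim x)
      show ?case
      proof
        assume x: "x \<in> J"
        have cong: "toeplitz_D n (?v (Suc k)) i x = toeplitz_D n (\<lambda>j x. z k x * ?w j x) i x" for i
          by (rule toeplitz_D_cong[OF J _ x]) (simp add: dz[OF Sk(1)])
        have "(\<Sum>i=1..n+1. coeff_vec a i x * toeplitz_D n (?v (Suc k)) i x) =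
            (\<Sum>i=1..n+1. z k x * (coeff_vec a i x * toeplitz_D n ?w i x) + coeff_vec a i x * toeplitz_D n (?v k) i x)"
        proof (rule sum.cong[OF refl])
          fix i assume "i \<in> {1..n+1}"
          then have "toeplitz_D n (\<lambda>j x. z k x * ?w j x) i x = z k x * toeplitz_D n ?w i x + toeplitz_D n (?v k) i x"
            using elim(1) x by blast
          then show "coeff_vec a i x * toeplitz_D n (?v (Suc k)) i x =
             z k x * (coeff_vec a i x * toeplitz_D n ?w i x) + coeff_vec a i x * toeplitz_D n (?v k) i x"
            unfolding cong by (simp add: distrib_left mult.left_commute)
        qed
        also have "\<dots> = z k x * (\<Sum>i=1..n+1. coeff_vec a i x * toeplitz_D n ?w i x) +
            (\<Sum>i=1..n+1. coeff_vec a i x * toeplitz_D n (?v k) i x)"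
          by (simp only: sum.distrib sum_distrib_left)
        also have "(\<Sum>i=1..n+1. coeff_vec a i x * toeplitz_D n ?w i x) = 0"
          using elim(3) x by blast
        finally show "?L x = ?R k x" using elim(2) x by simp
      qed
    qed
  qed
  have "AE x in lebesgue. x \<in> J \<longrightarrow> ?L x = ?R 1 x" using main n by simp
  then show ?thesis using prod dz1
  proof eventually_elim
    case (elim x)
    show ?case
    proof
      assume x: "x \<in> J"
      have zero: "nderiv m (?v 1 j) x = 0" if "j \<in> {3..n+1}" for m j
      proof -
        have "alpha n \<phi> 1 j = (\<lambda>x. 0)" using alpha_eq_0[of 1 n \<phi>] n that by simp
        then show ?thesis by (simp add: nderiv_const)
      qed
      have T1: "toeplitz_D n (?v 1) 1 x = nderiv (Suc 0) (z 1) x * (\<Prod>l=2..n. \<phi> l x)"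
      proof -
        have "{1+1..n+1} = insert 2 {3..n+1}" using n by auto
        then have "toeplitz_D n (?v 1) 1 x = ?v 1 2 x + (\<Sum>j\<in>{3..n+1}. nderiv (j - 1 - 1) (?v 1 j) x)"
          by (simp add: toeplitz_D_def)
        also have "(\<Sum>j\<in>{3..n+1}. nderiv (j - 1 - 1) (?v 1 j) x) = 0"
          using zero by (intro sum.neutral) blast
        finally show ?thesis using alpha_diag[of 1 n \<phi>] n by (simp add: numeral_2_eq_2)
      qed
      have Ti: "toeplitz_D n (?v 1) i x = 0" if "i \<in> {2..n+1}" for i
        unfolding toeplitz_D_def using zero that by (intro sum.neutral) auto
      have "(\<Sum>i=1..n+1. coeff_vec a i x * toeplitz_D n (?v 1) i x) =
          coeff_vec a 1 x * toeplitz_D n (?v 1) 1 x + (\<Sum>i=2..n+1. coeff_vec a i x * toeplitz_D n (?v 1) i x)"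
        using n by (simp add: sum.atLeast_Suc_atMost numeral_2_eq_2)
      also have "(\<Sum>i=2..n+1. coeff_vec a i x * toeplitz_D n (?v 1) i x) = 0"
        using Ti by (intro sum.neutral) simp
      also have "coeff_vec a 1 x * toeplitz_D n (?v 1) 1 x + 0 = - (\<phi> 1 x * (\<Prod>l=2..n. \<phi> l x)) * ?y x"
        using elim(3) x unfolding T1 by (simp add: coeff_vec_def)
      also have "\<phi> 1 x * (\<Prod>l=2..n. \<phi> l x) = a n x"
        using elim(2) x n by (simp add: prod.atLeast_Suc_atMost numeral_2_eq_2)
      finally have "?L x = 0" using elim(1) x by simp
      then show "nderiv n ?y x = (\<Sum>j=1..n. a j x * nderiv (n - j) ?y x)" by simp
    qed
  qed
qed

section \<open>Initial values and local uniqueness\<close>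

lemma cyclic_system_initial_values:
  fixes z :: "nat \<Rightarrow> real \<Rightarrow> complex"
  assumes J: "open J" "0 \<in> J"
    and \<phi>: "\<And>k. k \<in> {2..n} \<Longrightarrow> AC_class J (k - 1) (\<phi> k)"
    and jet: "\<And>k j. \<lbrakk>k \<in> {2..n}; j \<in> {1..k-1}\<rbrakk> \<Longrightarrow> nderiv (j - 1) (\<phi> k) 0 = (if j = 1 then 1 else 0)"
    and z: "\<And>k. k \<in> {1..n} \<Longrightarrow> AC_class J k (z k)"
    and dz: "\<And>k x. \<lbrakk>k \<in> {2..n}; x \<in> J\<rbrakk> \<Longrightarrow> nderiv (Suc 0) (z k) x = \<phi> k x * z (k - 1) x"
  shows "\<lbrakk>j < m; m \<le> n\<rbrakk> \<Longrightarrow> nderiv j (z m) 0 = z (m - j) 0"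
proof (induction j arbitrary: m)
  case (Suc j)
  then have m: "m \<in> {2..n}" "m - 1 \<in> {1..n}" "Suc j \<le> m - 1" by auto
  have "nderiv (Suc j) (z m) 0 = nderiv j (\<lambda>x. \<phi> m x * z (m - 1) x) 0"
    unfolding nderiv_Suc_shift[of j] by (rule nderiv_cong[OF J(1) dz[OF m(1)] J(2)])
  also have "\<dots> = 1 * nderiv j (z (m - 1)) 0"
  proof (rule nderiv_mult_flat[OF J])
    show "AC_class J (Suc j) (\<phi> m)" by (rule AC_class_le[OF J(1) \<phi>[OF m(1)] m(3)])
    show "AC_class J (Suc j) (z (m - 1))" by (rule AC_class_le[OF J(1) z[OF m(2)] m(3)])
    show "nderiv i (\<phi> m) 0 = (if i = 0 then 1 else 0)" if "i \<le> j" for i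
      using jet[OF m(1), of "Suc i"] that m(3) by simp
  qed
  also have "\<dots> = z (m - 1 - j) 0" using Suc by simp
  finally show ?case by simp
qed simp

lemma small_integral:
  fixes b :: "real \<Rightarrow> real"
  assumes "r > 0" "b integrable_on {-r..r}" "\<epsilon> > 0"
  obtains \<rho> where "0 < \<rho>" "\<rho> \<le> r" "\<And>s. \<lbrakk>0 \<le> s; s \<le> \<rho>\<rbrakk> \<Longrightarrow> integral {-s..s} b \<le> \<epsilon>"
proof -
  let ?H = "\<lambda>x. integral {-r..x} b"
  have "continuous_on {-r..r} ?H" using assms(2) by (rule indefinite_integral_continuous_1)
  moreover have "0 \<in> {-r..r}" using assms(1) by simp
  ultimately obtain d where d: "d > 0" "\<And>x. x \<in> {-r..r} \<Longrightarrow> dist x 0 < d \<Longrightarrow> dist (?H x) (?H 0) < \<epsilon>/2"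
    using half_gt_zero[OF assms(3)] unfolding continuous_on_iff by blast
  define \<rho> where "\<rho> = min r (d/2)"
  have "integral {-s..s} b \<le> \<epsilon>" if s: "0 \<le> s" "s \<le> \<rho>" for s
  proof -
    have s': "s \<le> r" "s < d" using s d(1) by (auto simp: \<rho>_def min_def split: if_splits)
    have "dist (?H s) (?H 0) < \<epsilon>/2" by (rule d(2)) (use s s' in auto)
    moreover have "dist (?H (-s)) (?H 0) < \<epsilon>/2" by (rule d(2)) (use s s' in auto)
    moreover have "?H (-s) + integral {-s..s} b = ?H s"
    proof (rule Henstock_Kurzweil_Integration.integral_combine)
      show "b integrable_on {-r..s}"
        by (rule integrable_on_subinterval[OF assms(2)]) (use s' s in auto)
    qed (use s s' in auto)
    ultimately show ?thesis unfolding dist_real_def by linarith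
  qed
  moreover have "0 < \<rho>" "\<rho> \<le> r" using assms(1) d(1) by (auto simp: \<rho>_def)
  ultimately show thesis using that by blast
qed

text \<open>Let \<open>D\<^sub>i\<close> be the difference of the \<open>i\<close>-th derivatives, for \<open>i < n\<close>. On an interval over which
\<open>b = 1 + (\<Sum>j=1..n. \<bar>a\<^sub>j\<bar>)\<close> has integral at most \<open>1/2\<close>, a common bound for the \<open>D\<^sub>i\<close> can be halved, hence
they vanish.\<close>

lemma local_uniqueness:
  fixes y y' :: "real \<Rightarrow> complex"
  assumes n: "n \<ge> 1" and r: "r > 0"
    and a: "\<And>j. j \<in> {1..n} \<Longrightarrow> a j absolutely_integrable_on {-r..r}"
    and y: "AC_class {-r<..<r} n y" "AE x in lebesgue. x \<in> {-r<..<r} \<longrightarrow> nderiv n y x = (\<Sum>j=1..n. a j x * nderiv (n - j) y x)"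
    and y': "AC_class {-r<..<r} n y'" "AE x in lebesgue. x \<in> {-r<..<r} \<longrightarrow> nderiv n y' x = (\<Sum>j=1..n. a j x * nderiv (n - j) y' x)"
    and init: "\<And>i. i < n \<Longrightarrow> nderiv i y 0 = nderiv i y' 0"
  obtains \<rho> where "0 < \<rho>" "\<rho> < r" "\<And>x. x \<in> {-\<rho>..\<rho>} \<Longrightarrow> y x = y' x"
proof -
  let ?J = "{-r<..<r}"
  define b where "b x = 1 + (\<Sum>j=1..n. norm (a j x))" for x
  have b_abs: "b absolutely_integrable_on {-r..r}"
    unfolding b_def using a
    by (intro set_integral_add(1) absolutely_integrable_sum set_integrable_norm)
      (auto simp: absolutely_integrable_on_const)
  then have "b integrable_on {-r..r}" using set_lebesgue_integral_eq_integral(1) by blast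
  then obtain \<rho>0 where \<rho>0: "0 < \<rho>0" "\<rho>0 \<le> r" "\<And>s. \<lbrakk>0 \<le> s; s \<le> \<rho>0\<rbrakk> \<Longrightarrow> integral {-s..s} b \<le> 1/2"
    using small_integral[OF r, of b "1/2"] by auto
  \<comment> \<open>strictly inside, as nothing is assumed about the solutions at \<open>-r\<close> and \<open>r\<close>\<close>
  define \<rho> where "\<rho> = \<rho>0 / 2"
  have \<rho>: "0 < \<rho>" "\<rho> < r" "integral {-\<rho>..\<rho>} b \<le> 1/2" using \<rho>0 by (auto simp: \<rho>_def)
  have sub: "{-\<rho>..\<rho>} \<subseteq> ?J" using \<rho> by auto
  have b_int: "b integrable_on {u..v}" if "-\<rho> \<le> u" "v \<le> \<rho>" for u v
    using integrable_on_subinterval[OF \<open>b integrable_on {-r..r}\<close>] that \<rho> by simp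
  have b0: "b x \<ge> 1" for x by (simp add: b_def sum_nonneg)
  define D where "D i x = nderiv i y x - nderiv i y' x" for i x
  define E where "E i x = (if i < n - 1 then D (Suc i) x else (\<Sum>j=1..n. a j x * D (n - j) x))" for i x
  have FTC: "(nderiv (Suc i) f has_integral nderiv i f v - nderiv i f u) {u..v}"
    if f: "AC_class ?J n f" and i: "i < n" and uv: "-\<rho> \<le> u" "u \<le> v" "v \<le> \<rho>" for f i u v
  proof -
    have "AC_class ?J (1 + i) f" by (rule AC_class_le[OF _ f]) (use i in auto)
    then have "AC_class ?J 1 (nderiv i f)" by (rule AC_class_nderiv)
    then have "AC_on_interval (-\<rho>) \<rho> (nderiv i f)"
      using sub by (simp add: AC_class_1 locally_AC_on_def)
    from AC_on_interval_FTC(3)[OF this _ uv] show ?thesis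
      using \<rho> by (simp add: nderiv_Suc[abs_def])
  qed
  have E: "(E i has_integral D i v - D i u) {u..v}"
    if i: "i < n" and uv: "-\<rho> \<le> u" "u \<le> v" "v \<le> \<rho>" for i u v
  proof -
    have h: "((\<lambda>x. nderiv (Suc i) y x - nderiv (Suc i) y' x) has_integral D i v - D i u) {u..v}"
      using has_integral_diff[OF FTC[OF y(1) i uv] FTC[OF y'(1) i uv]] by (simp add: D_def algebra_simps)
    show ?thesis
    proof (cases "i < n - 1")
      case True
      then have "E i = (\<lambda>x. nderiv (Suc i) y x - nderiv (Suc i) y' x)"
        by (simp add: E_def D_def fun_eq_iff)
      then show ?thesis using h by simp
    next
      case False
      then have Suc_i: "Suc i = n" using i by simp
      have "AE x in lebesgue. x \<in> ?J \<longrightarrow> E i x = nderiv (Suc i) y x - nderiv (Suc i) y' x"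
        using y(2) y'(2)
      proof eventually_elim
        case (elim x)
        then show ?case
          using False by (simp add: E_def D_def Suc_i right_diff_distrib sum_subtractf)
      qed
      then obtain N where N: "negligible N"
        "{x. \<not> (x \<in> ?J \<longrightarrow> E i x = nderiv (Suc i) y x - nderiv (Suc i) y' x)} \<subseteq> N"
        unfolding eventually_ae_filter_negligible by blast
      show ?thesis
      proof (rule has_integral_spike[OF N(1) _ h])
        fix x assume x: "x \<in> {u..v} - N"
        then have "x \<in> ?J" using uv \<rho>(2) by auto
        then show "E i x = nderiv (Suc i) y x - nderiv (Suc i) y' x" using N(2) x by blast
      qed
    qed
  qed
  have half: "\<forall>i<n. \<forall>x\<in>{-\<rho>..\<rho>}. norm (D i x) \<le> B / 2"
    if B: "\<forall>i<n. \<forall>x\<in>{-\<rho>..\<rho>}. norm (D i x) \<le> B" for B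
  proof (intro allI impI ballI)
    fix i x assume i: "i < n" and x: "x \<in> {-\<rho>..\<rho>}"
    have B0: "0 \<le> B" using B i x norm_ge_zero order.trans by blast
    have Eb: "norm (E i t) \<le> B * b t" if t: "t \<in> {-\<rho>..\<rho>}" for t
    proof (cases "i < n - 1")
      case True
      then have "norm (E i t) \<le> B * 1" using B t by (simp add: E_def)
      also have "\<dots> \<le> B * b t" using B0 b0 by (rule mult_left_mono[rotated])
      finally show ?thesis .
    next
      case False
      have "norm (E i t) \<le> (\<Sum>j=1..n. norm (a j t * D (n - j) t))"
        using False by (simp add: E_def norm_sum)
      also have "\<dots> \<le> (\<Sum>j=1..n. norm (a j t) * B)"
        unfolding norm_mult using B t by (intro sum_mono mult_left_mono) auto
      also have "\<dots> \<le> B * b t" using B0 by (simp add: b_def sum_distrib_left algebra_simps)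
      finally show ?thesis .
    qed
    have bound: "norm (D i v - D i u) \<le> B / 2" if uv: "-\<rho> \<le> u" "u \<le> v" "v \<le> \<rho>" for u v
    proof -
      have "(\<lambda>t. B * b t) integrable_on {u..v}"
        using integrable_cmul[OF b_int[of u v], of B] uv by simp
      then have "norm (integral {u..v} (E i)) \<le> integral {u..v} (\<lambda>t. B * b t)"
        using has_integral_integrable[OF E[OF i uv]] uv Eb
        by (intro integral_norm_bound_integral) auto
      also have "\<dots> = B * integral {u..v} b" by simp
      also have "\<dots> \<le> B * (1/2)"
      proof (rule mult_left_mono[OF _ B0])
        have "integral {u..v} b \<le> integral {-\<rho>..\<rho>} b"
          using uv b_int[of u v] b_int[of "-\<rho>" \<rho>] b0 by (intro integral_subset_le) (auto intro: order.trans[OF zero_le_one])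
        then show "integral {u..v} b \<le> 1/2" using \<rho>(3) by linarith
      qed
      finally show ?thesis using E[OF i uv] by (simp add: integral_unique)
    qed
    have "D i 0 = 0" using init[OF i] by (simp add: D_def)
    then show "norm (D i x) \<le> B / 2"
      using bound[of 0 x] bound[of x 0] x \<rho>(1) by (cases "0 \<le> x") auto
  qed
  have "\<exists>B. \<forall>i<n. \<forall>x\<in>{-\<rho>..\<rho>}. norm (D i x) \<le> B"
  proof -
    have "\<exists>B. \<forall>x\<in>{-\<rho>..\<rho>}. norm (D i x) \<le> B" if i: "i < n" for i
    proof -
      have "continuous_on {-\<rho>..\<rho>} (nderiv i f)" if f: "AC_class ?J n f" for f
      proof -
        have "AC_class ?J (Suc 0 + i) f" by (rule AC_class_le[OF _ f]) (use i in auto)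
        then show ?thesis using AC_class_continuous[OF AC_class_nderiv[of ?J "Suc 0" i f]] sub
          by (auto intro: continuous_on_subset)
      qed
      then have "continuous_on {-\<rho>..\<rho>} (D i)"
        unfolding D_def using y(1) y'(1) by (intro continuous_on_diff) auto
      from compact_imp_bounded[OF compact_continuous_image[OF this compact_Icc]]
      show ?thesis by (auto simp: bounded_iff)
    qed
    then obtain B where B: "\<And>i x. \<lbrakk>i < n; x \<in> {-\<rho>..\<rho>}\<rbrakk> \<Longrightarrow> norm (D i x) \<le> B i" by metis
    have "norm (D i x) \<le> (\<Sum>i<n. \<bar>B i\<bar>)" if "i < n" "x \<in> {-\<rho>..\<rho>}" for i x
    proof -
      have "norm (D i x) \<le> \<bar>B i\<bar>" using B[OF that] by linarith
      also have "\<dots> \<le> (\<Sum>i<n. \<bar>B i\<bar>)" using that(1) by (intro member_le_sum) auto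
      finally show ?thesis .
    qed
    then show ?thesis by blast
  qed
  then obtain B where B: "\<forall>i<n. \<forall>x\<in>{-\<rho>..\<rho>}. norm (D i x) \<le> B" by blast
  have iter: "\<forall>i<n. \<forall>x\<in>{-\<rho>..\<rho>}. norm (D i x) \<le> B * (1/2) ^ k" for k
  proof (induction k)
    case (Suc k)
    from half[OF Suc.IH] show ?case by simp
  qed (use B in simp)
  have "y x = y' x" if x: "x \<in> {-\<rho>..\<rho>}" for x
  proof -
    have "(\<lambda>k. B * (1/2) ^ k) \<longlonglongrightarrow> B * 0"
      by (intro tendsto_mult tendsto_const LIMSEQ_power_zero) simp
    then have "norm (D 0 x) \<le> 0"
      using iter n x by (intro LIMSEQ_le_const[of "\<lambda>k. B * (1/2) ^ k"]) auto
    then show ?thesis by (simp add: D_def)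
  qed
  with \<rho>(1,2) show thesis using that by blast
qed

section \<open>The fundamental solutions\<close>

lemma has_vector_derivative_from_integral:
  fixes F g :: "real \<Rightarrow> complex"
  assumes "\<And>u v. \<lbrakk>-r \<le> u; u \<le> v; v \<le> r\<rbrakk> \<Longrightarrow> (g has_integral F v - F u) {u..v}"
    and cont: "continuous_on {-r..r} g" and x: "x \<in> {-r<..<r}"
  shows "(F has_vector_derivative g x) (at x)"
proof -
  have x': "x \<in> {-r..r}" using x by auto
  have "((\<lambda>u. integral {-r..u} g) has_vector_derivative g x) (at x within {-r..r})"
    by (rule integral_has_vector_derivative[OF cont x'])
  then have 1: "((\<lambda>u. integral {-r..u} g + F (-r)) has_vector_derivative g x) (at x within {-r..r})"
    by (simp add: has_vector_derivative_add_const)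
  have 2: "F y = integral {-r..y} g + F (-r)" if "y \<in> {-r..r}" for y
  proof -
    have "integral {-r..y} g = F y - F (-r)" using that by (intro integral_unique assms(1)) auto
    then show ?thesis by simp
  qed
  have "(F has_vector_derivative g x) (at x within {-r..r})"
    by (rule has_vector_derivative_transform[OF x' 2 1])
  then show ?thesis using x at_within_Icc_at[of "-r" x r] by simp
qed

lemma shift_perm_power_n: "i < n \<Longrightarrow> (shift_perm n ^^ i) n = n - i"
  by (induction i) (auto simp: shift_perm_def)

lemma shift_perm_power_permutes: "n \<ge> 1 \<Longrightarrow> (shift_perm n ^^ i) permutes {1..n}"
proof (induction i)
  case 0
  show ?case unfolding funpow_0 by (simp add: permutes_def)
next
  case (Suc i)
  then show ?case
    unfolding funpow_Suc_right by (intro permutes_compose shift_perm_permutes) auto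
qed

theorem theorem1:
  fixes n :: nat and a \<phi> \<psi> :: "nat \<Rightarrow> real \<Rightarrow> complex" and I :: "real set"
  assumes "n \<ge> 2"
    and "\<And>i. i \<in> {1..n} \<Longrightarrow> locally_integrable (a i)"
    and "open I" and "is_interval I" and "0 \<in> I"
    and "auxiliary_functions_on I n a \<phi>"
    and "\<And>k. k \<in> {1..n} \<Longrightarrow> fundamental_solution n a k (\<psi> k)"
  shows "\<forall>k\<in>{1..n}. \<exists>U. open U \<and> 0 \<in> U \<and> U \<subseteq> I \<and>
    (\<forall>x\<in>U. \<psi> k x =
      (let \<eta> = shift_perm n ^^ (k - 1) in trig_T n (\<lambda>i. \<phi> (\<eta> i)) (inv \<eta> n) x))"
proof
  fix k assume k: "k \<in> {1..n}"
  note n = assms(1) and a = assms(2)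
  have n1: "n \<ge> 1" using n by simp
  have \<phi>W: "AC_class I (m - 1) (\<phi> m)" if "m \<in> {2..n}" for m
  proof -
    have "m - 1 = Suc (m - 2)" using that by auto
    then show ?thesis using assms(6) that by (simp add: auxiliary_functions_on_def AC_class_Suc)
  qed
  have \<phi>eq: "AE x in lebesgue. x \<in> I \<longrightarrow>
      (\<Sum>i=1..n+1. coeff_vec a i x * toeplitz_D n (\<lambda>j x. \<phi> m x * alpha n \<phi> m j x) i x) = 0"
    if "m \<in> {2..n}" for m
    using assms(6) that unfolding auxiliary_functions_on_def by blast
  have jet: "nderiv (j - 1) (\<phi> m) 0 = (if j = 1 then 1 else 0)" if "m \<in> {2..n}" "j \<in> {1..m-1}" for m j
    using assms(6) that unfolding auxiliary_functions_on_def by blast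
  have prod: "AE x in lebesgue. x \<in> I \<longrightarrow> (\<Prod>k=1..n. \<phi> k x) = a n x"
    using assms(6) unfolding auxiliary_functions_on_def by blast
  have a_int: "a j absolutely_integrable_on {c..d}" if "j \<in> {1..n}" for j c d
    using a[OF that] by (simp add: locally_integrable_def)
  have \<phi>cont: "continuous_on I (\<phi> m)" if "m \<in> {2..n}" for m
  proof -
    have "AC_class I (Suc 0) (\<phi> m)" by (rule AC_class_le[OF assms(3) \<phi>W[OF that]]) (use that in auto)
    then show ?thesis using assms(3) by (rule AC_class_continuous)
  qed
  define P where "P x = (\<Prod>m=2..n. \<phi> m x)" for x
  have Pcont: "continuous_on I P" unfolding P_def by (intro continuous_on_prod \<phi>cont)
  have P0: "P 0 = 1"
    unfolding P_def using jet[of _ 1] by (intro prod.neutral) auto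
  \<comment> \<open>where \<open>\<phi>\<^sub>2 \<cdots> \<phi>\<^sub>n\<close> has no zero, \<open>\<phi>\<^sub>1\<close> is integrable as a quotient of \<open>a\<^sub>n\<close>\<close>
  obtain r1 where r1: "r1 > 0" "{-r1..r1} \<subseteq> I" "\<And>x. x \<in> {-r1..r1} \<Longrightarrow> P x \<noteq> 0"
  proof -
    have "open {x \<in> I. P x \<noteq> 0}"
      using continuous_open_preimage[OF Pcont assms(3), of "-{0}"] by (simp add: vimage_def Int_def conj_commute open_Compl)
    moreover have "0 \<in> {x \<in> I. P x \<noteq> 0}" using P0 assms(5) by simp
    ultimately obtain e where e: "e > 0" "cball 0 e \<subseteq> {x \<in> I. P x \<noteq> 0}"
      using open_contains_cball by blast
    have "{-e..e} = cball 0 e" by (simp add: cball_eq_atLeastAtMost)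
    then have "{-e..e} \<subseteq> I" "x \<in> {-e..e} \<Longrightarrow> P x \<noteq> 0" for x using e(2) by blast+
    with e(1) show thesis by (rule that)
  qed
  have \<phi>1_int: "\<phi> 1 absolutely_integrable_on {-r1..r1}"
  proof -
    have contP: "continuous_on {-r1..r1} (\<lambda>x. inverse (P x))"
      using continuous_on_subset[OF Pcont r1(2)] r1(3) by (intro continuous_on_inverse) auto
    have quot: "(\<lambda>x. inverse (P x) * a n x) absolutely_integrable_on {-r1..r1}"
    proof (rule absolutely_integrable_bounded_measurable_product[of "(*)"])
      show "bilinear ((*) :: complex \<Rightarrow> complex \<Rightarrow> complex)"
        using bounded_bilinear_mult bilinear_conv_bounded_bilinear by blast
      show "(\<lambda>x. inverse (P x)) \<in> borel_measurable (lebesgue_on {-r1..r1})"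
        using contP by (rule continuous_imp_measurable_on_sets_lebesgue) simp
      show "bounded ((\<lambda>x. inverse (P x)) ` {-r1..r1})"
        using contP by (intro compact_imp_bounded compact_continuous_image) auto
      show "a n absolutely_integrable_on {-r1..r1}" using a_int n by simp
    qed simp
    obtain N where N: "negligible N" "{x. \<not> (x \<in> I \<longrightarrow> (\<Prod>k=1..n. \<phi> k x) = a n x)} \<subseteq> N"
      using prod unfolding eventually_ae_filter_negligible by blast
    have "\<phi> 1 x = inverse (P x) * a n x" if "x \<in> {-r1..r1} - N" for x
    proof -
      have "(\<Prod>k=1..n. \<phi> k x) = a n x" using that N(2) r1(2) by blast
      moreover have "(\<Prod>k=1..n. \<phi> k x) = \<phi> 1 x * P x"
        unfolding P_def using n by (simp add: prod.atLeast_Suc_atMost numeral_2_eq_2)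
      ultimately have "a n x = \<phi> 1 x * P x" by simp
      moreover have "P x \<noteq> 0" using r1(3)[of x] that by blast
      ultimately show ?thesis by (simp add: field_simps)
    qed
    then show ?thesis by (rule absolutely_integrable_spike[OF quot N(1)])
  qed
  have \<phi>_int: "\<phi> m absolutely_integrable_on {-r1..r1}" if "m \<in> {1..n}" for m
  proof (cases "m = 1")
    case False
    then have "m \<in> {2..n}" using that by auto
    then show ?thesis
      by (intro absolutely_integrable_continuous_real continuous_on_subset[OF \<phi>cont r1(2)])
  qed (use \<phi>1_int in simp)
  have norm_int: "(\<lambda>t. norm (\<phi> m t)) integrable_on {-r1..r1}" if "m \<in> {1..n}" for m
    by (rule set_lebesgue_integral_eq_integral(1)[OF set_integrable_norm[OF \<phi>_int[OF that]]])
  then have sum_int: "(\<lambda>t. \<Sum>m=1..n. norm (\<phi> m t)) integrable_on {-r1..r1}"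
    by (intro integrable_sum) auto
  have half: "(0::real) < 1/2" by simp
  obtain r where "0 < r" "r \<le> r1"
      "\<And>s. \<lbrakk>0 \<le> s; s \<le> r\<rbrakk> \<Longrightarrow> integral {-s..s} (\<lambda>t. \<Sum>m=1..n. norm (\<phi> m t)) \<le> 1/2"
    by (fact small_integral[OF r1(1) sum_int half])
  then have r: "0 < r" "r \<le> r1" "integral {-r..r} (\<lambda>t. \<Sum>m=1..n. norm (\<phi> m t)) \<le> 1/2"
    by simp_all
  have \<phi>_r: "\<phi> m absolutely_integrable_on {-r..r}" if "m \<in> {1..n}" for m
    by (rule absolutely_integrable_on_subinterval[OF \<phi>_int[OF that]]) (use r in auto)
  have norm_r: "(\<lambda>t. norm (\<phi> m t)) integrable_on {-r..r}" if "m \<in> {1..n}" for m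
    by (rule set_lebesgue_integral_eq_integral(1)[OF set_integrable_norm[OF \<phi>_r[OF that]]])
  have \<phi>_small: "integral {-r..r} (\<lambda>t. norm (\<phi> m t)) \<le> 1/2" if "m \<in> {1..n}" for m
  proof -
    have "integral {-r..r} (\<lambda>t. norm (\<phi> m t)) \<le> integral {-r..r} (\<lambda>t. \<Sum>m=1..n. norm (\<phi> m t))"
    proof (rule integral_le[OF norm_r[OF that]])
      show "(\<lambda>t. \<Sum>m=1..n. norm (\<phi> m t)) integrable_on {-r..r}"
        using norm_r by (intro integrable_sum) auto
      show "norm (\<phi> m t) \<le> (\<Sum>m=1..n. norm (\<phi> m t))" for t
        using that by (intro member_le_sum) auto
    qed
    then show ?thesis using r(3) by linarith
  qed
  define \<eta> where "\<eta> = shift_perm n ^^ (k - 1)"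
  have \<eta>: "\<eta> permutes {1..n}" unfolding \<eta>_def by (rule shift_perm_power_permutes[OF n1])
  have \<eta>_in: "\<eta> i \<in> {1..n} \<longleftrightarrow> i \<in> {1..n}" for i using permutes_in_image[OF \<eta>] .
  \<comment> \<open>relabelling by \<open>\<eta>\<close> makes the coefficient in the equation for \<open>z m\<close> equal to \<open>\<phi> m\<close>\<close>
  define z where "z m = trig_T n (\<lambda>i. \<phi> (\<eta> i)) (inv \<eta> m)" for m
  have inv_in: "inv \<eta> m \<in> {1..n}" if "m \<in> {1..n}" for m
    using permutes_in_image[OF permutes_inv[OF \<eta>]] that by blast
  have \<eta>_inv: "\<eta> (inv \<eta> m) = m" for m by (rule permutes_inverses(1)[OF \<eta>])
  have shift_inv: "shift_perm n (inv \<eta> m) = inv \<eta> (shift_perm n m)" for m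
  proof -
    have "\<eta> (shift_perm n (inv \<eta> m)) = shift_perm n (\<eta> (inv \<eta> m))"
      unfolding \<eta>_def by (simp add: funpow_swap1)
    then show ?thesis using \<eta>_inv permutes_inverses(2)[OF \<eta>] by metis
  qed
  have sys: "trig_T n (\<lambda>i. \<phi> (\<eta> i)) i 0 = (if i = n then 1 else 0)"
    "(\<lambda>t. \<phi> (\<eta> i) t * trig_T n (\<lambda>i. \<phi> (\<eta> i)) (shift_perm n i) t) absolutely_integrable_on {-r..r}"
    "\<And>u v. \<lbrakk>-r \<le> u; u \<le> v; v \<le> r\<rbrakk> \<Longrightarrow> ((\<lambda>t. \<phi> (\<eta> i) t * trig_T n (\<lambda>i. \<phi> (\<eta> i)) (shift_perm n i) t)
      has_integral trig_T n (\<lambda>i. \<phi> (\<eta> i)) i v - trig_T n (\<lambda>i. \<phi> (\<eta> i)) i u) {u..v}"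
    if "i \<in> {1..n}" for i
    using r(1) \<phi>_r \<phi>_small \<eta>_in that
    by (intro trig_T_cyclic_system[OF n1, of r "\<lambda>i. \<phi> (\<eta> i)" i]; simp)+
  have z_abs: "(\<lambda>t. \<phi> m t * z (shift_perm n m) t) absolutely_integrable_on {-r..r}"
    and z_int: "\<And>u v. \<lbrakk>-r \<le> u; u \<le> v; v \<le> r\<rbrakk> \<Longrightarrow>
      ((\<lambda>t. \<phi> m t * z (shift_perm n m) t) has_integral z m v - z m u) {u..v}"
    if "m \<in> {1..n}" for m
    using sys(2,3)[OF inv_in[OF that]] unfolding z_def shift_inv \<eta>_inv by blast+
  have z_init: "z m 0 = (if m = n - (k - 1) then 1 else 0)" if "m \<in> {1..n}" for m
  proof -
    have "\<eta> n = n - (k - 1)" unfolding \<eta>_def by (rule shift_perm_power_n) (use k in auto)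
    then have "inv \<eta> m = n \<longleftrightarrow> m = n - (k - 1)" using \<eta>_inv permutes_inverses(2)[OF \<eta>] by metis
    then show ?thesis using sys(1)[OF inv_in[OF that]] by (simp add: z_def)
  qed
  let ?J = "{-r<..<r}"
  have JI: "?J \<subseteq> I" "{-r..r} \<subseteq> I" "0 \<in> ?J" "open ?J" using r r1(2) by auto
  have z_AC: "AC_on_interval (-r) r (z m)" if "m \<in> {1..n}" for m
    by (rule indefinite_integral_AC[OF z_abs[OF that] integral_unique[OF z_int[OF that], symmetric]])
  have z_deriv: "(z m has_vector_derivative \<phi> m x * z (m - 1) x) (at x)" if m: "m \<in> {2..n}" and x: "x \<in> ?J" for m x
  proof -
    have s: "shift_perm n m = m - 1" "m \<in> {1..n}" "m - 1 \<in> {1..n}" using m by (auto simp: shift_perm_def)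
    show ?thesis
    proof (rule has_vector_derivative_from_integral[OF _ _ x])
      show "((\<lambda>x. \<phi> m x * z (m - 1) x) has_integral z m v - z m u) {u..v}"
        if "-r \<le> u" "u \<le> v" "v \<le> r" for u v
        using z_int[OF s(2) that] unfolding s(1) .
      show "continuous_on {-r..r} (\<lambda>x. \<phi> m x * z (m - 1) x)"
        by (intro continuous_on_mult continuous_on_subset[OF \<phi>cont[OF m] JI(2)] AC_on_interval_continuous z_AC s(3))
    qed
  qed
  have dz: "nderiv (Suc 0) (z m) x = \<phi> m x * z (m - 1) x" if "m \<in> {2..n}" "x \<in> ?J" for m x
    using z_deriv[OF that] by (simp add: nderiv_1 vector_derivative_at)
  have \<phi>WJ: "AC_class ?J (m - 1) (\<phi> m)" if "m \<in> {2..n}" for m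
    by (rule AC_class_subset[OF \<phi>W[OF that] JI(1)])
  have zW: "AC_class ?J m (z m)" if "1 \<le> m" "m \<le> n" for m
    using that
  proof (induction m rule: dec_induct)
    case base
    have "locally_AC_on ?J (z 1)"
      unfolding locally_AC_on_def
    proof (intro allI impI)
      fix c d assume cd: "{c..d} \<subseteq> ?J"
      show "AC_on_interval c d (z 1)"
      proof (cases "c \<le> d")
        case True
        then have "c \<in> ?J" "d \<in> ?J" using cd by auto
        then show ?thesis using n by (intro AC_on_interval_subinterval[OF z_AC[of 1]]) auto
      next
        case False
        then have "\<not> (c \<le> u \<and> u \<le> v \<and> v \<le> d)" for u v by linarith
        then show ?thesis unfolding AC_on_interval_def
          by (intro allI impI exI[of _ 1]) (metis lessThan_0 less_nat_zero_code neq0_conv sum.empty zero_less_one)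
      qed
    qed
    then show ?case by (simp add: AC_class_1)
  next
    case (step m)
    then have m: "Suc m \<in> {2..n}" by auto
    have "AC_class ?J m (\<lambda>x. \<phi> (Suc m) x * z m x)"
      using \<phi>WJ[OF m] step by (intro AC_class_mult[OF JI(4)]) auto
    then have "AC_class ?J m (nderiv (Suc 0) (z (Suc m)))"
      by (rule AC_class_cong[OF JI(4), rotated]) (use dz[OF m] in simp)
    moreover have "\<forall>x\<in>?J. z (Suc m) differentiable (at x)"
      using z_deriv[OF m] by (blast intro: differentiableI_vector)
    moreover obtain m' where "m = Suc m'" using step by (cases m) auto
    ultimately show ?case by (simp add: AC_class_Suc_Suc)
  qed
  have dz1: "AE x in lebesgue. x \<in> ?J \<longrightarrow> nderiv (Suc 0) (z 1) x = \<phi> 1 x * z n x"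
  proof -
    have s: "shift_perm n 1 = n" "1 \<in> {1..n}" using n by (auto simp: shift_perm_def)
    have "AE x in lebesgue. x \<in> ?J \<longrightarrow> (z 1 has_vector_derivative \<phi> 1 x * z n x) (at x)"
      using set_lebesgue_integral_eq_integral(1)[OF z_abs[OF s(2)]] integral_unique[OF z_int[OF s(2)], symmetric]
      unfolding s(1) by (rule indefinite_integral_derivative_AE)
    then show ?thesis by eventually_elim (auto simp: nderiv_1 vector_derivative_at)
  qed
  have ode: "AE x in lebesgue. x \<in> ?J \<longrightarrow> nderiv n (z n) x = (\<Sum>j=1..n. a j x * nderiv (n - j) (z n) x)"
  proof (rule cyclic_system_solves_equation[OF JI(4) n1 \<phi>WJ _ _ _ dz dz1])
    show "AE x in lebesgue. x \<in> ?J \<longrightarrow>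
      (\<Sum>i=1..n+1. coeff_vec a i x * toeplitz_D n (\<lambda>j x. \<phi> m x * alpha n \<phi> m j x) i x) = 0"
      if "m \<in> {2..n}" for m
      using \<phi>eq[OF that] by eventually_elim (use JI(1) in blast)
    show "AE x in lebesgue. x \<in> ?J \<longrightarrow> (\<Prod>k=1..n. \<phi> k x) = a n x"
      using prod by eventually_elim (use JI(1) in blast)
  qed (use zW in auto)
  have sol: "AC_nderiv_on UNIV (n - 1) (\<psi> k)"
    "AE x in lebesgue. nderiv n (\<psi> k) x = (\<Sum>j=1..n. a j x * nderiv (n - j) (\<psi> k) x)"
    "\<And>j. j \<in> {1..n} \<Longrightarrow> nderiv (j - 1) (\<psi> k) 0 = (if j = k then 1 else 0)"
    using assms(7)[OF k] unfolding fundamental_solution_def by blast+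
  have \<psi>W: "AC_class ?J n (\<psi> k)"
    by (rule AC_class_subset[of UNIV]) (use sol(1) n in \<open>auto simp: AC_class_def\<close>)
  have \<psi>ode: "AE x in lebesgue. x \<in> ?J \<longrightarrow> nderiv n (\<psi> k) x = (\<Sum>j=1..n. a j x * nderiv (n - j) (\<psi> k) x)"
    using sol(2) by eventually_elim simp
  have init: "nderiv i (\<psi> k) 0 = nderiv i (z n) 0" if i: "i < n" for i
  proof -
    have "nderiv i (z n) 0 = z (n - i) 0"
      by (rule cyclic_system_initial_values[OF JI(4,3) \<phi>WJ jet _ dz i order_refl]) (use zW in auto)
    also have "\<dots> = (if n - i = n - (k - 1) then 1 else 0)" using i by (intro z_init) auto
    also have "\<dots> = (if Suc i = k then 1 else 0)" using i k by auto
    finally show ?thesis using sol(3)[of "Suc i"] i by simp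
  qed
  have zWn: "AC_class ?J n (z n)" using zW n by simp
  obtain \<rho> where \<rho>: "0 < \<rho>" "\<rho> < r" "\<And>x. x \<in> {-\<rho>..\<rho>} \<Longrightarrow> \<psi> k x = z n x"
    using local_uniqueness[OF n1 r(1) a_int \<psi>W \<psi>ode zWn ode init] by blast
  show "\<exists>U. open U \<and> 0 \<in> U \<and> U \<subseteq> I \<and>
    (\<forall>x\<in>U. \<psi> k x = (let \<eta> = shift_perm n ^^ (k - 1) in trig_T n (\<lambda>i. \<phi> (\<eta> i)) (inv \<eta> n) x))"
  proof (intro exI[of _ "{-\<rho><..<\<rho>}"] conjI ballI)
    show "{-\<rho><..<\<rho>} \<subseteq> I" using \<rho>(2) JI(1) by force
    show "\<psi> k x = (let \<eta> = shift_perm n ^^ (k - 1) in trig_T n (\<lambda>i. \<phi> (\<eta> i)) (inv \<eta> n) x)"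
      if "x \<in> {-\<rho><..<\<rho>}" for x
      using \<rho>(3)[of x] that by (simp add: Let_def z_def \<eta>_def)
  qed (use \<rho>(1) in auto)
qed

end
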